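(* Consider the intermediate model on $\mathbb{Z}^2$, with laws $\widetilde P_t$, $t\in[0,1]$. Let $\widetilde\theta_n(t)=\widetilde P_t(0\longleftrightarrow\partial B(n))$ and let $t_c^*=\sup\{t\in[0,1]:\widetilde P_t(0\longleftrightarrow\infty)=0\}$ be its percolation critical threshold. Then: 1. For every $t\in[0,1]$ with $t<t_c^*$, there exists $c_t>0$ such that $\widetilde\theta_n(t)\leq \exp(-c_t n)$ for all $n\geq1$. 2. There exists $c>0$ such that for every $t\in[0,1]$ with $t>t_c^*$, $\widetilde P_t(0\longleftrightarrow\infty)\geq c\,(t-t_c^* )$.
   Context: Let $\mathbb{L}^2=(\mathbb{Z}^2,\mathcal{E})$ be the square lattice with nearest-neighbour edges. For $\Gamma\subset\mathbb{Z}^2$, $\mathcal{E}(\Gamma)$ is the set of edges with both endpoints in $\Gamma$ and $\partial\Gamma$ is the set of vertices of $\Gamma$ adjacent to some vertex not in $\Gamma$. $B(n)=[-n,n]^2\cap\mathbb{Z}^2$. Intermediate model. Let $\Lambda=\{0,1,2,3,4,5\}\times\{0,1,2,3,4\}$ and $\overline\Lambda=\{1,2,3,4\}\times\{1,2,3\}$. For $(r,s)\in\mathbb{Z}^2$ put $\Lambda_{r,s}=\Lambda+(6r,5s)$, $\overline\Lambda_{r,s}=\overline\Lambda+(6r,5s)$, let $g_{r,s}=\langle(6r+2,5s+2),(6r+3,5s+2)\rangle$, and let $A_{r,s}$ be the set of edges $e\in\mathcal{E}(\overline\Lambda_{r,s})$ having exactly one endpoint in $\partial\overline\Lambda_{r,s}$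 (the six edges sharing exactly one endpoint with $g_{r,s}$). Let $U=\{U(e)\}_{e\in\mathcal{E}}$ be i.i.d. uniform on $[0,1]$ with product law $\mathbb{P}$, and let $$C_{r,s}=\Big\{U\in[0,1]^{\mathcal{E}}:\ \max_{e\in A_{r,s}}U(e)<\min_{e\in\mathcal{E}(\Lambda_{r,s})\setminus A_{r,s}}U(e)\Big\}.$$ For $t\in[0,1]$ define $\widetilde\omega_t:[0,1]^{\mathcal{E}}\to\{0,1\}^{\mathcal{E}}$ by $\widetilde\omega_{t,e}=\mathbf 1_{\{U(e)\le t\}}$ if $e\notin\bigcup_{r,s}\{g_{r,s}\}$, and $\widetilde\omega_{t,e}=\mathbf 1_{\{U(e)\le t\}}\mathbf 1_{C_{r,s}^c}$ if $e=g_{r,s}$. An edge $e$ is open if $\widetilde\omega_{t,e}=1$. Let $\widetilde P_t$ be the law of $\widetilde\omega_t$, i.e. $\widetilde P_t(A)=\mathbb{P}(\widetilde\omega_t\in A)$. $\{0\longleftrightarrow D\}$ is the event that the origin is connected by an open path to some vertex of $D$, and $\{0\longleftrightarrow\infty\}$ is the event that the open cluster of the origin is infinite. *)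

theory Defs
  imports "HOL-Probability.Probability"
begin

type_synonym vertex = "int \<times> int"
type_synonym edge = "vertex set"

definition edges :: "edge set" where
  "edges = {{(a, b), (c, d)} | a b c d. \<bar>a - c\<bar> + \<bar>b - d\<bar> = 1}"

definition edges_in :: "vertex set \<Rightarrow> edge set" where
  "edges_in \<Gamma> = {e \<in> edges. e \<subseteq> \<Gamma>}"

definition bdry :: "vertex set \<Rightarrow> vertex set" where
  "bdry \<Gamma> = {x \<in> \<Gamma>. \<exists>y. y \<notin> \<Gamma> \<and> {x, y} \<in> edges}"

definition lattice_box :: "nat \<Rightarrow> vertex set" where
  "lattice_box n = {- int n..int n} \<times> {- int n..int n}"

definition Lam :: "int \<Rightarrow> int \<Rightarrow> vertex set" where
  "Lam r s = (\<lambda>(x, y). (x + 6 * r, y + 5 * s)) ` ({0..5} \<times> {0..4})"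

definition Lam_bar :: "int \<Rightarrow> int \<Rightarrow> vertex set" where
  "Lam_bar r s = (\<lambda>(x, y). (x + 6 * r, y + 5 * s)) ` ({1..4} \<times> {1..3})"

definition g_edge :: "int \<Rightarrow> int \<Rightarrow> edge" where
  "g_edge r s = {(6 * r + 2, 5 * s + 2), (6 * r + 3, 5 * s + 2)}"

definition A_edges :: "int \<Rightarrow> int \<Rightarrow> edge set" where
  "A_edges r s = {e \<in> edges_in (Lam_bar r s). card (e \<inter> bdry (Lam_bar r s)) = 1}"

definition unif_space :: "(edge \<Rightarrow> real) measure" where
  "unif_space = PiM edges (\<lambda>_. restrict_space lborel {0..1})"

definition C_event :: "int \<Rightarrow> int \<Rightarrow> (edge \<Rightarrow> real) set" where
  "C_event r s = {U \<in> space unif_space.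
     Max (U ` A_edges r s) < Min (U ` (edges_in (Lam r s) - A_edges r s))}"

text \<open>Configurations in \<open>{0,1}\<close> to the power \<^term>\<open>edges\<close> are encoded as Boolean-valued functions
  (\<^term>\<open>True\<close> means open), extensional on \<^term>\<open>edges\<close>.\<close>

definition config_space :: "(edge \<Rightarrow> bool) measure" where
  "config_space = PiM edges (\<lambda>_. count_space UNIV)"

definition omega_tilde :: "real \<Rightarrow> (edge \<Rightarrow> real) \<Rightarrow> edge \<Rightarrow> bool" where
  "omega_tilde t U = (\<lambda>e\<in>edges. U e \<le> t \<and> (\<forall>r s. e = g_edge r s \<longrightarrow> U \<notin> C_event r s))"

definition P_tilde :: "real \<Rightarrow> (edge \<Rightarrow> bool) measure" where
  "P_tilde t = distr unif_space config_space (omega_tilde t)"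

definition open_adj :: "(edge \<Rightarrow> bool) \<Rightarrow> (vertex \<times> vertex) set" where
  "open_adj \<omega> = {(x, y). {x, y} \<in> edges \<and> \<omega> {x, y}}"

definition cluster :: "(edge \<Rightarrow> bool) \<Rightarrow> vertex set" where
  "cluster \<omega> = {x. ((0, 0), x) \<in> (open_adj \<omega>)\<^sup>*}"

definition connects_to :: "vertex set \<Rightarrow> (edge \<Rightarrow> bool) set" where
  "connects_to D = {\<omega> \<in> space config_space. \<exists>x\<in>D. x \<in> cluster \<omega>}"

definition connects_to_infinity :: "(edge \<Rightarrow> bool) set" where
  "connects_to_infinity = {\<omega> \<in> space config_space. infinite (cluster \<omega>)}"

definition theta_tilde :: "nat \<Rightarrow> real \<Rightarrow> real" where
  "theta_tilde n t = measure (P_tilde t) (connects_to (bdry (lattice_box n)))"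

definition t_c_star :: real where
  "t_c_star = Sup {t \<in> {0..1}. measure (P_tilde t) connects_to_infinity = 0}"

text \<open>The model and its events are measurable, so that \<^const>\<open>measure\<close> takes no default values above.\<close>

lemma finite_edges_in: "finite \<Gamma> \<Longrightarrow> finite (edges_in \<Gamma>)"
  by (rule finite_subset[of _ "Pow \<Gamma>"]) (auto simp: edges_in_def)

lemma finite_Lam: "finite (Lam r s)" "finite (Lam_bar r s)"
  by (auto simp: Lam_def Lam_bar_def)

lemma finite_A: "finite (A_edges r s)"
  using finite_edges_in[OF finite_Lam(2), of r s] by (auto simp: A_edges_def)

lemma measurable_edge_label: "e \<in> edges \<Longrightarrow> (\<lambda>U. U e) \<in> borel_measurable unif_space"
proof -
  assume "e \<in> edges"
  then have "(\<lambda>U. U e) \<in> measurable unif_space (restrict_space lborel {0..1::real})"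
    unfolding unif_space_def by (rule measurable_component_singleton)
  then show ?thesis by (simp add: measurable_restrict_space2_iff)
qed

lemma prob_space_unif_space: "prob_space unif_space"
  unfolding unif_space_def
  by (intro prob_space_PiM prob_space_restrict_space) auto

lemma sets_C_event: "C_event r s \<in> sets unif_space"
proof -
  have A: "A_edges r s \<subseteq> edges" "edges_in (Lam r s) - A_edges r s \<subseteq> edges"
    by (auto simp: A_edges_def edges_in_def)
  have m1: "(\<lambda>U. Max (U ` A_edges r s)) \<in> borel_measurable unif_space"
    using A(1) by (intro borel_measurable_Max finite_A measurable_edge_label) auto
  have m2: "(\<lambda>U. Min (U ` (edges_in (Lam r s) - A_edges r s))) \<in> borel_measurable unif_space"
    using A(2) by (intro borel_measurable_Min finite_Diff finite_edges_in finite_Lam measurable_edge_label) auto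
  show ?thesis unfolding C_event_def by (rule borel_measurable_less[OF m1 m2])
qed

lemma measurable_omega_tilde: "omega_tilde t \<in> measurable unif_space config_space"
  unfolding omega_tilde_def config_space_def
proof (rule measurable_restrict)
  fix e assume e: "e \<in> edges"
  have [measurable]: "(\<lambda>U. U e) \<in> borel_measurable unif_space" by (rule measurable_edge_label[OF e])
  note sets_C_event[measurable]
  show "(\<lambda>U. U e \<le> t \<and> (\<forall>r s. e = g_edge r s \<longrightarrow> U \<notin> C_event r s))
    \<in> measurable unif_space (count_space UNIV)"
    by measurable
qed

lemma prob_space_P_tilde: "prob_space (P_tilde t)"
  unfolding P_tilde_def by (rule prob_space.prob_space_distr[OF prob_space_unif_space measurable_omega_tilde])

lemma pred_open: "Measurable.pred config_space (\<lambda>\<omega>. (x,y) \<in> open_adj \<omega>)"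
proof (cases "{x,y} \<in> edges")
  case True
  then have "(\<lambda>\<omega>. \<omega> {x,y}) \<in> measurable config_space (count_space UNIV)"
    unfolding config_space_def by (rule measurable_component_singleton)
  then show ?thesis using True by (simp add: open_adj_def)
qed (simp add: open_adj_def)

lemma pred_relpow: "Measurable.pred config_space (\<lambda>\<omega>. (x,y) \<in> open_adj \<omega> ^^ n)"
proof (induction n arbitrary: y)
  case (Suc n)
  note Suc[measurable] pred_open[measurable]
  show ?case by (simp add: relcomp_unfold)
qed simp

lemma pred_cluster[measurable]: "Measurable.pred config_space (\<lambda>\<omega>. x \<in> cluster \<omega>)"
proof -
  note pred_relpow[measurable]
  show ?thesis unfolding cluster_def by (simp add: rtrancl_power)
qed

lemma sets_connects_to: "connects_to D \<in> sets config_space"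
  unfolding connects_to_def by measurable

lemma sets_connects_to_infinity: "connects_to_infinity \<in> sets config_space"
proof -
  have fs: "infinite S \<longleftrightarrow> (\<forall>n::nat. \<exists>x\<in>S. x \<notin> lattice_box n)" for S
  proof
    assume "infinite S"
    have "finite (lattice_box n)" for n by (simp add: lattice_box_def)
    with \<open>infinite S\<close> show "\<forall>n::nat. \<exists>x\<in>S. x \<notin> lattice_box n" by (meson finite_subset subsetI)
  next
    assume *: "\<forall>n::nat. \<exists>x\<in>S. x \<notin> lattice_box n"
    show "infinite S"
    proof
      assume f: "finite S"
      define N where "N = (\<Sum>(x,y)\<in>S. nat \<bar>x\<bar> + nat \<bar>y\<bar>)"
      have "S \<subseteq> lattice_box N"
      proof
        fix p assume p: "p \<in> S"
        obtain x y where xy: "p = (x,y)" by (cases p)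
        have "nat \<bar>x\<bar> + nat \<bar>y\<bar> \<le> N"
          using member_le_sum[OF p, of "\<lambda>(x,y). nat \<bar>x\<bar> + nat \<bar>y\<bar>"] f xy by (auto simp: N_def)
        then show "p \<in> lattice_box N" by (auto simp: xy lattice_box_def)
      qed
      with * show False by blast
    qed
  qed
  have "{\<omega> \<in> space config_space. \<forall>n::nat. \<exists>x. x \<in> cluster \<omega> \<and> x \<notin> lattice_box n} \<in> sets config_space"
    by measurable
  then show ?thesis by (simp add: connects_to_infinity_def fs Bex_def)
qed

end

theory Submission
  imports Defs "HOL-Real_Asymp.Real_Asymp"
begin

text \<open>Partition the edges into blocks such that the state of each gate \<open>g\<^bsub>r,s\<^esub>\<close> is
  determined inside one block. The configurations of distinct blocks are then independent, and the argument of
  Duminil-Copin, Raoufi and Tassion applies with blocks in the role of edges. Exploring the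
  clusters of \<open>\<partial>B(k)\<close> for \<open>k = 1, \<dots>, n\<close> and averaging the OSSS inequality over \<open>k\<close> gives
  \<open>n \<theta>\<^sub>n (1 - \<theta>\<^sub>n) \<le> C (\<theta>\<^sub>0 + \<dots> + \<theta>\<^bsub>n-1\<^esub>) \<Sigma>\<^sub>b P(b is pivotal)\<close>. The sum over pivotal blocks is
  bounded by a multiple of the derivative of \<open>\<theta>\<^sub>n\<close>, because an increasing event that is not constant
  on a block is entered at positive rate: let \<open>g\<close> open first in its block, so that the gate never
  closes. Derivatives are avoided throughout in favour of increments with a quadratic error. The
  constants degenerate only at \<open>t = 0\<close> and \<open>t = 1\<close>; a count of self-avoiding walks keeps the
  threshold away from \<open>0\<close>.\<close>

section \<open>Products of finite weights and the OSSS inequality\<close>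

text \<open>Whether a gate closes is decided by the labels alone and never changes with
  \<open>t\<close>. This makes the configuration increasing in \<open>t\<close>, but a block in
  which the six edges around the gate get the smallest labels of \<Lambda> never becomes fully open.
  The edges of a block are thus dependent, and a gate can be pivotal while being unable to open. For
  this reason a block is called pivotal when its two extreme states, all closed and all open, decide
  the event, and the increasing route between these states is made to begin with the gate. The law
  is invariant only under shifts by \<open>(6 r, 5 s)\<close>. A connection from an arbitrary vertex
  is moved to the block of the origin and joined to the origin by opening that block, which costs a
  factor \<open>(t / 2) ^ 60\<close> and five units of distance. The quadratic error of the
  increments may depend on \<open>n\<close> in any way: \<open>n\<close> is fixed when the parameter
  interval is subdivided, and the error vanishes with the mesh.\<close>

definition depends_on :: "'i set \<Rightarrow> (('i \<Rightarrow> 'a) \<Rightarrow> 'b) \<Rightarrow> bool" where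
  "depends_on L h \<longleftrightarrow> (\<forall>x y. (\<forall>i\<in>L. x i = y i) \<longrightarrow> h x = h y)"

locale finite_product =
  fixes A :: "'i \<Rightarrow> 'a set" and w :: "'i \<Rightarrow> 'a \<Rightarrow> real"
  assumes finite_A: "finite (A i)"
    and w_nonneg: "0 \<le> w i a"
    and w_sum: "(\<Sum>a\<in>A i. w i a) = 1"
begin

definition completions :: "'i set \<Rightarrow> ('i \<Rightarrow> 'a) \<Rightarrow> ('i \<Rightarrow> 'a) set" where
  "completions L x = {y. (\<forall>i\<in>L. y i \<in> A i) \<and> (\<forall>i. i \<notin> L \<longrightarrow> y i = x i)}"

text \<open>Conditional expectation: the coordinates in \<open>L\<close> are averaged and the others
  stay frozen at \<open>x\<close>. Fixing one more coordinate means moving it from \<open>L\<close>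
  into \<open>x\<close>, which is the shape of the inductions below.\<close>

definition expect :: "'i set \<Rightarrow> (('i \<Rightarrow> 'a) \<Rightarrow> real) \<Rightarrow> ('i \<Rightarrow> 'a) \<Rightarrow> real" where
  "expect L h x = (\<Sum>y\<in>completions L x. (\<Prod>i\<in>L. w i (y i)) * h y)"

text \<open>For an indicator \<open>h\<close> this is the probability that replacing coordinate
  \<open>i\<close> by an independent copy changes \<open>h\<close>.\<close>

definition influence :: "'i set \<Rightarrow> 'i \<Rightarrow> (('i \<Rightarrow> 'a) \<Rightarrow> real) \<Rightarrow> ('i \<Rightarrow> 'a) \<Rightarrow> real" where
  "influence L i h = expect L (\<lambda>y. \<Sum>a\<in>A i. w i a * \<bar>h y - h (y(i := a))\<bar>)"

lemma completions_insert:
  assumes "b \<notin> L"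
  shows "completions (insert b L) x = (\<Union>a\<in>A b. completions L (x(b := a)))"
  using assms by (auto simp: completions_def fun_upd_def)

lemma finite_completions: "finite L \<Longrightarrow> finite (completions L x)"
proof (induction L arbitrary: x rule: finite_induct)
  case empty
  have "completions {} x = {x}" by (auto simp: completions_def)
  then show ?case by simp
qed (simp add: completions_insert finite_A)

lemma expect_empty [simp]: "expect {} h x = h x"
proof -
  have "completions {} x = {x}" by (auto simp: completions_def)
  then show ?thesis by (simp add: expect_def)
qed

lemma expect_insert:
  assumes "finite L" "b \<notin> L"
  shows "expect (insert b L) h x = (\<Sum>a\<in>A b. w b a * expect L h (x(b := a)))"
proof -
  have "expect (insert b L) h x
      = (\<Sum>a\<in>A b. \<Sum>y\<in>completions L (x(b := a)). (\<Prod>i\<in>insert b L. w i (y i)) * h y)"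
    unfolding expect_def completions_insert[OF assms(2)]
  proof (rule sum.UNION_disjoint)
    show "\<forall>a\<in>A b. \<forall>a'\<in>A b. a \<noteq> a' \<longrightarrow>
        completions L (x(b := a)) \<inter> completions L (x(b := a')) = {}"
    proof (intro ballI impI equals0I)
      fix a a' y
      assume *: "a \<noteq> a'" "y \<in> completions L (x(b := a)) \<inter> completions L (x(b := a'))"
      then have "y b = a" "y b = a'" using assms(2) by (auto simp: completions_def)
      with * show False by simp
    qed
  qed (simp_all add: finite_A finite_completions assms)
  also have "\<dots> = (\<Sum>a\<in>A b. w b a * expect L h (x(b := a)))"
  proof (rule sum.cong[OF refl])
    fix a assume "a \<in> A b"
    have "(\<Prod>i\<in>insert b L. w i (y i)) = w b a * (\<Prod>i\<in>L. w i (y i))"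
      if "y \<in> completions L (x(b := a))" for y
    proof -
      have "y b = a" using that assms(2) by (auto simp: completions_def)
      then show ?thesis using assms by simp
    qed
    then show "(\<Sum>y\<in>completions L (x(b := a)). (\<Prod>i\<in>insert b L. w i (y i)) * h y)
        = w b a * expect L h (x(b := a))"
      by (simp add: expect_def sum_distrib_left mult.assoc)
  qed
  finally show ?thesis .
qed

text \<open>\<open>override_on x z L\<close> has the values of \<open>z\<close> on \<open>L\<close>
  and those of \<open>x\<close> elsewhere, so all completions have this form. Two frozen backgrounds
  are compared at once; independence of the background and the resampling identity both come from
  here.\<close>

lemma expect_cong_override:
  assumes "finite L" "\<And>z. h (override_on x z L) = h' (override_on x' z L)"
  shows "expect L h x = expect L h' x'"
  using assms
proof (induction L arbitrary: x x' rule: finite_induct)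
  case empty
  then show ?case by simp
next
  case (insert b L)
  have *: "override_on (x(b := a)) z L = override_on x (z(b := a)) (insert b L)" for x z :: "'i \<Rightarrow> 'a" and a
    using insert.hyps by (auto simp: override_on_def)
  have "expect L h (x(b := a)) = expect L h' (x'(b := a))" for a
    by (rule insert.IH) (unfold *, rule insert.prems)
  then show ?case by (simp add: expect_insert insert.hyps)
qed

lemma expect_depends:
  assumes "finite L" "depends_on L h"
  shows "expect L h x = expect L h x'"
  using assms(1)
proof (rule expect_cong_override)
  fix z
  show "h (override_on x z L) = h (override_on x' z L)"
    using assms(2) by (simp add: depends_on_def override_on_def)
qed

lemma expect_update:
  assumes "finite L" "b \<notin> L" "\<And>y a. h (y(b := a)) = h y"
  shows "expect L h (x(b := a)) = expect L h x"
  using assms(1)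
proof (rule expect_cong_override)
  fix z
  have "override_on (x(b := a)) z L = (override_on x z L)(b := a)"
    using assms(2) by (auto simp: override_on_def)
  then show "h (override_on (x(b := a)) z L) = h (override_on x z L)"
    by (simp add: assms(3))
qed

lemma expect_mono:
  assumes "\<And>y. y \<in> completions L x \<Longrightarrow> h y \<le> h' y"
  shows "expect L h x \<le> expect L h' x"
  unfolding expect_def by (intro sum_mono mult_left_mono assms prod_nonneg w_nonneg ballI)

lemma expect_cong:
  assumes "\<And>y. y \<in> completions L x \<Longrightarrow> h y = h' y"
  shows "expect L h x = expect L h' x"
  unfolding expect_def by (intro sum.cong) (auto simp: assms)

lemma expect_diff: "expect L (\<lambda>y. h y - h' y) x = expect L h x - expect L h' x"
  by (simp add: expect_def right_diff_distrib sum_subtractf)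

lemma expect_cmult: "expect L (\<lambda>y. c * h y) x = c * expect L h x"
  by (simp add: expect_def sum_distrib_left mult.left_commute)

lemma expect_sum: "expect L (\<lambda>y. \<Sum>k\<in>S. h k y) x = (\<Sum>k\<in>S. expect L (h k) x)"
  unfolding expect_def sum_distrib_left by (rule sum.swap)

lemma expect_const: "finite L \<Longrightarrow> expect L (\<lambda>_. c) x = c"
proof (induction L arbitrary: x rule: finite_induct)
  case (insert b L)
  then show ?case by (simp add: expect_insert sum_distrib_right[symmetric] w_sum)
qed simp

lemma expect_nonneg: "(\<And>y. y \<in> completions L x \<Longrightarrow> 0 \<le> h y) \<Longrightarrow> 0 \<le> expect L h x"
  unfolding expect_def by (intro sum_nonneg mult_nonneg_nonneg prod_nonneg w_nonneg ballI)

lemma expect_le_const: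
  assumes "finite L" "\<And>y. y \<in> completions L x \<Longrightarrow> h y \<le> c"
  shows "expect L h x \<le> c"
  using expect_mono[of L x h "\<lambda>_. c"] assms by (simp add: expect_const)

lemma abs_expect_le: "\<bar>expect L h x\<bar> \<le> expect L (\<lambda>y. \<bar>h y\<bar>) x"
  unfolding expect_def
  by (rule order_trans[OF sum_abs])
     (auto intro!: sum_mono simp: abs_mult prod_nonneg w_nonneg)

text \<open>The second draw of coordinate \<open>b\<close> overwrites the first, whose weights add
  up to one.\<close>

lemma expect_resample:
  assumes "finite L" "b \<in> L"
  shows "expect L h x = expect L (\<lambda>y. \<Sum>a\<in>A b. w b a * h (y(b := a))) x"
proof -
  define L' where "L' = L - {b}"
  have L: "L = insert b L'" "b \<notin> L'" "finite L'" using assms by (auto simp: L'_def)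
  have "expect L' (\<lambda>y. h (y(b := a))) (x(b := a')) = expect L' h (x(b := a))" for a a'
  proof (rule expect_cong_override)
    fix z
    have "(override_on (x(b := a')) z L')(b := a) = override_on (x(b := a)) z L'"
      using L(2) by (auto simp: override_on_def)
    then show "h ((override_on (x(b := a')) z L')(b := a)) = h (override_on (x(b := a)) z L')"
      by simp
  qed (rule L(3))
  then show ?thesis
    unfolding L(1) expect_insert[OF L(3,2)] expect_sum expect_cmult
    by (simp add: sum_distrib_right[symmetric] w_sum)
qed

end

locale finite_product_bot = finite_product A w
  for A :: "'i \<Rightarrow> 'a :: order_bot set" and w :: "'i \<Rightarrow> 'a \<Rightarrow> real"
begin

text \<open>The exploration reveals coordinates one at a time; each revealed coordinate of \<open>h\<close> is
  replaced by an independent copy, i.e. averaged out, at the cost of one influence.\<close>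

lemma OSSS_state:
  assumes "finite L"
    and J_mono: "\<And>x y. x \<le> y \<Longrightarrow> J x \<subseteq> J y"
    and f_local: "\<And>x y. (\<And>i. i \<in> J x \<Longrightarrow> y i = x i) \<Longrightarrow> f y = f x"
    and f_bound: "\<And>y. 0 \<le> f y \<and> f y \<le> 1"
    and "depends_on L h"
  shows "\<bar>expect L (\<lambda>y. h y * f y) x - expect L h x * expect L f x\<bar>
    \<le> (\<Sum>i\<in>L. expect L (\<lambda>y. of_bool (i \<in> J y)) x * influence L i h x)"
  using assms(1,5)
proof (induction L arbitrary: x h rule: finite_psubset_induct)
  case (psubset L)
  \<comment> \<open>Since \<open>J\<close> is increasing and \<open>x0\<close> lies below every
    completion, the coordinates in \<open>J x0\<close> are explored whatever the unrevealed values
    are. So \<open>J x0\<close> serves as the rule for the next query. When it contains no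
    unrevealed coordinate, \<open>f_local\<close> makes \<open>f\<close> constant on the
    completions.\<close>
  define x0 where "x0 = override_on x (\<lambda>_. bot) L"
  have le: "x0 \<le> y" if "y \<in> completions L x" for y
    using that by (auto simp: x0_def completions_def override_on_def le_fun_def)
  show ?case
  proof (cases "J x0 \<inter> L = {}")
    case True
    have f: "f y = f x0" if "y \<in> completions L x" for y
    proof (rule f_local)
      fix i assume "i \<in> J x0"
      with True have "i \<notin> L" by auto
      then show "y i = x0 i" using that by (auto simp: x0_def completions_def)
    qed
    have "expect L (\<lambda>y. h y * f y) x = expect L (\<lambda>y. f x0 * h y) x" "expect L f x = expect L (\<lambda>_. f x0) x"
      by (auto intro!: expect_cong simp: f)
    then have "expect L (\<lambda>y. h y * f y) x - expect L h x * expect L f x = 0"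
      using psubset.hyps by (simp add: expect_cmult expect_const)
    moreover have "0 \<le> (\<Sum>i\<in>L. expect L (\<lambda>y. of_bool (i \<in> J y)) x * influence L i h x)"
      unfolding influence_def
      by (intro sum_nonneg mult_nonneg_nonneg expect_nonneg) (auto intro: w_nonneg)
    ultimately show ?thesis by simp
  next
    case False
    then obtain b where b: "b \<in> J x0" "b \<in> L" by auto
    define L' where "L' = L - {b}"
    have L: "L = insert b L'" "b \<notin> L'" "finite L'" and sub: "L' \<subset> L"
      using b psubset.hyps by (auto simp: L'_def)
    define h' where "h' y = (\<Sum>a\<in>A b. w b a * h (y(b := a)))" for y
    have dep': "depends_on L' h'"
      unfolding depends_on_def
    proof (intro allI impI)
      fix y z :: "'i \<Rightarrow> 'a"
      assume "\<forall>i\<in>L'. y i = z i"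
      then have "h (y(b := a)) = h (z(b := a))" for a
        using psubset.prems by (auto simp: depends_on_def L(1))
      then show "h' y = h' z" by (simp add: h'_def)
    qed
    have h'_upd: "h' (y(b := a)) = h' y" for y a by (simp add: h'_def)
    define X where "X a = x(b := a)" for a
    let ?P = "\<lambda>i y. of_bool (i \<in> J y) :: real"
    have split: "expect L k x = (\<Sum>a\<in>A b. w b a * expect L' k (X a))" for k
      unfolding L(1) X_def by (rule expect_insert[OF L(3,2)])
    have Eh': "expect L' h' (X a) = expect L h x" for a
    proof -
      have "expect L h x = expect L h' x" unfolding h'_def by (rule expect_resample[OF psubset.hyps b(2)])
      also have "\<dots> = (\<Sum>a'\<in>A b. w b a' * expect L' h' (X a))"
        unfolding split by (intro sum.cong refl arg_cong2[where f = "(*)"] expect_depends L(3) dep')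
      finally show ?thesis by (simp add: sum_distrib_right[symmetric] w_sum)
    qed
    \<comment> \<open>Averaging out \<open>b\<close> can only lower an influence, because the
      absolute value of a mean is at most the mean of the absolute values. Hence the influences of
      the original \<open>h\<close> can be kept through the induction.\<close>
    have infl: "influence L' i h' (X a) \<le> influence L i h x" if "i \<in> L'" for i a
    proof -
      let ?g = "\<lambda>y. \<Sum>a\<in>A i. w i a * \<bar>h y - h (y(i := a))\<bar>"
      have ib: "i \<noteq> b" using that L(2) by auto
      have "influence L' i h' (X a) \<le> expect L' (\<lambda>y. \<Sum>a\<in>A b. w b a * ?g (y(b := a))) (X a)"
        unfolding influence_def
      proof (rule expect_mono)
        fix y
        have "\<bar>h' y - h' (y(i := a'))\<bar> \<le> (\<Sum>a\<in>A b. w b a * \<bar>h (y(b := a)) - h (y(b := a, i := a'))\<bar>)" for a'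
        proof -
          have "h' y - h' (y(i := a')) = (\<Sum>a\<in>A b. w b a * (h (y(b := a)) - h (y(b := a, i := a'))))"
            using ib by (simp add: h'_def sum_subtractf[symmetric] right_diff_distrib fun_upd_twist)
          also have "\<bar>\<dots>\<bar> \<le> (\<Sum>a\<in>A b. \<bar>w b a * (h (y(b := a)) - h (y(b := a, i := a')))\<bar>)"
            by (rule sum_abs)
          finally show ?thesis unfolding abs_mult abs_of_nonneg[OF w_nonneg] .
        qed
        then have "(\<Sum>a'\<in>A i. w i a' * \<bar>h' y - h' (y(i := a'))\<bar>)
          \<le> (\<Sum>a'\<in>A i. w i a' * (\<Sum>a\<in>A b. w b a * \<bar>h (y(b := a)) - h (y(b := a, i := a'))\<bar>))"
          by (intro sum_mono mult_left_mono w_nonneg)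
        also have "\<dots> = (\<Sum>a\<in>A b. w b a * ?g (y(b := a)))"
          unfolding sum_distrib_left by (subst sum.swap) (simp add: mult.left_commute)
        finally show "(\<Sum>a'\<in>A i. w i a' * \<bar>h' y - h' (y(i := a'))\<bar>)
          \<le> (\<Sum>a\<in>A b. w b a * ?g (y(b := a)))" .
      qed
      also have "\<dots> = expect L' (\<lambda>y. \<Sum>a\<in>A b. w b a * ?g (y(b := a))) x" unfolding X_def
        by (rule expect_update[OF L(3,2)]) simp
      also have "\<dots> = expect L (\<lambda>y. \<Sum>a\<in>A b. w b a * ?g (y(b := a))) x" unfolding L(1)
        by (subst expect_insert[OF L(3,2)], subst expect_update[OF L(3,2)])
           (simp_all add: sum_distrib_right[symmetric] w_sum)
      also have "\<dots> = influence L i h x" unfolding influence_def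
        by (rule expect_resample[OF psubset.hyps b(2), symmetric])
      finally show ?thesis .
    qed
    \<comment> \<open>Replacing \<open>h\<close> by its average over \<open>b\<close> while
      \<open>f\<close> still sees the true value costs at most the influence of \<open>b\<close>,
      because \<open>f\<close> lies in \<open>[0, 1]\<close>.\<close>
    have first: "\<bar>expect L (\<lambda>y. h y * f y) x - (\<Sum>a\<in>A b. w b a * expect L' (\<lambda>y. h' y * f y) (X a))\<bar>
      \<le> influence L b h x"
    proof -
      have "expect L (\<lambda>y. h y * f y) x - (\<Sum>a\<in>A b. w b a * expect L' (\<lambda>y. h' y * f y) (X a))
        = expect L (\<lambda>y. (h y - h' y) * f y) x"
        unfolding split by (simp add: left_diff_distrib expect_diff right_diff_distrib sum_subtractf)
      also have "\<bar>\<dots>\<bar> \<le> expect L (\<lambda>y. \<bar>(h y - h' y) * f y\<bar>) x" by (rule abs_expect_le)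
      also have "\<dots> \<le> influence L b h x" unfolding influence_def
      proof (rule expect_mono)
        fix y
        have "\<bar>(h y - h' y) * f y\<bar> \<le> \<bar>h y - h' y\<bar> * 1"
          unfolding abs_mult using f_bound[of y] by (intro mult_left_mono) auto
        also have "\<bar>h y - h' y\<bar> * 1 \<le> (\<Sum>a\<in>A b. w b a * \<bar>h y - h (y(b := a))\<bar>)"
        proof -
          have "h y - h' y = (\<Sum>a\<in>A b. w b a * (h y - h (y(b := a))))"
            by (simp add: h'_def right_diff_distrib sum_subtractf sum_distrib_right[symmetric] w_sum)
          also have "\<bar>\<dots>\<bar> \<le> (\<Sum>a\<in>A b. \<bar>w b a * (h y - h (y(b := a)))\<bar>)" by (rule sum_abs)
          finally show ?thesis unfolding abs_mult abs_of_nonneg[OF w_nonneg] by simp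
        qed
        finally show "\<bar>(h y - h' y) * f y\<bar> \<le> (\<Sum>a\<in>A b. w b a * \<bar>h y - h (y(b := a))\<bar>)" .
      qed
      finally show ?thesis .
    qed
    have second: "\<bar>expect L' (\<lambda>y. h' y * f y) (X a) - expect L h x * expect L' f (X a)\<bar>
        \<le> (\<Sum>i\<in>L'. expect L' (?P i) (X a) * influence L i h x)" for a
    proof -
      have "\<bar>expect L' (\<lambda>y. h' y * f y) (X a) - expect L' h' (X a) * expect L' f (X a)\<bar>
        \<le> (\<Sum>i\<in>L'. expect L' (?P i) (X a) * influence L' i h' (X a))"
        by (rule psubset.IH[OF sub dep'])
      also have "\<dots> \<le> (\<Sum>i\<in>L'. expect L' (?P i) (X a) * influence L i h x)"
        by (intro sum_mono mult_left_mono infl expect_nonneg) auto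
      finally show ?thesis unfolding Eh' .
    qed
    have eq: "expect L (\<lambda>y. h y * f y) x - expect L h x * expect L f x
      = (expect L (\<lambda>y. h y * f y) x - (\<Sum>a\<in>A b. w b a * expect L' (\<lambda>y. h' y * f y) (X a)))
       + (\<Sum>a\<in>A b. w b a * (expect L' (\<lambda>y. h' y * f y) (X a) - expect L h x * expect L' f (X a)))"
      unfolding split[of f]
      by (simp add: right_diff_distrib sum_subtractf sum_distrib_left mult.left_commute)
    have "\<bar>expect L (\<lambda>y. h y * f y) x - expect L h x * expect L f x\<bar> \<le> influence L b h x
       + (\<Sum>a\<in>A b. w b a * (\<Sum>i\<in>L'. expect L' (?P i) (X a) * influence L i h x))"
      unfolding eq
    proof (rule order_trans[OF abs_triangle_ineq], rule add_mono[OF first])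
      have "\<bar>\<Sum>a\<in>A b. w b a * (expect L' (\<lambda>y. h' y * f y) (X a) - expect L h x * expect L' f (X a))\<bar>
        \<le> (\<Sum>a\<in>A b. \<bar>w b a * (expect L' (\<lambda>y. h' y * f y) (X a) - expect L h x * expect L' f (X a))\<bar>)"
        by (rule sum_abs)
      also have "\<dots> \<le> (\<Sum>a\<in>A b. w b a * (\<Sum>i\<in>L'. expect L' (?P i) (X a) * influence L i h x))"
        unfolding abs_mult abs_of_nonneg[OF w_nonneg]
        by (intro sum_mono mult_left_mono w_nonneg second)
      finally show "\<bar>\<Sum>a\<in>A b. w b a * (expect L' (\<lambda>y. h' y * f y) (X a) - expect L h x * expect L' f (X a))\<bar>
        \<le> (\<Sum>a\<in>A b. w b a * (\<Sum>i\<in>L'. expect L' (?P i) (X a) * influence L i h x))" .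
    qed
    also have "\<dots> = (\<Sum>i\<in>L. expect L (?P i) x * influence L i h x)"
    proof -
      have "(\<Sum>a\<in>A b. w b a * (\<Sum>i\<in>L'. expect L' (?P i) (X a) * influence L i h x))
        = (\<Sum>i\<in>L'. \<Sum>a\<in>A b. w b a * (expect L' (?P i) (X a) * influence L i h x))"
        by (subst sum.swap) (simp only: sum_distrib_left)
      also have "\<dots> = (\<Sum>i\<in>L'. expect L (?P i) x * influence L i h x)"
        unfolding split by (simp only: sum_distrib_right mult.assoc)
      \<comment> \<open>The influence of \<open>b\<close> entered with coefficient 1. This is the
        revelation probability of \<open>b\<close>, which is explored in every completion.\<close>
      moreover have "expect L (?P b) x = expect L (\<lambda>_. 1) x"
      proof (rule expect_cong)
        fix y assume "y \<in> completions L x"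
        with b(1) J_mono[OF le] have "b \<in> J y" by blast
        then show "?P b y = 1" by simp
      qed
      then have "expect L (?P b) x = 1" using psubset.hyps by (simp add: expect_const)
      moreover have "(\<Sum>i\<in>L. expect L (?P i) x * influence L i h x) = expect L (?P b) x * influence L b h x
          + (\<Sum>i\<in>L'. expect L (?P i) x * influence L i h x)"
        using sum.insert[OF L(3,2), of "\<lambda>i. expect L (?P i) x * influence L i h x"] by (simp only: L(1))
      ultimately show ?thesis by (simp only: mult_1)
    qed
    finally show ?thesis .
  qed
qed

end

text \<open>Changing the weights from \<open>w\<close> to \<open>w'\<close> raises the mean of \<open>f\<close> by
  a constant times \<open>\<eta>\<close> for every coordinate that is pivotal, up to an error of order \<open>\<eta>\<^sup>2\<close>
  that is uniform in the weights.\<close>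

lemma expect_increment:
  fixes f :: "('i \<Rightarrow> 'a) \<Rightarrow> real" and piv :: "'i \<Rightarrow> ('i \<Rightarrow> 'a) \<Rightarrow> real"
  assumes "finite L" "0 \<le> c" "0 \<le> \<kappa>"
    and piv01: "\<And>i y. 0 \<le> piv i y \<and> piv i y \<le> 1"
    and piv_upd: "\<And>i y a. piv i (y(i := a)) = piv i y"
  shows "\<exists>K\<ge>0. \<forall>w w' \<eta> x. finite_product A w \<longrightarrow> finite_product A w' \<longrightarrow> 0 \<le> \<eta> \<longrightarrow>
      (\<forall>i\<in>L. \<forall>a\<in>A i. \<bar>w' i a - w i a\<bar> \<le> \<kappa> * \<eta>) \<longrightarrow>
      (\<forall>i\<in>L. \<forall>y. c * \<eta> * piv i y \<le> (\<Sum>a\<in>A i. (w' i a - w i a) * f (y(i := a)))) \<longrightarrow>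
      c * \<eta> * (\<Sum>i\<in>L. finite_product.expect A w L (piv i) x) - K * \<eta>\<^sup>2
        \<le> finite_product.expect A w' L f x - finite_product.expect A w L f x"
  using assms(1)
proof (induction L rule: finite_induct)
  case empty
  have "finite_product.expect A w {} f x = f x" if "finite_product A w" for w :: "'i \<Rightarrow> 'a \<Rightarrow> real" and x
    by (rule finite_product.expect_empty[OF that])
  then show ?case by (intro exI[of _ 0]) simp
next
  case (insert b L)
  obtain K where K: "0 \<le> K" and IH: "\<And>w w' \<eta> x. \<lbrakk>finite_product A w; finite_product A w'; 0 \<le> \<eta>;
      \<forall>i\<in>L. \<forall>a\<in>A i. \<bar>w' i a - w i a\<bar> \<le> \<kappa> * \<eta>;
      \<forall>i\<in>L. \<forall>y. c * \<eta> * piv i y \<le> (\<Sum>a\<in>A i. (w' i a - w i a) * f (y(i := a)))\<rbrakk> \<Longrightarrow>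
      c * \<eta> * (\<Sum>i\<in>L. finite_product.expect A w L (piv i) x) - K * \<eta>\<^sup>2
        \<le> finite_product.expect A w' L f x - finite_product.expect A w L f x"
  proof -
    from insert.IH obtain K where "0 \<le> K" and *: "\<forall>w w' \<eta> x. finite_product A w \<longrightarrow> finite_product A w' \<longrightarrow> 0 \<le> \<eta> \<longrightarrow>
      (\<forall>i\<in>L. \<forall>a\<in>A i. \<bar>w' i a - w i a\<bar> \<le> \<kappa> * \<eta>) \<longrightarrow>
      (\<forall>i\<in>L. \<forall>y. c * \<eta> * piv i y \<le> (\<Sum>a\<in>A i. (w' i a - w i a) * f (y(i := a)))) \<longrightarrow>
      c * \<eta> * (\<Sum>i\<in>L. finite_product.expect A w L (piv i) x) - K * \<eta>\<^sup>2
        \<le> finite_product.expect A w' L f x - finite_product.expect A w L f x"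
      by (elim exE conjE)
    show thesis by (rule that[OF \<open>0 \<le> K\<close> *[rule_format]]) simp_all
  qed
  define N where "N = real (card (A b))"
  \<comment> \<open>In coordinate \<open>b\<close> the weights are already \<open>w'\<close>,
    whereas the pivotal probabilities are wanted under \<open>w\<close>. The exchange costs at most
    \<open>N * \<kappa> * \<eta>\<close> for each coordinate of \<open>L\<close>, and it multiplies
    a gain of size \<open>c * \<eta>\<close>.\<close>
  define K' where "K' = K + c * real (card L) * (N * \<kappa>)"
  show ?case
  proof (intro exI[of _ K'] conjI allI impI)
    show "0 \<le> K'" using K assms(2,3) by (simp add: K'_def N_def)
  next
    fix w w' :: "'i \<Rightarrow> 'a \<Rightarrow> real" and \<eta> and x :: "'i \<Rightarrow> 'a"
    assume fp: "finite_product A w" "finite_product A w'" and \<eta>: "0 \<le> \<eta>"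
      and close: "\<forall>i\<in>insert b L. \<forall>a\<in>A i. \<bar>w' i a - w i a\<bar> \<le> \<kappa> * \<eta>"
      and gain: "\<forall>i\<in>insert b L. \<forall>y. c * \<eta> * piv i y \<le> (\<Sum>a\<in>A i. (w' i a - w i a) * f (y(i := a)))"
    interpret W: finite_product A w by (rule fp(1))
    interpret W': finite_product A w' by (rule fp(2))
    define X where "X a = x(b := a)" for a
    have split: "W.expect (insert b L) k x = (\<Sum>a\<in>A b. w b a * W.expect L k (X a))"
      "W'.expect (insert b L) k x = (\<Sum>a\<in>A b. w' b a * W'.expect L k (X a))" for k
      unfolding X_def using insert.hyps by (rule W.expect_insert, rule W'.expect_insert)
    have one: "c * \<eta> * (\<Sum>i\<in>L. W.expect L (piv i) (X a)) - K * \<eta>\<^sup>2 + W.expect L f (X a) \<le> W'.expect L f (X a)" for a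
      using IH[OF fp \<eta>, of "X a"] close gain by simp
    have cmp: "W.expect (insert b L) (piv i) x - N * \<kappa> * \<eta> \<le> (\<Sum>a\<in>A b. w' b a * W.expect L (piv i) (X a))" for i
    proof -
      have "(\<Sum>a\<in>A b. w b a * W.expect L (piv i) (X a)) - (\<Sum>a\<in>A b. w' b a * W.expect L (piv i) (X a))
        = (\<Sum>a\<in>A b. (w b a - w' b a) * W.expect L (piv i) (X a))"
        by (simp add: left_diff_distrib sum_subtractf)
      also have "\<dots> \<le> (\<Sum>a\<in>A b. \<kappa> * \<eta> * 1)"
      proof (rule sum_mono)
        fix a assume a: "a \<in> A b"
        have E: "0 \<le> W.expect L (piv i) (X a)" "W.expect L (piv i) (X a) \<le> 1"
          using piv01 insert.hyps(1) by (auto intro!: W.expect_nonneg W.expect_le_const)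
        have "(w b a - w' b a) * W.expect L (piv i) (X a) \<le> \<bar>w' b a - w b a\<bar> * W.expect L (piv i) (X a)"
          using E by (intro mult_right_mono) auto
        also have "\<dots> \<le> \<kappa> * \<eta> * 1"
          using E close a by (intro mult_mono) (auto intro: order_trans[OF abs_ge_zero])
        finally show "(w b a - w' b a) * W.expect L (piv i) (X a) \<le> \<kappa> * \<eta> * 1" .
      qed
      finally show ?thesis unfolding split(1) by (simp add: N_def)
    qed
    \<comment> \<open>Only the weights of coordinate \<open>b\<close> change here. Since
      \<open>piv b\<close> does not depend on that coordinate, the gain hypothesis can be averaged
      over the remaining ones.\<close>
    have base: "c * \<eta> * W.expect (insert b L) (piv b) x
        \<le> (\<Sum>a\<in>A b. w' b a * W.expect L f (X a)) - W.expect (insert b L) f x"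
    proof -
      have ov: "W.expect L f (X a) = W.expect L (\<lambda>y. f (y(b := a))) x" for a
        using insert.hyps(1)
      proof (rule W.expect_cong_override)
        fix z
        have "override_on (X a) z L = (override_on x z L)(b := a)"
          using insert.hyps(2) by (auto simp: override_on_def X_def)
        then show "f (override_on (X a) z L) = f ((override_on x z L)(b := a))" by simp
      qed
      have pv: "W.expect L (piv b) (X a) = W.expect L (piv b) x" for a
        unfolding X_def by (rule W.expect_update[OF insert.hyps piv_upd])
      have "c * \<eta> * W.expect (insert b L) (piv b) x = W.expect L (\<lambda>y. c * \<eta> * piv b y) x"
        by (simp add: split(1) pv W.expect_cmult sum_distrib_right[symmetric] W.w_sum)
      also have "\<dots> \<le> W.expect L (\<lambda>y. \<Sum>a\<in>A b. (w' b a - w b a) * f (y(b := a))) x"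
        by (rule W.expect_mono) (use gain in simp)
      also have "\<dots> = (\<Sum>a\<in>A b. (w' b a - w b a) * W.expect L f (X a))"
        unfolding ov by (simp add: W.expect_sum W.expect_cmult)
      also have "\<dots> = (\<Sum>a\<in>A b. w' b a * W.expect L f (X a)) - W.expect (insert b L) f x"
        by (simp add: split(1) left_diff_distrib sum_subtractf)
      finally show ?thesis .
    qed
    have "W'.expect (insert b L) f x
      \<ge> (\<Sum>a\<in>A b. w' b a * (c * \<eta> * (\<Sum>i\<in>L. W.expect L (piv i) (X a)) - K * \<eta>\<^sup>2 + W.expect L f (X a)))"
      unfolding split(2) by (intro sum_mono mult_left_mono one W'.w_nonneg)
    also have "(\<Sum>a\<in>A b. w' b a * (c * \<eta> * (\<Sum>i\<in>L. W.expect L (piv i) (X a)) - K * \<eta>\<^sup>2 + W.expect L f (X a)))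
      = c * \<eta> * (\<Sum>i\<in>L. \<Sum>a\<in>A b. w' b a * W.expect L (piv i) (X a)) - K * \<eta>\<^sup>2
        + (\<Sum>a\<in>A b. w' b a * W.expect L f (X a))"
    proof -
      have "(\<Sum>a\<in>A b. w' b a * (c * \<eta> * (\<Sum>i\<in>L. W.expect L (piv i) (X a))))
        = c * \<eta> * (\<Sum>i\<in>L. \<Sum>a\<in>A b. w' b a * W.expect L (piv i) (X a))"
        by (subst sum.swap) (simp add: sum_distrib_left mult.left_commute)
      moreover have "(\<Sum>a\<in>A b. w' b a * (K * \<eta>\<^sup>2)) = K * \<eta>\<^sup>2"
        by (simp add: sum_distrib_right[symmetric] W'.w_sum)
      ultimately show ?thesis
        by (simp add: distrib_left right_diff_distrib sum.distrib sum_subtractf)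
    qed
    finally have A: "c * \<eta> * (\<Sum>i\<in>L. \<Sum>a\<in>A b. w' b a * W.expect L (piv i) (X a)) - K * \<eta>\<^sup>2
        + (\<Sum>a\<in>A b. w' b a * W.expect L f (X a)) \<le> W'.expect (insert b L) f x" .
    have "(\<Sum>i\<in>L. W.expect (insert b L) (piv i) x) - card L * (N * \<kappa> * \<eta>)
      \<le> (\<Sum>i\<in>L. \<Sum>a\<in>A b. w' b a * W.expect L (piv i) (X a))"
      using sum_mono[of L, OF cmp] by (simp add: sum_subtractf)
    then have "c * \<eta> * ((\<Sum>i\<in>L. W.expect (insert b L) (piv i) x) - card L * (N * \<kappa> * \<eta>))
      \<le> c * \<eta> * (\<Sum>i\<in>L. \<Sum>a\<in>A b. w' b a * W.expect L (piv i) (X a))"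
      using assms(2) \<eta> by (intro mult_left_mono) auto
    with A base show "c * \<eta> * (\<Sum>i\<in>insert b L. W.expect (insert b L) (piv i) x) - K' * \<eta>\<^sup>2
        \<le> W'.expect (insert b L) f x - W.expect (insert b L) f x"
      using insert.hyps by (simp add: K'_def algebra_simps power2_eq_square)
  qed
qed

section \<open>The differential inequality\<close>

text \<open>Stands in for integrating a bound on a derivative: over \<open>n\<close> equal steps the
  main terms add up to \<open>(b - a) * L\<close> and the errors to
  \<open>K * (b - a)\<^sup>2 / n\<close>, which tends to zero.\<close>

lemma difference_bound_below:
  fixes F :: "real \<Rightarrow> real"
  assumes "a \<le> b"
    and "\<And>t h. \<lbrakk>a \<le> t; 0 < h; t + h \<le> b\<rbrakk> \<Longrightarrow> h * L - K * h\<^sup>2 \<le> F (t + h) - F t"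
  shows "(b - a) * L \<le> F b - F a"
proof (cases "a = b")
  case False
  then have ab: "a < b" using assms(1) by simp
  have bound: "(b - a) * L - K * (b - a)\<^sup>2 / real n \<le> F b - F a" if n: "n > 0" for n :: nat
  proof -
    define h where "h = (b - a) / real n"
    have h: "0 < h" "real n * h = b - a" using ab n by (auto simp: h_def)
    have "h * L - K * h\<^sup>2 \<le> F (a + real (Suc i) * h) - F (a + real i * h)" if "i < n" for i
    proof -
      have "real (Suc i) * h \<le> real n * h" using that h(1) by (intro mult_right_mono) auto
      then have "a + real i * h + h \<le> b" using h(2) by (simp add: algebra_simps)
      moreover have "a \<le> a + real i * h" using h(1) by simp
      ultimately have "h * L - K * h\<^sup>2 \<le> F (a + real i * h + h) - F (a + real i * h)"
        using assms(2) h(1) by blast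
      then show ?thesis by (simp add: algebra_simps)
    qed
    then have "(\<Sum>i<n. h * L - K * h\<^sup>2) \<le> (\<Sum>i<n. F (a + real (Suc i) * h) - F (a + real i * h))"
      by (intro sum_mono) auto
    also have "\<dots> = F (a + real n * h) - F (a + real 0 * h)"
      by (rule sum_lessThan_telescope)
    finally have "real n * (h * L - K * h\<^sup>2) \<le> F b - F a" by (simp add: h(2))
    moreover have "real n * (h * L - K * h\<^sup>2) = (real n * h) * L - K * (real n * h)\<^sup>2 / real n"
      using n by (simp add: field_simps power2_eq_square)
    ultimately show ?thesis by (simp add: h(2))
  qed
  have "(\<lambda>n. (b - a) * L - K * (b - a)\<^sup>2 / real n) \<longlonglongrightarrow> (b - a) * L - 0"
    by (intro tendsto_diff tendsto_const lim_const_over_n)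
  moreover have "\<exists>N. \<forall>n\<ge>N. (b - a) * L - K * (b - a)\<^sup>2 / real n \<le> F b - F a"
    using bound by (intro exI[of _ 1]) auto
  ultimately have "(b - a) * L - 0 \<le> F b - F a" by (rule LIMSEQ_le_const2)
  then show ?thesis by simp
qed simp

text \<open>Gronwall's inequality for increments: after multiplication by
  \<open>exp (- \<kappa> * (t - a))\<close> the function is nondecreasing up to a quadratic error,
  and \<open>F b\<close> is at most 1.\<close>

lemma exp_difference_bound:
  fixes F :: "real \<Rightarrow> real"
  assumes "a \<le> b" "0 \<le> \<kappa>" "0 \<le> K"
    and F: "\<And>t. \<lbrakk>a \<le> t; t \<le> b\<rbrakk> \<Longrightarrow> 0 \<le> F t \<and> F t \<le> 1"
    and incr: "\<And>t h. \<lbrakk>a \<le> t; 0 < h; t + h \<le> b\<rbrakk> \<Longrightarrow> h * \<kappa> * F t - K * h\<^sup>2 \<le> F (t + h) - F t"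
  shows "F a \<le> exp (- \<kappa> * (b - a))"
proof -
  define G where "G t = exp (- \<kappa> * (t - a)) * F t" for t
  have "(b - a) * 0 \<le> G b - G a"
  proof (rule difference_bound_below[OF assms(1), where K = "\<kappa>\<^sup>2 + K"])
    fix t h assume th: "a \<le> t" "0 < h" "t + h \<le> b"
    define u where "u = exp (- \<kappa> * (t - a))"
    define v where "v = exp (- (\<kappa> * h))"
    have u: "0 < u" "u \<le> 1" using th assms(2) by (auto simp: u_def)
    have v: "0 < v" "v \<le> 1" "1 - \<kappa> * h \<le> v" using th assms(2) exp_ge_add_one_self[of "- (\<kappa> * h)"]
      by (auto simp: v_def)
    have Ft: "0 \<le> F t" "F t \<le> 1" using F[of t] th by auto
    have "1 - (\<kappa> * h)\<^sup>2 = (1 + \<kappa> * h) * (1 - \<kappa> * h)" by (simp add: algebra_simps power2_eq_square)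
    also have "\<dots> \<le> (1 + \<kappa> * h) * v" using v th assms(2) by (intro mult_left_mono) auto
    finally have vv: "1 - (\<kappa> * h)\<^sup>2 \<le> (1 + \<kappa> * h) * v" .
    have "(1 - (\<kappa> * h)\<^sup>2) * F t - K * h\<^sup>2 \<le> (1 + \<kappa> * h) * v * F t - v * (K * h\<^sup>2)"
    proof (rule diff_mono)
      show "(1 - (\<kappa> * h)\<^sup>2) * F t \<le> (1 + \<kappa> * h) * v * F t" by (rule mult_right_mono[OF vv Ft(1)])
      show "v * (K * h\<^sup>2) \<le> K * h\<^sup>2" using v assms(3) by (intro mult_left_le_one_le) auto
    qed
    also have "\<dots> = v * (F t + (h * \<kappa> * F t - K * h\<^sup>2))" by (simp add: algebra_simps)
    also have "\<dots> \<le> v * F (t + h)" using incr[OF th] v by (intro mult_left_mono) auto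
    finally have 1: "(1 - (\<kappa> * h)\<^sup>2) * F t - K * h\<^sup>2 - F t \<le> v * F (t + h) - F t" by simp
    have "(\<kappa> * h)\<^sup>2 * F t \<le> (\<kappa> * h)\<^sup>2 * 1" using Ft by (intro mult_left_mono) auto
    then have "- ((\<kappa>\<^sup>2 + K) * h\<^sup>2) \<le> (1 - (\<kappa> * h)\<^sup>2) * F t - K * h\<^sup>2 - F t"
      by (simp add: algebra_simps power_mult_distrib)
    with 1 have 2: "- ((\<kappa>\<^sup>2 + K) * h\<^sup>2) \<le> v * F (t + h) - F t" by linarith
    have "u * ((\<kappa>\<^sup>2 + K) * h\<^sup>2) \<le> (\<kappa>\<^sup>2 + K) * h\<^sup>2" using u assms(3) by (intro mult_left_le_one_le) auto
    moreover have "u * - ((\<kappa>\<^sup>2 + K) * h\<^sup>2) \<le> u * (v * F (t + h) - F t)"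
      using 2 u by (intro mult_left_mono) auto
    moreover have "G (t + h) - G t = u * (v * F (t + h) - F t)"
      by (simp add: G_def u_def v_def algebra_simps exp_add[symmetric] exp_diff[symmetric])
    ultimately show "h * 0 - (\<kappa>\<^sup>2 + K) * h\<^sup>2 \<le> G (t + h) - G t" by simp
  qed
  then have "F a \<le> exp (- \<kappa> * (b - a)) * F b" by (simp add: G_def)
  also have "\<dots> \<le> exp (- \<kappa> * (b - a)) * 1" using F[of b] assms(1) by (intro mult_left_mono) auto
  finally show ?thesis by simp
qed

text \<open>The differential inequality \<open>f\<^sub>n' \<ge> c n f\<^sub>n / S\<^sub>n\<close>, where \<open>S\<^sub>n = f\<^sub>0 + \<dots> + f\<^bsub>n-1\<^esub>\<close>,
  in terms of increments.\<close>

locale sharp_sequence =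
  fixes f :: "nat \<Rightarrow> real \<Rightarrow> real" and lo hi c :: real
  assumes c_pos: "0 < c"
    and f_nonneg: "\<And>n t. 0 \<le> f n t"
    and f_le_1: "\<And>n t. f n t \<le> 1"
    and f_0: "\<And>t. f 0 t = 1"
    and f_mono: "\<And>n s t. s \<le> t \<Longrightarrow> f n s \<le> f n t"
    and increment: "\<And>n. 1 \<le> n \<Longrightarrow> \<exists>K\<ge>0. \<forall>t h. lo \<le> t \<longrightarrow> 0 < h \<longrightarrow> t + h \<le> hi \<longrightarrow>
        h * (c * real n / (\<Sum>k<n. f k t)) * f n t - K * h\<^sup>2 \<le> f n (t + h) - f n t"
begin

abbreviation S :: "nat \<Rightarrow> real \<Rightarrow> real" where "S n t \<equiv> (\<Sum>k<n. f k t)"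

lemma S_ge_1: "1 \<le> n \<Longrightarrow> 1 \<le> S n t"
  using member_le_sum[of 0 "{..<n}" "\<lambda>k. f k t"] by (simp add: f_nonneg f_0)

lemma S_mono: "s \<le> t \<Longrightarrow> S n s \<le> S n t"
  by (intro sum_mono f_mono)

text \<open>The sums \<open>S n\<close> increase with the parameter, so the bound \<open>M\<close>
  at \<open>t\<close> holds on the whole interval and the exponential growth rate of
  \<open>f n\<close> there is at least \<open>c * n / M\<close>.\<close>

lemma decay_from_S_bound:
  assumes "1 \<le> n" "lo \<le> s" "s \<le> t" "t \<le> hi" "S n t \<le> M"
  shows "f n s \<le> exp (- (c * real n / M) * (t - s))"
proof -
  obtain K where K: "0 \<le> K" and incr: "\<And>t h. \<lbrakk>lo \<le> t; 0 < h; t + h \<le> hi\<rbrakk> \<Longrightarrow>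
        h * (c * real n / S n t) * f n t - K * h\<^sup>2 \<le> f n (t + h) - f n t"
    using increment[OF assms(1)] by blast
  have M: "1 \<le> M" using S_ge_1[OF assms(1), of t] assms(5) by simp
  show ?thesis
  proof (rule exp_difference_bound[OF assms(3) _ K])
    show "0 \<le> c * real n / M" using M c_pos by simp
    fix r h assume r: "s \<le> r" "0 < h" "r + h \<le> t"
    have "S n r \<le> M" using S_mono[of r t n] r assms(5) by simp
    then have "c * real n / M \<le> c * real n / S n r"
      using M S_ge_1[OF assms(1), of r] c_pos by (intro divide_left_mono mult_pos_pos) auto
    then have "h * (c * real n / M) * f n r \<le> h * (c * real n / S n r) * f n r"
      using r by (intro mult_right_mono mult_left_mono f_nonneg) auto
    also have "\<dots> - K * h\<^sup>2 \<le> f n (r + h) - f n r" using r assms by (intro incr) auto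
    finally show "h * (c * real n / M) * f n r - K * h\<^sup>2 \<le> f n (r + h) - f n r" by simp
  qed (simp add: f_nonneg f_le_1)
qed

text \<open>Summation of \<open>ln (1 + q) \<le> q\<close> with \<open>q = f i t / S i t\<close>.
  The right-hand side is what the increments of the sum of \<open>f i / i\<close> produce.\<close>

lemma ln_S_le: "1 \<le> n \<Longrightarrow> ln (S n t) \<le> (\<Sum>i=1..<n. f i t / S i t)"
proof (induction n rule: nat_induct_at_least)
  case base
  then show ?case by (simp add: f_0)
next
  case (Suc n)
  have S: "0 < S n t" using S_ge_1[OF Suc.hyps, of t] by simp
  have q: "0 \<le> f n t / S n t" using S f_nonneg by simp
  have "S (Suc n) t = S n t * (1 + f n t / S n t)" using S by (simp add: field_simps)
  then have "ln (S (Suc n) t) = ln (S n t) + ln (1 + f n t / S n t)"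
    using S q by (simp add: ln_mult)
  also have "\<dots> \<le> ln (S n t) + f n t / S n t" using q by (simp add: ln_add_one_self_le_self)
  finally show ?case using Suc by simp
qed

text \<open>Dividing the growth inequality of \<open>f i\<close> by \<open>i\<close> cancels the
  factor \<open>i\<close> and leaves the rate \<open>c * f i / S i\<close>. The sum of these rates
  is bounded below through \<open>ln_S_le\<close>.\<close>

lemma weighted_sum_growth:
  assumes "1 \<le> n" "lo \<le> s" "s \<le> t" "t \<le> hi"
  shows "(t - s) * (c * ln (S n s)) \<le> (\<Sum>i=1..<n. f i t / real i)"
proof -
  have "\<exists>K\<ge>0. \<forall>i\<in>{1..<n}. \<forall>t h. lo \<le> t \<longrightarrow> 0 < h \<longrightarrow> t + h \<le> hi \<longrightarrow>
        h * (c * real i / S i t) * f i t - K * h\<^sup>2 \<le> f i (t + h) - f i t"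
  proof -
    obtain K where K: "\<And>i. 1 \<le> i \<Longrightarrow> 0 \<le> K i \<and> (\<forall>t h. lo \<le> t \<longrightarrow> 0 < h \<longrightarrow> t + h \<le> hi \<longrightarrow>
        h * (c * real i / S i t) * f i t - K i * h\<^sup>2 \<le> f i (t + h) - f i t)"
      using increment by metis
    show ?thesis
    proof (intro exI[of _ "\<Sum>i=1..<n. K i"] conjI ballI allI impI)
      show "0 \<le> (\<Sum>i=1..<n. K i)" using K by (intro sum_nonneg) auto
      fix i t h assume i: "i \<in> {1..<n}" and th: "lo \<le> t" "0 < h" "t + h \<le> hi"
      have "K i \<le> (\<Sum>i=1..<n. K i)" using i K by (intro member_le_sum) auto
      then have "K i * h\<^sup>2 \<le> (\<Sum>i=1..<n. K i) * h\<^sup>2" by (intro mult_right_mono) auto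
      moreover have "h * (c * real i / S i t) * f i t - K i * h\<^sup>2 \<le> f i (t + h) - f i t"
        using K[of i] i th by auto
      ultimately show "h * (c * real i / S i t) * f i t - (\<Sum>i=1..<n. K i) * h\<^sup>2 \<le> f i (t + h) - f i t"
        by linarith
    qed
  qed
  then obtain K where K: "0 \<le> K" and incr: "\<And>i t h. \<lbrakk>i \<in> {1..<n}; lo \<le> t; 0 < h; t + h \<le> hi\<rbrakk> \<Longrightarrow>
        h * (c * real i / S i t) * f i t - K * h\<^sup>2 \<le> f i (t + h) - f i t"
    by blast
  define F where "F t = (\<Sum>i=1..<n. f i t / real i)" for t
  have "(t - s) * (c * ln (S n s)) \<le> F t - F s"
  proof (rule difference_bound_below[OF assms(3), where K = "real n * K"])
    fix r h assume r: "s \<le> r" "0 < h" "r + h \<le> t"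
    have "ln (S n s) \<le> ln (S n r)"
      using S_ge_1[OF assms(1), of s] S_mono[OF r(1), of n] by simp
    also have "\<dots> \<le> (\<Sum>i=1..<n. f i r / S i r)" by (rule ln_S_le[OF assms(1)])
    finally have "h * (c * ln (S n s)) \<le> h * (c * (\<Sum>i=1..<n. f i r / S i r))"
      using r c_pos by simp
    moreover have "real (card {1..<n}) * (K * h\<^sup>2) \<le> real n * K * h\<^sup>2"
      using K by (simp add: mult_right_mono mult.assoc)
    ultimately have "h * (c * ln (S n s)) - real n * K * h\<^sup>2
        \<le> h * (c * (\<Sum>i=1..<n. f i r / S i r)) - real (card {1..<n}) * (K * h\<^sup>2)" by linarith
    also have "\<dots> = (\<Sum>i=1..<n. h * c * (f i r / S i r) - K * h\<^sup>2)"
      by (simp add: sum_subtractf sum_distrib_left mult.assoc)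
    also have "\<dots> \<le> (\<Sum>i=1..<n. (f i (r + h) - f i r) / real i)"
    proof (rule sum_mono)
      fix i assume i: "i \<in> {1..<n}"
      have "h * c * (f i r / S i r) - K * h\<^sup>2 \<le> h * c * (f i r / S i r) - K * h\<^sup>2 / real i"
      proof -
        have "K * h\<^sup>2 * 1 \<le> K * h\<^sup>2 * real i" using i K by (intro mult_left_mono) auto
        then have "K * h\<^sup>2 / real i \<le> K * h\<^sup>2" using i by (simp add: divide_le_eq)
        then show ?thesis by simp
      qed
      also have "\<dots> = (h * (c * real i / S i r) * f i r - K * h\<^sup>2) / real i"
        using i by (simp add: diff_divide_distrib)
      also have "\<dots> \<le> (f i (r + h) - f i r) / real i"
        using i r assms by (intro divide_right_mono incr) auto
      finally show "h * c * (f i r / S i r) - K * h\<^sup>2 \<le> (f i (r + h) - f i r) / real i" .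
    qed
    also have "\<dots> = F (r + h) - F r" by (simp add: F_def sum_subtractf diff_divide_distrib)
    finally show "h * (c * ln (S n s)) - real n * K * h\<^sup>2 \<le> F (r + h) - F r" .
  qed
  moreover have "0 \<le> F s" unfolding F_def by (intro sum_nonneg) (simp add: f_nonneg)
  ultimately show ?thesis by (simp add: F_def)
qed

text \<open>Compare both sides of \<open>weighted_sum_growth\<close> with \<open>ln n\<close>: the
  left is at least \<open>c * (t - s) * (1 - \<alpha>) * ln n\<close> for infinitely many
  \<open>n\<close>, while the right is at most \<open>(l + \<alpha>) * ln n\<close> plus a constant
  because \<open>f n t\<close> tends to \<open>l\<close>. Then \<alpha> tends to zero.\<close>

lemma linear_growth:
  assumes st: "lo \<le> s" "s \<le> t" "t \<le> hi"
    and large: "\<And>\<alpha>. 0 < \<alpha> \<Longrightarrow> \<exists>\<^sub>F n in sequentially. real n powr (1 - \<alpha>) < S n s"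
    and lim: "(\<lambda>n. f n t) \<longlonglongrightarrow> l"
  shows "c * (t - s) \<le> l"
proof -
  have "c * (t - s) * (1 - \<alpha>) \<le> l + \<alpha>" if \<alpha>: "0 < \<alpha>" for \<alpha>
  proof (rule ccontr)
    assume neg: "\<not> c * (t - s) * (1 - \<alpha>) \<le> l + \<alpha>"
    define d where "d = c * (t - s) * (1 - \<alpha>) - (l + \<alpha>)"
    have d: "0 < d" using neg by (simp add: d_def)
    have l: "0 \<le> l" by (rule LIMSEQ_le_const[OF lim]) (simp add: f_nonneg)
    obtain N where N: "\<And>n. N \<le> n \<Longrightarrow> f n t \<le> l + \<alpha>"
    proof -
      have "\<forall>\<^sub>F n in sequentially. f n t < l + \<alpha>" using order_tendstoD(2)[OF lim] \<alpha> by simp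
      then show thesis using that by (force simp: eventually_sequentially)
    qed
    have up: "(\<Sum>i=1..<n. f i t / real i) \<le> real N + (l + \<alpha>) * (1 + ln (real n))" if "1 \<le> n" for n
    proof -
      have "(\<Sum>i=1..<n. f i t / real i) \<le> (\<Sum>i=1..<n. of_bool (i < N) + (l + \<alpha>) * (1 / real i))"
      proof (rule sum_mono)
        fix i assume i: "i \<in> {1..<n}"
        have "f i t / real i \<le> 1" using i f_le_1[of i t] by (simp add: divide_le_eq)
        moreover have "0 \<le> (l + \<alpha>) * (1 / real i)" using l \<alpha> by simp
        moreover have "f i t / real i \<le> (l + \<alpha>) * (1 / real i)" if "N \<le> i"
          using N[OF that] i by (simp add: divide_right_mono)
        ultimately show "f i t / real i \<le> of_bool (i < N) + (l + \<alpha>) * (1 / real i)"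
          by (cases "i < N") auto
      qed
      also have "\<dots> = (\<Sum>i=1..<n. of_bool (i < N)) + (l + \<alpha>) * (\<Sum>i=1..<n. 1 / real i)"
        by (simp only: sum.distrib sum_distrib_left)
      also have "(\<Sum>i=1..<n. of_bool (i < N) :: real) \<le> real N"
      proof -
        have "(\<Sum>i=1..<n. of_bool (i < N) :: real) = real (card ({1..<n} \<inter> {i. i < N}))"
          by (simp add: sum_of_bool_eq)
        also have "card ({1..<n} \<inter> {i. i < N}) \<le> card {..<N}" by (intro card_mono) auto
        finally show ?thesis by simp
      qed
      also have "(\<Sum>i=1..<n. 1 / real i) \<le> 1 + ln (real n)"
      proof -
        have "(\<Sum>i=1..<n. 1 / real i) \<le> (\<Sum>i=1..n. 1 / real i)" by (intro sum_mono2) auto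
        also have "\<dots> = harm n" by (simp add: harm_def inverse_eq_divide)
        \<comment> \<open>\<open>harm n - ln n\<close> decreases in \<open>n\<close> and equals 1 at
          \<open>n = 1\<close>.\<close>
        also have "\<dots> \<le> 1 + ln (real n)" using euler_mascheroni_sequence_decreasing[of 1 n] that by (simp add: harm_expand)
        finally show ?thesis .
      qed
      finally show ?thesis using l \<alpha> by simp
    qed
    have "filterlim (\<lambda>n. ln (real n)) at_top sequentially"
      by (rule filterlim_compose[OF ln_at_top filterlim_real_sequentially])
    then have "\<forall>\<^sub>F n in sequentially. (real N + (l + \<alpha>)) / d < ln (real n)"
      by (rule filterlim_at_top_dense[THEN iffD1, rule_format])
    with large[OF \<alpha>] have "\<exists>\<^sub>F n in sequentially. real n powr (1 - \<alpha>) < S n s \<and>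
        (real N + (l + \<alpha>)) / d < ln (real n)"
      by (rule frequently_eventually_frequently)
    then obtain n where n: "real n powr (1 - \<alpha>) < S n s" "(real N + (l + \<alpha>)) / d < ln (real n)"
      by (auto dest: frequently_ex)
    have "0 < ln (real n)" by (rule le_less_trans[OF _ n(2)]) (use l \<alpha> d in simp)
    then have n1: "1 \<le> n" by (cases n) auto
    have "(1 - \<alpha>) * ln (real n) = ln (real n powr (1 - \<alpha>))" using n1 by (simp add: ln_powr)
    also have "\<dots> \<le> ln (S n s)" using n(1) n1 S_ge_1[OF n1, of s] by (subst ln_le_cancel_iff) auto
    finally have "(t - s) * (c * ((1 - \<alpha>) * ln (real n))) \<le> (t - s) * (c * ln (S n s))"
      using st c_pos by (intro mult_left_mono) auto
    also have "\<dots> \<le> (\<Sum>i=1..<n. f i t / real i)" by (rule weighted_sum_growth[OF n1 st])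
    also have "\<dots> \<le> real N + (l + \<alpha>) * (1 + ln (real n))" by (rule up[OF n1])
    finally have "d * ln (real n) \<le> real N + (l + \<alpha>)" by (simp add: d_def algebra_simps)
    with n(2) d show False by (simp add: divide_less_eq mult.commute)
  qed
  then have "\<forall>\<^sub>F \<alpha> in at_right 0. c * (t - s) * (1 - \<alpha>) \<le> l + \<alpha>"
    by (intro eventually_at_rightI[of 0 1]) auto
  moreover have "((\<lambda>\<alpha>. c * (t - s) * (1 - \<alpha>)) \<longlongrightarrow> c * (t - s) * (1 - 0)) (at_right 0)"
    "((\<lambda>\<alpha>. l + \<alpha>) \<longlongrightarrow> l + 0) (at_right 0)"
    by (intro tendsto_intros)+
  ultimately have "c * (t - s) * (1 - 0) \<le> l + 0"
    by (intro tendsto_le[of "at_right (0::real)"]) (auto simp: trivial_limit_at_right_real)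
  then show ?thesis by simp
qed

text \<open>Two applications of \<open>decay_from_S_bound\<close>. On \<open>[s, t]\<close> the
  polynomial saving gives a stretched exponential bound at \<open>s\<close>, which is summable.
  Hence \<open>S n s\<close> is bounded uniformly in \<open>n\<close>, and on \<open>[r, s]\<close>
  the rate becomes proportional to \<open>n\<close>.\<close>

lemma exponential_decay:
  assumes rst: "lo \<le> r" "r < s" "s < t" "t \<le> hi"
    and \<alpha>: "0 < \<alpha>" and small: "\<forall>\<^sub>F n in sequentially. S n t \<le> real n powr (1 - \<alpha>)"
  shows "\<exists>d>0. \<forall>n\<ge>1. f n r \<le> exp (- d * real n)"
proof -
  define \<kappa> where "\<kappa> = c * (t - s)"
  have \<kappa>: "0 < \<kappa>" using rst c_pos by (simp add: \<kappa>_def)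
  have "\<forall>\<^sub>F n in sequentially. f n s \<le> exp (- \<kappa> * real n powr \<alpha>)"
    using small eventually_ge_at_top[of 1]
  proof eventually_elim
    case (elim n)
    have "f n s \<le> exp (- (c * real n / real n powr (1 - \<alpha>)) * (t - s))"
      using elim rst by (intro decay_from_S_bound) auto
    moreover have "c * real n / real n powr (1 - \<alpha>) = c * real n powr \<alpha>"
      using elim by (simp add: powr_diff field_simps)
    ultimately show ?case by (simp add: \<kappa>_def mult_ac)
  qed
  moreover have "\<forall>\<^sub>F n in sequentially. exp (- \<kappa> * real n powr \<alpha>) \<le> 1 / real n ^ 2"
    using \<kappa> \<alpha> by real_asymp
  ultimately have "\<forall>\<^sub>F n in sequentially. norm (f n s) \<le> 1 / real n ^ 2"
    by eventually_elim (simp add: f_nonneg)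
  then have "summable (\<lambda>n. f n s)"
    by (rule summable_comparison_test_ev) (use inverse_power_summable[of 2] in \<open>simp add: inverse_eq_divide\<close>)
  define M where "M = (\<Sum>n. f n s)"
  have S: "S n s \<le> M" for n unfolding M_def
    by (rule sum_le_suminf) (auto simp: f_nonneg \<open>summable _\<close>)
  have "1 \<le> M" using S[of 1] by (simp add: f_0)
  show ?thesis
  proof (intro exI[of _ "c * (s - r) / M"] conjI allI impI)
    show "0 < c * (s - r) / M" using \<open>1 \<le> M\<close> rst c_pos by simp
    fix n :: nat assume "1 \<le> n"
    then have "f n r \<le> exp (- (c * real n / M) * (s - r))"
      using rst S by (intro decay_from_S_bound) auto
    then show "f n r \<le> exp (- (c * (s - r) / M) * real n)" by (simp add: mult_ac)
  qed
qed

end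

section \<open>Lattice geometry and blocks of edges\<close>

lemma edge_iff: "{(a, b), (c, d)} \<in> edges \<longleftrightarrow> \<bar>a - c\<bar> + \<bar>b - d\<bar> = 1"
proof
  assume "{(a, b), (c, d)} \<in> edges"
  then obtain a' b' c' d' where "{(a, b), (c, d)} = {(a', b'), (c', d')}" and *: "\<bar>a' - c'\<bar> + \<bar>b' - d'\<bar> = 1"
    by (auto simp: edges_def)
  then have "(a, b) = (a', b') \<and> (c, d) = (c', d') \<or> (a, b) = (c', d') \<and> (c, d) = (a', b')"
    by (simp only: doubleton_eq_iff)
  with * show "\<bar>a - c\<bar> + \<bar>b - d\<bar> = 1" by (auto simp: abs_minus_commute)
qed (auto simp: edges_def)

lemma edgeE:
  assumes "e \<in> edges"
  obtains a b where "e = {(a, b), (a + 1, b)}" | a b where "e = {(a, b), (a, b + 1)}"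
proof -
  obtain a b c d where e: "e = {(a, b), (c, d)}" and *: "\<bar>a - c\<bar> + \<bar>b - d\<bar> = 1"
    using assms by (auto simp: edges_def)
  consider "c = a + 1" "d = b" | "a = c + 1" "d = b" | "c = a" "d = b + 1" | "c = a" "b = d + 1"
    using * by linarith
  then show thesis using e that by cases (auto simp: insert_commute)
qed

definition sup_norm :: "vertex \<Rightarrow> int" where
  "sup_norm v = max \<bar>fst v\<bar> \<bar>snd v\<bar>"

lemma sup_norm_0 [simp]: "sup_norm (0, 0) = 0" "sup_norm 0 = 0"
  by (simp_all add: sup_norm_def)

lemma sup_norm_nonneg: "0 \<le> sup_norm v"
  by (simp add: sup_norm_def)

lemma sup_norm_diff_self [simp]: "sup_norm (v - v) = 0"
  by (simp add: sup_norm_def)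

lemma sup_norm_triangle: "\<bar>sup_norm u - sup_norm v\<bar> \<le> sup_norm (u - v)"
  by (simp add: sup_norm_def) linarith

lemma sup_norm_edge:
  assumes "{u, v} \<in> edges"
  shows "\<bar>sup_norm (u - w) - sup_norm (v - w)\<bar> \<le> 1"
proof -
  have "\<bar>fst u - fst v\<bar> + \<bar>snd u - snd v\<bar> = 1"
    using assms edge_iff[of "fst u" "snd u" "fst v" "snd v"] by simp
  then show ?thesis by (simp add: sup_norm_def) linarith
qed

lemma lattice_box_eq: "lattice_box n = {v. sup_norm v \<le> int n}"
  by (auto simp: lattice_box_def sup_norm_def)

lemma bdry_lattice_box: "bdry (lattice_box n) = {v. sup_norm v = int n}"
proof (intro set_eqI iffI)
  fix v assume "v \<in> bdry (lattice_box n)"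
  then obtain y where v: "sup_norm v \<le> int n" and y: "\<not> sup_norm y \<le> int n" "{v, y} \<in> edges"
    by (auto simp: bdry_def lattice_box_eq)
  have "\<bar>sup_norm v - sup_norm y\<bar> \<le> 1"
    using sup_norm_edge[OF y(2), of 0] by simp
  with v y show "v \<in> {v. sup_norm v = int n}" by simp
next
  fix v assume "v \<in> {v. sup_norm v = int n}"
  then have v: "sup_norm v = int n" by simp
  obtain a b where ab: "v = (a, b)" by (cases v)
  consider "\<bar>a\<bar> = int n" | "\<bar>b\<bar> = int n" using v by (auto simp: ab sup_norm_def max_def split: if_splits)
  then have "\<exists>y. sup_norm y > int n \<and> {v, y} \<in> edges"
  proof cases
    case 1
    then show ?thesis
      by (intro exI[of _ "(if a \<ge> 0 then a + 1 else a - 1, b)"]) (auto simp: ab edge_iff sup_norm_def)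
  next
    case 2
    then show ?thesis
      by (intro exI[of _ "(a, if b \<ge> 0 then b + 1 else b - 1)"]) (auto simp: ab edge_iff sup_norm_def)
  qed
  then show "v \<in> bdry (lattice_box n)" using v by (auto simp: bdry_def lattice_box_eq not_le)
qed

lemma open_adj_mono: "\<omega> \<le> \<omega>' \<Longrightarrow> open_adj \<omega> \<subseteq> open_adj \<omega>'"
  by (auto simp: open_adj_def le_fun_def)

lemma sym_open_adj_rtrancl: "sym ((open_adj \<omega>)\<^sup>*)"
  by (rule sym_rtrancl) (auto simp: sym_def open_adj_def insert_commute)

text \<open>A potential that gains at most one per step cannot jump over level \<open>k\<close>. The
  witness is the first vertex of the path at this level, so the initial segment stays at or below
  it.\<close>

lemma rtrancl_crossing:
  fixes \<phi> :: "'a \<Rightarrow> int"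
  assumes "(u, v) \<in> R\<^sup>*" "\<phi> u \<le> k" "k \<le> \<phi> v" "\<And>x y. (x, y) \<in> R \<Longrightarrow> \<phi> y \<le> \<phi> x + 1"
  shows "\<exists>w. \<phi> w = k \<and> (u, w) \<in> (R \<inter> {x. \<phi> x \<le> k} \<times> {x. \<phi> x \<le> k})\<^sup>* \<and> (w, v) \<in> R\<^sup>*"
  using assms(1-3)
proof (induction rule: converse_rtrancl_induct)
  case base
  then show ?case by (intro exI[of _ v]) auto
next
  case (step x y)
  show ?case
  proof (cases "\<phi> x = k")
    case True
    then show ?thesis using step.hyps by (intro exI[of _ x]) auto
  next
    case False
    then have y: "\<phi> y \<le> k" using step.prems assms(4)[OF step.hyps(1)] by linarith
    then obtain w where w: "\<phi> w = k" "(y, w) \<in> (R \<inter> {x. \<phi> x \<le> k} \<times> {x. \<phi> x \<le> k})\<^sup>*" "(w, v) \<in> R\<^sup>*"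
      using step.IH step.prems by blast
    have "(x, y) \<in> R \<inter> {x. \<phi> x \<le> k} \<times> {x. \<phi> x \<le> k}"
      using step.hyps(1) step.prems(1) y by auto
    with w show ?thesis by (intro exI[of _ w]) (auto intro: converse_rtrancl_into_rtrancl)
  qed
qed

text \<open>The distance is measured from the starting vertex, so that the event can be translated;
  from the origin it is the connection to the boundary of a box.\<close>

definition reaches_distance :: "vertex \<Rightarrow> nat \<Rightarrow> (edge \<Rightarrow> bool) \<Rightarrow> bool" where
  "reaches_distance v m \<omega> \<longleftrightarrow> (\<exists>w. sup_norm (w - v) = int m \<and> (v, w) \<in> (open_adj \<omega>)\<^sup>*)"

lemma connects_to_bdry_iff:
  "\<omega> \<in> connects_to (bdry (lattice_box n)) \<longleftrightarrow> \<omega> \<in> space config_space \<and> reaches_distance (0, 0) n \<omega>"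
  by (auto simp: connects_to_def bdry_lattice_box cluster_def reaches_distance_def zero_prod_def[symmetric])

lemma reaches_distanceI:
  assumes "(v, w) \<in> (open_adj \<omega>)\<^sup>*" "int m \<le> sup_norm (w - v)"
  shows "reaches_distance v m \<omega>"
proof -
  have "\<exists>x. sup_norm (x - v) = int m \<and> (v, x) \<in> (open_adj \<omega> \<inter> {x. sup_norm (x - v) \<le> int m} \<times> {x. sup_norm (x - v) \<le> int m})\<^sup>* \<and> (x, w) \<in> (open_adj \<omega>)\<^sup>*"
    using assms(1)
  proof (rule rtrancl_crossing)
    show "sup_norm (v - v) \<le> int m" "int m \<le> sup_norm (w - v)" using assms(2) by simp_all
    show "sup_norm (y - v) \<le> sup_norm (x - v) + 1" if "(x, y) \<in> open_adj \<omega>" for x y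
      using sup_norm_edge[of x y v] that by (auto simp: open_adj_def)
  qed
  then show ?thesis unfolding reaches_distance_def
    using rtrancl_mono[of "open_adj \<omega> \<inter> _" "open_adj \<omega>"] by (meson Int_lower1 subsetD)
qed

lemma reaches_distance_antimono:
  "reaches_distance v m \<omega> \<Longrightarrow> k \<le> m \<Longrightarrow> reaches_distance v k \<omega>"
  by (auto simp: reaches_distance_def[of v m] intro: reaches_distanceI)

lemma reaches_distance_mono:
  "reaches_distance v m \<omega> \<Longrightarrow> \<omega> \<le> \<omega>' \<Longrightarrow> reaches_distance v m \<omega>'"
  using rtrancl_mono[OF open_adj_mono[of \<omega> \<omega>']] by (auto simp: reaches_distance_def)

definition in_box :: "nat \<Rightarrow> (edge \<Rightarrow> bool) \<Rightarrow> edge \<Rightarrow> bool" where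
  "in_box n \<omega> e \<longleftrightarrow> e \<subseteq> lattice_box n \<and> \<omega> e"

lemma open_adj_in_box:
  "open_adj (in_box n \<omega>) = open_adj \<omega> \<inter> {x. sup_norm x \<le> int n} \<times> {x. sup_norm x \<le> int n}"
  by (auto simp: open_adj_def in_box_def lattice_box_eq)

text \<open>A path stopped at its first visit to the sphere of radius \<open>n\<close> uses edges of
  the box only. This makes the event depend on finitely many blocks.\<close>

lemma reaches_distance_in_box:
  "reaches_distance (0, 0) n (in_box n \<omega>) \<longleftrightarrow> reaches_distance (0, 0) n \<omega>"
proof
  show "reaches_distance (0, 0) n (in_box n \<omega>) \<Longrightarrow> reaches_distance (0, 0) n \<omega>"
    by (erule reaches_distance_mono) (auto simp: in_box_def le_fun_def)
next
  assume "reaches_distance (0, 0) n \<omega>"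
  then obtain w where w: "sup_norm w = int n" "((0, 0), w) \<in> (open_adj \<omega>)\<^sup>*"
    by (auto simp: reaches_distance_def zero_prod_def[symmetric])
  have "\<exists>x. sup_norm x = int n \<and> ((0, 0), x) \<in> (open_adj \<omega> \<inter> {x. sup_norm x \<le> int n} \<times> {x. sup_norm x \<le> int n})\<^sup>* \<and> (x, w) \<in> (open_adj \<omega>)\<^sup>*"
    using w(2)
  proof (rule rtrancl_crossing)
    show "sup_norm y \<le> sup_norm x + 1" if "(x, y) \<in> open_adj \<omega>" for x y
      using sup_norm_edge[of x y 0] that by (auto simp: open_adj_def)
  qed (simp_all add: w)
  then show "reaches_distance (0, 0) n (in_box n \<omega>)"
    by (auto simp: reaches_distance_def open_adj_in_box zero_prod_def[symmetric])
qed

text \<open>Every edge belongs to one block, so that distinct blocks are independent; block \<open>(r, s)\<close>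
  consists of the edges of \<open>\<Lambda>\<^bsub>r,s\<^esub>\<close> and those leaving it to the right and upwards.\<close>

definition block_of :: "edge \<Rightarrow> int \<times> int" where
  "block_of e = (Min (fst ` e) div 6, Min (snd ` e) div 5)"

definition block_edges :: "int \<times> int \<Rightarrow> edge set" where
  "block_edges b = {e \<in> edges. block_of e = b}"

lemma block_of_simps:
  "block_of {(x, y), (x + 1, y)} = (x div 6, y div 5)"
  "block_of {(x, y), (x, y + 1)} = (x div 6, y div 5)"
  by (auto simp: block_of_def)

lemma block_edges_subset:
  "block_edges (r, s) \<subseteq> (\<lambda>((x, y), d). {(x, y), if d then (x + 1, y) else (x, y + 1)}) `
     (({6 * r..6 * r + 5} \<times> {5 * s..5 * s + 4}) \<times> UNIV)"
proof
  fix e assume "e \<in> block_edges (r, s)"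
  then have e: "e \<in> edges" "block_of e = (r, s)" by (auto simp: block_edges_def)
  from e(1) show "e \<in> (\<lambda>((x, y), d). {(x, y), if d then (x + 1, y) else (x, y + 1)}) `
     (({6 * r..6 * r + 5} \<times> {5 * s..5 * s + 4}) \<times> UNIV)"
  proof (cases rule: edgeE)
    case (1 x y)
    then have "x div 6 = r" "y div 5 = s" using e(2) by (auto simp: block_of_simps)
    then have "x \<in> {6 * r..6 * r + 5}" "y \<in> {5 * s..5 * s + 4}" by auto
    then show ?thesis unfolding 1 by (intro image_eqI[of _ _ "((x, y), True)"]) auto
  next
    case (2 x y)
    then have "x div 6 = r" "y div 5 = s" using e(2) by (auto simp: block_of_simps)
    then have "x \<in> {6 * r..6 * r + 5}" "y \<in> {5 * s..5 * s + 4}" by auto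
    then show ?thesis unfolding 2 by (intro image_eqI[of _ _ "((x, y), False)"]) auto
  qed
qed

lemma finite_block_edges: "finite (block_edges b)"
  by (cases b) (auto intro: finite_subset[OF block_edges_subset])

text \<open>Thirty left or lower endpoints with two directions each. This is the 60 in the later
  powers and Lipschitz bounds.\<close>

lemma card_block_edges: "card (block_edges b) \<le> 60"
proof -
  obtain r s where b: "b = (r, s)" by (cases b)
  have "card (block_edges (r, s)) \<le> card (({6 * r..6 * r + 5} \<times> {5 * s..5 * s + 4}) \<times> (UNIV :: bool set))"
    by (rule order_trans[OF card_mono[OF _ block_edges_subset] card_image_le]) auto
  then show ?thesis by (simp add: b card_cartesian_product)
qed

text \<open>One column and one row more than \<open>Lam\<close>, since the edges leaving to the
  right and upwards belong to the block as well.\<close>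

definition block_vertices :: "int \<times> int \<Rightarrow> vertex set" where
  "block_vertices b = {6 * fst b..6 * fst b + 6} \<times> {5 * snd b..5 * snd b + 5}"

lemma finite_block_vertices: "finite (block_vertices b)"
  by (simp add: block_vertices_def)

lemma card_block_vertices: "card (block_vertices b) = 42"
  by (simp add: block_vertices_def card_cartesian_product)

lemma block_edge_vertices: "e \<in> block_edges b \<Longrightarrow> e \<subseteq> block_vertices b"
  using block_edges_subset[of "fst b" "snd b"]
  by (force simp: block_vertices_def split: if_splits)

section \<open>Position of the gates inside their blocks\<close>

lemma Lam_eq: "Lam r s = {6 * r..6 * r + 5} \<times> {5 * s..5 * s + 4}"
proof -
  have "v \<in> Lam r s" if "v \<in> {6 * r..6 * r + 5} \<times> {5 * s..5 * s + 4}" for v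
    unfolding Lam_def using that
    by (intro image_eqI[of _ _ "(fst v - 6 * r, snd v - 5 * s)"]) (auto simp: case_prod_beta)
  then show ?thesis by (auto simp: Lam_def)
qed

lemma Lam_bar_eq: "Lam_bar r s = {6 * r + 1..6 * r + 4} \<times> {5 * s + 1..5 * s + 3}"
proof -
  have "v \<in> Lam_bar r s" if "v \<in> {6 * r + 1..6 * r + 4} \<times> {5 * s + 1..5 * s + 3}" for v
    unfolding Lam_bar_def using that
    by (intro image_eqI[of _ _ "(fst v - 6 * r, snd v - 5 * s)"]) (auto simp: case_prod_beta)
  then show ?thesis by (auto simp: Lam_bar_def)
qed

text \<open>All labels compared in \<open>C_event r s\<close> are thereby labels of one block, which
  makes the gates of different blocks independent.\<close>

lemma edges_in_Lam_block: "edges_in (Lam r s) \<subseteq> block_edges (r, s)"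
proof
  fix e assume "e \<in> edges_in (Lam r s)"
  then have e: "e \<in> edges" "e \<subseteq> Lam r s" by (auto simp: edges_in_def)
  have "x div 6 = r \<and> y div 5 = s" if "(x, y) \<in> Lam r s" for x y
    using that by (auto simp: Lam_eq)
  then have "block_of e = (r, s)"
    using e(2) by (cases rule: edgeE[OF e(1)]) (auto simp: block_of_simps)
  with e show "e \<in> block_edges (r, s)" by (simp add: block_edges_def)
qed

lemma A_edges_subset: "A_edges r s \<subseteq> edges_in (Lam r s)"
  by (auto simp: A_edges_def edges_in_def Lam_eq Lam_bar_eq)

lemma bdry_Lam_bar_inner:
  assumes "x \<in> {6 * r + 2, 6 * r + 3}"
  shows "(x, 5 * s + 2) \<notin> bdry (Lam_bar r s)"
proof
  assume "(x, 5 * s + 2) \<in> bdry (Lam_bar r s)"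
  then obtain a b where "(a, b) \<notin> Lam_bar r s" "{(x, 5 * s + 2), (a, b)} \<in> edges"
    by (auto simp: bdry_def)
  then show False using assms by (auto simp: edge_iff Lam_bar_eq)
qed

text \<open>The endpoints of the gate are the two vertices of \<open>Lam_bar r s\<close> off its
  boundary. The label of the gate therefore enters the minimum in \<open>C_event\<close>: the gate
  closes only if its own label exceeds those of all six surrounding edges.\<close>

lemma g_edge_in: "g_edge r s \<in> edges_in (Lam r s) - A_edges r s"
proof -
  have "g_edge r s \<inter> bdry (Lam_bar r s) = {}"
    using bdry_Lam_bar_inner by (auto simp: g_edge_def)
  then show ?thesis by (auto simp: g_edge_def edges_in_def A_edges_def edge_iff Lam_eq)
qed

lemma g_edge_block: "g_edge r s \<in> block_edges (r, s)"
  using g_edge_in edges_in_Lam_block by blast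

lemma A_edges_nonempty: "A_edges r s \<noteq> {}"
proof -
  let ?u = "(6 * r + 1, 5 * s + 2)" and ?v = "(6 * r + 2, 5 * s + 2)"
  have "?u \<in> bdry (Lam_bar r s)"
  proof -
    have "(6 * r, 5 * s + 2) \<notin> Lam_bar r s" "{?u, (6 * r, 5 * s + 2)} \<in> edges" "?u \<in> Lam_bar r s"
      by (auto simp: Lam_bar_eq edge_iff)
    then show ?thesis unfolding bdry_def by blast
  qed
  then have "{?u, ?v} \<inter> bdry (Lam_bar r s) = {?u}" using bdry_Lam_bar_inner[of "6 * r + 2" r s] by auto
  moreover have "{?u, ?v} \<in> edges_in (Lam_bar r s)" by (auto simp: edges_in_def edge_iff Lam_bar_eq)
  ultimately have "{?u, ?v} \<in> A_edges r s" by (simp add: A_edges_def)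
  then show ?thesis by auto
qed

text \<open>Each \<open>x b\<close> is a function on all edges, but only its values on the edges of
  block \<open>b\<close> are read.\<close>

definition glue :: "(int \<times> int \<Rightarrow> edge \<Rightarrow> bool) \<Rightarrow> edge \<Rightarrow> bool" where
  "glue x e = x (block_of e) e"

lemma glue_mono: "x \<le> y \<Longrightarrow> glue x \<le> glue y"
  unfolding le_fun_def glue_def by blast

section \<open>The connection event as a function of finitely many block states, and its
  exploration\<close>

definition box_blocks :: "nat \<Rightarrow> (int \<times> int) set" where
  "box_blocks n = block_of ` edges_in (lattice_box n)"

lemma finite_box_blocks: "finite (box_blocks n)"
  unfolding box_blocks_def by (intro finite_imageI finite_edges_in) (simp add: lattice_box_def)

definition box_reach :: "nat \<Rightarrow> (int \<times> int \<Rightarrow> edge \<Rightarrow> bool) \<Rightarrow> bool" where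
  "box_reach n x \<longleftrightarrow> reaches_distance (0, 0) n (glue x)"

lemma box_reach_mono: "box_reach n x \<Longrightarrow> x \<le> y \<Longrightarrow> box_reach n y"
  unfolding box_reach_def by (erule reaches_distance_mono[OF _ glue_mono])

lemma open_adj_in_box_cong:
  assumes "\<And>e. e \<in> edges_in (lattice_box n) \<Longrightarrow> \<omega> e = \<omega>' e"
  shows "open_adj (in_box n \<omega>) = open_adj (in_box n \<omega>')"
  using assms by (auto simp: open_adj_def in_box_def edges_in_def)

lemma depends_on_box_reach:
  assumes "\<And>b. b \<in> box_blocks n \<Longrightarrow> x b = y b"
  shows "box_reach n x = box_reach n y"
proof -
  have "open_adj (in_box n (glue x)) = open_adj (in_box n (glue y))"
    using assms by (intro open_adj_in_box_cong) (auto simp: glue_def box_blocks_def)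
  then have "reaches_distance (0, 0) n (in_box n (glue x)) = reaches_distance (0, 0) n (in_box n (glue y))"
    by (simp add: reaches_distance_def)
  then show ?thesis by (simp add: box_reach_def reaches_distance_in_box)
qed

text \<open>Closed edges that touch the clusters count as well: they must be seen for the clusters
  to be known to end there. Paths are confined to the box so that finitely many blocks decide the
  set.\<close>

definition explored :: "nat \<Rightarrow> nat \<Rightarrow> (int \<times> int \<Rightarrow> edge \<Rightarrow> bool) \<Rightarrow> (int \<times> int) set" where
  "explored n k x = {block_of e | e u v. e \<in> edges_in (lattice_box n) \<and> v \<in> e \<and> sup_norm u = int k \<and>
     (u, v) \<in> (open_adj (in_box n (glue x)))\<^sup>*}"

lemma explored_mono: "x \<le> y \<Longrightarrow> explored n k x \<subseteq> explored n k y"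
proof -
  assume "x \<le> y"
  then have "in_box n (glue x) \<le> in_box n (glue y)"
    using glue_mono[of x y] by (auto simp: in_box_def le_fun_def)
  from rtrancl_mono[OF open_adj_mono[OF this]] show ?thesis unfolding explored_def by blast
qed

lemma depends_on_explored:
  assumes "\<And>b. b \<in> box_blocks n \<Longrightarrow> x b = y b"
  shows "explored n k x = explored n k y"
proof -
  have "open_adj (in_box n (glue x)) = open_adj (in_box n (glue y))"
    using assms by (intro open_adj_in_box_cong) (auto simp: glue_def box_blocks_def)
  then show ?thesis by (simp add: explored_def)
qed

text \<open>Every edge of the box at an already reached vertex lies in an explored block, so the
  same step is possible in both configurations. Induction along the path does the rest.\<close>

lemma explored_agree:
  assumes agree: "\<And>b. b \<in> explored n k x \<Longrightarrow> y b = x b"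
    and u: "sup_norm u = int k"
  shows "(u, v) \<in> (open_adj (in_box n (glue x)))\<^sup>* \<longleftrightarrow> (u, v) \<in> (open_adj (in_box n (glue y)))\<^sup>*"
proof -
  have step: "(v, w) \<in> open_adj (in_box n (glue x)) \<longleftrightarrow> (v, w) \<in> open_adj (in_box n (glue y))"
    if "(u, v) \<in> (open_adj (in_box n (glue x)))\<^sup>*" for v w
  proof (cases "{v, w} \<in> edges_in (lattice_box n)")
    case True
    then have "block_of {v, w} \<in> explored n k x" using that u unfolding explored_def by blast
    then show ?thesis using agree by (simp add: open_adj_def in_box_def glue_def)
  next
    case False
    then show ?thesis by (auto simp: open_adj_def in_box_def edges_in_def)
  qed
  show ?thesis
  proof
    assume "(u, v) \<in> (open_adj (in_box n (glue x)))\<^sup>*"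
    then show "(u, v) \<in> (open_adj (in_box n (glue y)))\<^sup>*"
      by (induction rule: rtrancl_induct) (auto intro: rtrancl_into_rtrancl simp: step)
  next
    assume "(u, v) \<in> (open_adj (in_box n (glue y)))\<^sup>*"
    then show "(u, v) \<in> (open_adj (in_box n (glue x)))\<^sup>*"
      by (induction rule: rtrancl_induct) (auto intro: rtrancl_into_rtrancl simp flip: step)
  qed
qed

text \<open>A connection from the origin to \<open>\<partial>B(n)\<close> crosses \<open>\<partial>B(k)\<close>, so it lies in the clusters of \<open>\<partial>B(k)\<close>.\<close>

lemma box_reach_iff_through:
  assumes "k \<le> n"
  shows "box_reach n x \<longleftrightarrow> (\<exists>u v. sup_norm u = int k \<and> sup_norm v = int n \<and>
    (u, (0, 0)) \<in> (open_adj (in_box n (glue x)))\<^sup>* \<and> (u, v) \<in> (open_adj (in_box n (glue x)))\<^sup>*)"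
    (is "_ = ?R")
proof
  let ?C = "(open_adj (in_box n (glue x)))\<^sup>*"
  assume "box_reach n x"
  then have "reaches_distance (0, 0) n (in_box n (glue x))"
    by (simp add: box_reach_def reaches_distance_in_box)
  then obtain v where v: "sup_norm v = int n" "((0, 0), v) \<in> ?C"
    by (auto simp: reaches_distance_def zero_prod_def[symmetric])
  have "\<exists>u. sup_norm u = int k \<and> ((0, 0), u) \<in> (open_adj (in_box n (glue x)) \<inter> {x. sup_norm x \<le> int k} \<times> {x. sup_norm x \<le> int k})\<^sup>* \<and> (u, v) \<in> ?C"
    using v(2)
  proof (rule rtrancl_crossing)
    show "sup_norm y \<le> sup_norm z + 1" if "(z, y) \<in> open_adj (in_box n (glue x))" for y z
      using sup_norm_edge[of z y 0] that by (auto simp: open_adj_def)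
  qed (use v assms in auto)
  then obtain u where u: "sup_norm u = int k" "(u, v) \<in> ?C"
    and 1: "((0, 0), u) \<in> (open_adj (in_box n (glue x)) \<inter> {x. sup_norm x \<le> int k} \<times> {x. sup_norm x \<le> int k})\<^sup>*"
    by blast
  from 1 have "((0, 0), u) \<in> ?C" by (rule rtrancl_mono[THEN subsetD, rotated]) blast
  then have "(u, (0, 0)) \<in> ?C" using sym_open_adj_rtrancl by (rule symD[rotated])
  with u v show ?R by blast
next
  assume ?R
  then obtain u v where uv: "sup_norm v = int n" "(u, (0, 0)) \<in> (open_adj (in_box n (glue x)))\<^sup>*"
    "(u, v) \<in> (open_adj (in_box n (glue x)))\<^sup>*" by blast
  then have "((0, 0), v) \<in> (open_adj (in_box n (glue x)))\<^sup>*"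
    by (meson symD[OF sym_open_adj_rtrancl] rtrancl_trans)
  then have "reaches_distance (0, 0) n (in_box n (glue x))"
    unfolding reaches_distance_def using uv(1) by (intro exI[of _ v]) (simp add: zero_prod_def[symmetric])
  then show "box_reach n x" by (simp add: box_reach_def reaches_distance_in_box)
qed

text \<open>This supplies the hypothesis \<open>f_local\<close> of \<open>OSSS_state\<close>: the
  clusters of the sphere of radius \<open>k\<close>, known from the explored blocks, decide the
  event.\<close>

lemma box_reach_explored:
  assumes "k \<le> n" "\<And>b. b \<in> explored n k x \<Longrightarrow> y b = x b"
  shows "box_reach n y = box_reach n x"
  unfolding box_reach_iff_through[OF assms(1)]
  using explored_agree[of n k x y, OF assms(2)] by blast

text \<open>An explored block has a vertex \<open>v\<close> in the cluster of some \<open>u\<close>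
  of norm \<open>k\<close>, and two vertices are at least as far apart as their norms. Only the
  starting vertex \<open>v\<close> remains in the bound, which can later be summed over
  \<open>k\<close>.\<close>

lemma explored_reaches:
  assumes "b \<in> explored n k x"
  shows "\<exists>v\<in>block_vertices b. sup_norm v \<le> int n \<and>
    reaches_distance v (nat \<bar>int k - sup_norm v\<bar>) (glue x)"
proof -
  obtain e u v where b: "b = block_of e" and e: "e \<in> edges_in (lattice_box n)" "v \<in> e"
    and u: "sup_norm u = int k" "(u, v) \<in> (open_adj (in_box n (glue x)))\<^sup>*"
    using assms unfolding explored_def by blast
  have "v \<in> block_vertices b"
    using e block_edge_vertices[of e b] b by (auto simp: block_edges_def edges_in_def)
  moreover have "sup_norm v \<le> int n" using e by (auto simp: edges_in_def lattice_box_eq)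
  moreover have "reaches_distance v (nat \<bar>int k - sup_norm v\<bar>) (glue x)"
  proof (rule reaches_distanceI)
    have "open_adj (in_box n (glue x)) \<subseteq> open_adj (glue x)" by (auto simp: open_adj_in_box)
    then have "(u, v) \<in> (open_adj (glue x))\<^sup>*" using u(2) rtrancl_mono by blast
    then show "(v, u) \<in> (open_adj (glue x))\<^sup>*" using sym_open_adj_rtrancl by (rule symD[rotated])
    show "int (nat \<bar>int k - sup_norm v\<bar>) \<le> sup_norm (u - v)"
      using sup_norm_triangle[of u v] u(1) by simp
  qed
  ultimately show ?thesis by blast
qed

lemma Lam_connected:
  assumes "v \<in> Lam 0 0"
  shows "((0, 0), v) \<in> (open_adj (\<lambda>e. e \<in> block_edges (0, 0)))\<^sup>*"
proof -
  let ?R = "open_adj (\<lambda>e. e \<in> block_edges (0, 0))"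
  have adj: "({u, w} \<in> edges \<and> u \<in> Lam 0 0 \<and> w \<in> Lam 0 0) \<Longrightarrow> (u, w) \<in> ?R" for u w
    using edges_in_Lam_block[of 0 0] by (auto simp: open_adj_def edges_in_def)
  have row: "((0, 0), (int i, 0)) \<in> ?R\<^sup>*" if "i \<le> 5" for i
    using that
  proof (induction i)
    case (Suc i)
    then have "((int i, 0), (int (Suc i), 0)) \<in> ?R" by (intro adj) (auto simp: edge_iff Lam_eq)
    with Suc show ?case by (auto intro: rtrancl_into_rtrancl)
  qed simp
  have col: "((int i, 0), (int i, int j)) \<in> ?R\<^sup>*" if "i \<le> 5" "j \<le> 4" for i j
    using that
  proof (induction j)
    case (Suc j)
    then have "((int i, int j), (int i, int (Suc j))) \<in> ?R" by (intro adj) (auto simp: edge_iff Lam_eq)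
    with Suc show ?case by (auto intro: rtrancl_into_rtrancl)
  qed simp
  obtain i j where v: "v = (int i, int j)" "i \<le> 5" "j \<le> 4"
  proof -
    have "v = (int (nat (fst v)), int (nat (snd v)))" "nat (fst v) \<le> 5" "nat (snd v) \<le> 4"
      using assms by (auto simp: Lam_eq)
    then show thesis using that by blast
  qed
  show ?thesis unfolding v(1) by (rule rtrancl_trans[OF row col]) (use v in auto)
qed

text \<open>The vertices of \<open>Lam 0 0\<close> have norm at most 5, so a path from
  \<open>v\<close> to distance \<open>m + 5\<close> ends at norm at least \<open>m\<close>, and the
  opened block connects its start to the origin.\<close>

lemma opened_block_reaches:
  assumes "reaches_distance v (m + 5) (glue x)" "v \<in> Lam 0 0"
  shows "box_reach m (x((0, 0) := (\<lambda>e. e \<in> block_edges (0, 0))))"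
proof -
  let ?x = "x((0, 0) := (\<lambda>e. e \<in> block_edges (0, 0)))"
  obtain w where w: "sup_norm (w - v) = int (m + 5)" "(v, w) \<in> (open_adj (glue x))\<^sup>*"
    using assms(1) by (auto simp: reaches_distance_def)
  have "open_adj (glue x) \<subseteq> open_adj (glue ?x)"
    by (auto simp: open_adj_def glue_def block_edges_def)
  then have 1: "(v, w) \<in> (open_adj (glue ?x))\<^sup>*" using w(2) rtrancl_mono by blast
  have "open_adj (\<lambda>e. e \<in> block_edges (0, 0)) \<subseteq> open_adj (glue ?x)"
    by (auto simp: open_adj_def glue_def block_edges_def)
  then have "((0, 0), v) \<in> (open_adj (glue ?x))\<^sup>*" using Lam_connected[OF assms(2)] rtrancl_mono by blast
  with 1 have "((0, 0), w) \<in> (open_adj (glue ?x))\<^sup>*" by (rule rtrancl_trans[rotated])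
  moreover have "int m \<le> sup_norm (w - (0, 0))"
  proof -
    have "sup_norm v \<le> 5" using assms(2) by (auto simp: Lam_eq sup_norm_def)
    then show ?thesis using w(1) sup_norm_triangle[of "w - v" "- v"]
      by (simp add: sup_norm_def zero_prod_def[symmetric] split: if_splits) linarith
  qed
  ultimately show ?thesis unfolding box_reach_def by (rule reaches_distanceI)
qed

section \<open>Independence of the blocks\<close>

abbreviation unit_uniform :: "real measure" where
  "unit_uniform \<equiv> restrict_space lborel {0..1}"

interpretation U: prob_space unif_space
  by (rule prob_space_unif_space)

lemma prob_space_unit_uniform: "prob_space unit_uniform"
  by (intro prob_space_restrict_space) auto

interpretation edge_product: product_prob_space "\<lambda>_. unit_uniform" edges
  by (intro product_prob_spaceI prob_space_unit_uniform)

abbreviation prob_unif :: "((edge \<Rightarrow> real) \<Rightarrow> bool) \<Rightarrow> real" where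
  "prob_unif Q \<equiv> measure unif_space {U \<in> space unif_space. Q U}"

lemma prob_edges:
  assumes "finite F" "F \<subseteq> edges" "\<And>e. e \<in> F \<Longrightarrow> X e \<in> sets borel" "\<And>e. e \<in> F \<Longrightarrow> X e \<subseteq> {0..1}"
  shows "prob_unif (\<lambda>U. \<forall>e\<in>F. U e \<in> X e) = (\<Prod>e\<in>F. measure lborel (X e))"
proof -
  have sets: "X e \<in> sets unit_uniform" if "e \<in> F" for e
    using assms(3,4)[OF that] by (auto simp: sets_restrict_space_iff)
  have "emeasure unif_space {U \<in> space unif_space. \<forall>e\<in>F. U e \<in> X e} = (\<Prod>e\<in>F. emeasure unit_uniform (X e))"
    unfolding unif_space_def by (rule edge_product.emeasure_PiM_Collect) (use assms sets in auto)
  also have "\<dots> = (\<Prod>e\<in>F. ennreal (measure unit_uniform (X e)))"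
    using prob_space_unit_uniform
    by (intro prod.cong refl finite_measure.emeasure_eq_measure) (auto simp: prob_space_def)
  also have "\<dots> = ennreal (\<Prod>e\<in>F. measure unit_uniform (X e))" by (simp add: prod_ennreal)
  also have "(\<Prod>e\<in>F. measure unit_uniform (X e)) = (\<Prod>e\<in>F. measure lborel (X e))"
    using assms(4) by (intro prod.cong refl measure_restrict_space) auto
  finally show ?thesis by (simp add: U.emeasure_eq_measure prod_nonneg)
qed

lemma prob_edge_interval:
  assumes "e \<in> edges" "0 \<le> a" "a \<le> b" "b \<le> 1"
  shows "prob_unif (\<lambda>U. a < U e \<and> U e \<le> b) = b - a"
proof -
  have "{a<..b} \<subseteq> {0..1}" using assms by auto
  then show ?thesis using prob_edges[of "{e}" "\<lambda>_. {a<..b}"] assms by simp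
qed

lemma edge_label_bounds: "U \<in> space unif_space \<Longrightarrow> e \<in> edges \<Longrightarrow> 0 \<le> U e \<and> U e \<le> 1"
  by (auto simp: unif_space_def space_PiM PiE_iff space_restrict_space)

lemma measurable_label:
  "e \<in> K \<Longrightarrow> (\<lambda>U. U e) \<in> borel_measurable (PiM K (\<lambda>_. unit_uniform))"
proof -
  assume "e \<in> K"
  then have "(\<lambda>U. U e) \<in> measurable (PiM K (\<lambda>_. unit_uniform)) unit_uniform"
    by (rule measurable_component_singleton)
  then show ?thesis by (simp add: measurable_restrict_space2_iff)
qed

lemma edges_nonempty: "edges \<noteq> {}"
  using g_edge_in by (auto simp: edges_in_def)

lemma indep_labels: "U.indep_vars (\<lambda>_. unit_uniform) (\<lambda>e U. U e) edges"
proof -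
  have rv: "(\<lambda>U. U e) \<in> measurable unif_space unit_uniform" if "e \<in> edges" for e
    using that unfolding unif_space_def by (rule measurable_component_singleton)
  have "distr unif_space (PiM edges (\<lambda>_. unit_uniform)) (\<lambda>x. \<lambda>e\<in>edges. x e) = distr unif_space unif_space (\<lambda>x. x)"
    by (rule distr_cong) (auto simp: unif_space_def space_PiM PiE_def extensional_restrict)
  also have "\<dots> = unif_space" by (rule distr_id)
  also have "unif_space = PiM edges (\<lambda>e. distr unif_space unit_uniform (\<lambda>U. U e))"
    unfolding unif_space_def
    by (rule PiM_cong[OF refl]) (rule edge_product.PiM_component[symmetric])
  finally show ?thesis
    using U.indep_vars_iff_distr_eq_PiM'[where M' = "\<lambda>_. unit_uniform" and X = "\<lambda>e U. U e" and I = edges] edges_nonempty rv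
    by blast
qed

lemma prob_disjoint_edge_sets:
  assumes "finite I" "\<And>b. b \<in> I \<Longrightarrow> K b \<subseteq> edges" "disjoint_family_on K I"
    and Q: "\<And>b. b \<in> I \<Longrightarrow> Measurable.pred (PiM (K b) (\<lambda>_. unit_uniform)) (Q b)"
    and Q_restrict: "\<And>b U. b \<in> I \<Longrightarrow> Q b (restrict U (K b)) = Q b U"
  shows "prob_unif (\<lambda>U. \<forall>b\<in>I. Q b U) = (\<Prod>b\<in>I. prob_unif (Q b))"
proof (cases "I = {}")
  case True
  then show ?thesis by (simp add: U.prob_space)
next
  case False
  have "U.indep_vars (\<lambda>b. PiM (K b) (\<lambda>_. unit_uniform)) (\<lambda>b U. restrict (\<lambda>e. U e) (K b)) I"
    by (rule U.indep_vars_restrict[OF indep_labels]) (use assms in auto)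
  then have "U.indep_vars (\<lambda>_. count_space UNIV) (\<lambda>b U. Q b (restrict (\<lambda>e. U e) (K b))) I"
    by (rule U.indep_vars_compose2) (use Q in auto)
  from U.indep_varsD_finite[OF this False assms(1), of "\<lambda>_. {True}"]
  have "measure unif_space (\<Inter>b\<in>I. (\<lambda>U. Q b (restrict (\<lambda>e. U e) (K b))) -` {True} \<inter> space unif_space)
    = (\<Prod>b\<in>I. measure unif_space ((\<lambda>U. Q b (restrict (\<lambda>e. U e) (K b))) -` {True} \<inter> space unif_space))"
    by simp
  moreover have "(\<Inter>b\<in>I. (\<lambda>U. Q b (restrict (\<lambda>e. U e) (K b))) -` {True} \<inter> space unif_space)
      = {U \<in> space unif_space. \<forall>b\<in>I. Q b U}"
    using Q_restrict False by auto
  moreover have "(\<lambda>U. Q b (restrict (\<lambda>e. U e) (K b))) -` {True} \<inter> space unif_space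
      = {U \<in> space unif_space. Q b U}" if "b \<in> I" for b
    using Q_restrict[OF that] by auto
  ultimately show ?thesis by simp
qed

section \<open>Block states driven by the uniform labels\<close>

definition gate_closed :: "int \<times> int \<Rightarrow> (edge \<Rightarrow> real) \<Rightarrow> bool" where
  "gate_closed b U \<longleftrightarrow> Max (U ` A_edges (fst b) (snd b))
     < Min (U ` (edges_in (Lam (fst b) (snd b)) - A_edges (fst b) (snd b)))"

text \<open>The gate is read off by \<open>gate_closed\<close>, which is \<open>C_event\<close>
  without membership in the sample space, so that a block can be evaluated on labels restricted to
  it. Edges of other blocks are set to closed, which leaves finitely many states.\<close>

definition block_config :: "real \<Rightarrow> (edge \<Rightarrow> real) \<Rightarrow> int \<times> int \<Rightarrow> edge \<Rightarrow> bool" where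
  "block_config t U b e \<longleftrightarrow> e \<in> block_edges b \<and> U e \<le> t \<and>
     (e = g_edge (fst b) (snd b) \<longrightarrow> \<not> gate_closed b U)"

lemma glue_block_config:
  assumes "U \<in> space unif_space" "e \<in> edges"
  shows "glue (block_config t U) e = omega_tilde t U e"
proof -
  have g: "block_of (g_edge r s) = (r, s)" for r s
    using g_edge_block[of r s] by (auto simp: block_edges_def)
  have C: "U \<in> C_event r s \<longleftrightarrow> gate_closed (r, s) U" for r s
    using assms(1) by (simp add: C_event_def gate_closed_def)
  have "(\<forall>r s. e = g_edge r s \<longrightarrow> \<not> gate_closed (r, s) U) \<longleftrightarrow>
    (e = g_edge (fst (block_of e)) (snd (block_of e)) \<longrightarrow> \<not> gate_closed (block_of e) U)"
    by (metis g fst_conv snd_conv)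
  then show ?thesis using assms(2)
    by (simp add: glue_def block_config_def omega_tilde_def block_edges_def C)
qed

lemma open_adj_glue_block_config:
  "U \<in> space unif_space \<Longrightarrow> open_adj (glue (block_config t U)) = open_adj (omega_tilde t U)"
  by (auto simp: open_adj_def glue_block_config)

lemma edges_in_Lam_block': "edges_in (Lam (fst b) (snd b)) \<subseteq> block_edges b"
  using edges_in_Lam_block[of "fst b" "snd b"] by simp

lemma gate_closed_cong:
  assumes "\<And>e. e \<in> block_edges b \<Longrightarrow> U e = V e"
  shows "gate_closed b U = gate_closed b V"
proof -
  have "U ` A_edges (fst b) (snd b) = V ` A_edges (fst b) (snd b)"
    using assms edges_in_Lam_block' A_edges_subset by (intro image_cong) blast+
  moreover have "U ` (edges_in (Lam (fst b) (snd b)) - A_edges (fst b) (snd b))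
      = V ` (edges_in (Lam (fst b) (snd b)) - A_edges (fst b) (snd b))"
    using assms edges_in_Lam_block' by (intro image_cong) blast+
  ultimately show ?thesis by (simp add: gate_closed_def)
qed

lemma block_config_restrict: "block_config t (restrict U (block_edges b)) b = block_config t U b"
  using gate_closed_cong[of b "restrict U (block_edges b)" U] by (auto simp: block_config_def fun_eq_iff)

lemma pred_block_config:
  assumes "block_edges b \<subseteq> K"
  shows "Measurable.pred (PiM K (\<lambda>_. unit_uniform)) (\<lambda>U. block_config t U b e)"
proof (cases "e \<in> block_edges b")
  case True
  let ?A = "A_edges (fst b) (snd b)" and ?B = "edges_in (Lam (fst b) (snd b))"
  have sub: "?A \<subseteq> K" "?B \<subseteq> K" using assms edges_in_Lam_block' A_edges_subset by blast+
  have m1: "(\<lambda>U. Max (U ` ?A)) \<in> borel_measurable (PiM K (\<lambda>_. unit_uniform))"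
    using sub by (intro borel_measurable_Max finite_A measurable_label) auto
  have m2: "(\<lambda>U. Min (U ` (?B - ?A))) \<in> borel_measurable (PiM K (\<lambda>_. unit_uniform))"
    using sub by (intro borel_measurable_Min finite_Diff finite_edges_in finite_Lam measurable_label) auto
  have [measurable]: "Measurable.pred (PiM K (\<lambda>_. unit_uniform)) (gate_closed b)"
    unfolding gate_closed_def using borel_measurable_less[OF m1 m2] by (simp add: pred_def)
  have [measurable]: "(\<lambda>U. U e) \<in> borel_measurable (PiM K (\<lambda>_. unit_uniform))"
    using True assms by (intro measurable_label) auto
  show ?thesis unfolding block_config_def using True by measurable
qed (simp add: block_config_def)

definition configs :: "int \<times> int \<Rightarrow> (edge \<Rightarrow> bool) set" where
  "configs b = {a. \<forall>e. a e \<longrightarrow> e \<in> block_edges b}"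

lemma finite_configs: "finite (configs b)"
proof (rule finite_subset)
  show "configs b \<subseteq> (\<lambda>S e. e \<in> S) ` Pow (block_edges b)"
  proof
    fix a assume "a \<in> configs b"
    then show "a \<in> (\<lambda>S e. e \<in> S) ` Pow (block_edges b)"
      by (intro image_eqI[of _ _ "{e. a e}"]) (auto simp: configs_def)
  qed
qed (simp add: finite_block_edges)

lemma pred_block_config_eq:
  assumes "block_edges b \<subseteq> K"
  shows "Measurable.pred (PiM K (\<lambda>_. unit_uniform)) (\<lambda>U. P (block_config t U b))"
proof -
  have eq: "P (block_config t U b) \<longleftrightarrow> (\<exists>a\<in>configs b. P a \<and> (\<forall>e\<in>block_edges b. block_config t U b e = a e))" for U
  proof
    assume "P (block_config t U b)"
    then show "\<exists>a\<in>configs b. P a \<and> (\<forall>e\<in>block_edges b. block_config t U b e = a e)"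
      by (intro bexI[of _ "block_config t U b"]) (auto simp: configs_def block_config_def)
  next
    assume "\<exists>a\<in>configs b. P a \<and> (\<forall>e\<in>block_edges b. block_config t U b e = a e)"
    then obtain a where a: "a \<in> configs b" "P a" "\<forall>e\<in>block_edges b. block_config t U b e = a e" by blast
    then have "block_config t U b = a" by (auto simp: fun_eq_iff configs_def block_config_def)
    with a show "P (block_config t U b)" by simp
  qed
  have val: "Measurable.pred (PiM K (\<lambda>_. unit_uniform)) (\<lambda>U. block_config t U b e = c)" for e c
    using pred_block_config[OF assms, of t e] by (cases c) (auto intro: pred_intros_logic)
  show ?thesis unfolding eq
    by (intro pred_intros_finite finite_configs finite_block_edges pred_intros_logic(3) val) simp
qed

definition config_weight :: "real \<Rightarrow> int \<times> int \<Rightarrow> (edge \<Rightarrow> bool) \<Rightarrow> real" where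
  "config_weight t b a = prob_unif (\<lambda>U. block_config t U b = a)"

lemma block_config_in: "block_config t U b \<in> configs b"
  by (simp add: configs_def block_config_def)

lemma sets_block_config:
  "{U \<in> space unif_space. P (block_config t U b)} \<in> sets unif_space"
  using pred_block_config_eq[of b edges P t] by (auto simp: unif_space_def block_edges_def pred_def)

lemma sum_config_weight:
  "(\<Sum>a\<in>configs b. config_weight t b a * of_bool (P a)) = prob_unif (\<lambda>U. P (block_config t U b))"
proof -
  have "(\<Sum>a\<in>configs b. config_weight t b a * of_bool (P a)) = (\<Sum>a\<in>{a\<in>configs b. P a}. config_weight t b a)"
    by (simp add: sum.If_cases finite_configs of_bool_def Collect_conj_eq Int_commute if_distrib cong: if_cong)
  also have "\<dots> = measure unif_space (\<Union>a\<in>{a\<in>configs b. P a}. {U \<in> space unif_space. block_config t U b = a})"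
    unfolding config_weight_def
    by (rule U.finite_measure_finite_Union[symmetric])
       (auto simp: finite_configs disjoint_family_on_def intro: sets_block_config[where P = "\<lambda>c. c = _"])
  also have "(\<Union>a\<in>{a\<in>configs b. P a}. {U \<in> space unif_space. block_config t U b = a})
     = {U \<in> space unif_space. P (block_config t U b)}"
    using block_config_in[of t _ b] by auto
  finally show ?thesis .
qed

lemma finite_product_configs: "finite_product configs (config_weight t)"
proof
  show "(\<Sum>a\<in>configs b. config_weight t b a) = 1" for b
    using sum_config_weight[of t b "\<lambda>_. True"] by (simp add: U.prob_space)
qed (auto simp: finite_configs config_weight_def)

lemma sets_config_event:
  assumes "finite I" and dep: "\<And>x y. (\<And>b. b \<in> I \<Longrightarrow> x b = y b) \<Longrightarrow> P x = P y"
  shows "{U \<in> space unif_space. P (block_config t U)} \<in> sets unif_space"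
proof -
  interpret W: finite_product configs "config_weight t" by (rule finite_product_configs)
  let ?Y = "{y \<in> W.completions I bot. P y}"
  have eq: "P (block_config t U) \<longleftrightarrow> (\<exists>y\<in>?Y. \<forall>b\<in>I. block_config t U b = y b)" for U
  proof
    assume P: "P (block_config t U)"
    define y where "y b = (if b \<in> I then block_config t U b else bot)" for b
    have "P y = P (block_config t U)" by (rule dep) (simp add: y_def)
    then have "y \<in> ?Y" using P block_config_in by (auto simp: W.completions_def y_def)
    then show "\<exists>y\<in>?Y. \<forall>b\<in>I. block_config t U b = y b"
      by (rule bexI[rotated]) (simp add: y_def)
  next
    assume "\<exists>y\<in>?Y. \<forall>b\<in>I. block_config t U b = y b"
    then obtain y where "y \<in> ?Y" "\<forall>b\<in>I. block_config t U b = y b" by blast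
    then show "P (block_config t U)" using dep[of "block_config t U" y] by simp
  qed
  have "finite ?Y" using W.finite_completions[OF assms(1)] by simp
  then show ?thesis unfolding eq
    by (intro sets.sets_Collect_finite_Ex sets.sets_Collect_finite_All assms(1) sets_block_config[where P = "\<lambda>c. c = _"])
qed

text \<open>Transfer from the labels to the finite product: the event is a disjoint union over the
  states of the blocks in \<open>I\<close>, and since the blocks have disjoint edge sets, each term
  has a product probability. The value \<open>bot\<close> outside \<open>I\<close> is a mere
  placeholder.\<close>

lemma prob_config_event:
  assumes "finite I" and dep: "\<And>x y. (\<And>b. b \<in> I \<Longrightarrow> x b = y b) \<Longrightarrow> P x = P y"
  shows "prob_unif (\<lambda>U. P (block_config t U))
    = finite_product.expect configs (config_weight t) I (\<lambda>y. of_bool (P y)) bot"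
proof -
  interpret W: finite_product configs "config_weight t" by (rule finite_product_configs)
  define E where "E y = {U \<in> space unif_space. \<forall>b\<in>I. block_config t U b = y b}" for y
  define Y where "Y = {y \<in> W.completions I bot. P y}"
  have finY: "finite Y" using W.finite_completions[OF assms(1)] by (simp add: Y_def)
  have setsE: "E y \<in> sets unif_space" for y
    unfolding E_def by (rule sets.sets_Collect_finite_All[OF sets_block_config assms(1)])
  have probE: "measure unif_space (E y) = (\<Prod>b\<in>I. config_weight t b (y b))" for y
    unfolding E_def config_weight_def
  proof (rule prob_disjoint_edge_sets[OF assms(1), where K = block_edges])
    show "disjoint_family_on block_edges I" by (auto simp: disjoint_family_on_def block_edges_def)
    show "block_edges b \<subseteq> edges" for b by (auto simp: block_edges_def)
    show "Measurable.pred (PiM (block_edges b) (\<lambda>_. unit_uniform)) (\<lambda>U. block_config t U b = y b)" for b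
      by (rule pred_block_config_eq) simp
  qed (simp only: block_config_restrict)
  have "{U \<in> space unif_space. P (block_config t U)} = (\<Union>y\<in>Y. E y)"
  proof (intro set_eqI iffI)
    fix U assume U: "U \<in> {U \<in> space unif_space. P (block_config t U)}"
    define y where "y b = (if b \<in> I then block_config t U b else bot)" for b
    have "P y = P (block_config t U)" by (rule dep) (simp add: y_def)
    then have "y \<in> Y" using U block_config_in by (auto simp: Y_def W.completions_def y_def)
    moreover have "U \<in> E y" using U by (simp add: E_def y_def)
    ultimately show "U \<in> (\<Union>y\<in>Y. E y)" by blast
  next
    fix U assume "U \<in> (\<Union>y\<in>Y. E y)"
    then obtain y where y: "y \<in> Y" "U \<in> E y" by blast
    then have "P (block_config t U) = P y" by (intro dep) (simp add: E_def)
    then show "U \<in> {U \<in> space unif_space. P (block_config t U)}" using y by (simp add: Y_def E_def)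
  qed
  then have "prob_unif (\<lambda>U. P (block_config t U)) = measure unif_space (\<Union>y\<in>Y. E y)" by simp
  also have "\<dots> = (\<Sum>y\<in>Y. measure unif_space (E y))"
  proof (rule U.finite_measure_finite_Union[OF finY])
    show "disjoint_family_on E Y" unfolding disjoint_family_on_def
    proof (intro ballI impI equals0I)
      fix y z U assume yz: "y \<in> Y" "z \<in> Y" "y \<noteq> z" "U \<in> E y \<inter> E z"
      have "y b = z b" for b
      proof (cases "b \<in> I")
        case True
        have "U \<in> E y" "U \<in> E z" using yz(4) by auto
        then have "block_config t U b = y b" and "z b = block_config t U b" using True by (simp_all add: E_def)
        then show ?thesis by simp
      next
        case False
        then show ?thesis using yz(1,2) by (simp add: Y_def W.completions_def del: split_paired_All)
      qed
      with yz(3) show False by auto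
    qed
  qed (use setsE in auto)
  also have "\<dots> = W.expect I (\<lambda>y. of_bool (P y)) bot"
    unfolding W.expect_def probE Y_def
    by (rule sum.mono_neutral_cong_left) (auto simp: W.finite_completions assms(1))
  finally show ?thesis .
qed

lemma sets_reaches_distance: "{\<omega> \<in> space config_space. reaches_distance v m \<omega>} \<in> sets config_space"
proof -
  note pred_relpow[measurable]
  show ?thesis unfolding reaches_distance_def rtrancl_power by measurable
qed

lemma sets_omega_reaches:
  "{U \<in> space unif_space. reaches_distance v m (omega_tilde t U)} \<in> sets unif_space"
  using measurable_sets[OF measurable_omega_tilde sets_reaches_distance[of v m], of t]
    measurable_space[OF measurable_omega_tilde, of _ t]
  by (auto simp: vimage_def Int_def conj_commute cong: conj_cong)

definition reach_prob :: "vertex \<Rightarrow> nat \<Rightarrow> real \<Rightarrow> real" where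
  "reach_prob v m t = prob_unif (\<lambda>U. reaches_distance v m (omega_tilde t U))"

lemma reach_prob_config: "reach_prob v m t = prob_unif (\<lambda>U. reaches_distance v m (glue (block_config t U)))"
  unfolding reach_prob_def
proof (intro arg_cong[where f = "measure unif_space"] Collect_cong conj_cong refl)
  fix U assume "U \<in> space unif_space"
  then show "reaches_distance v m (omega_tilde t U) = reaches_distance v m (glue (block_config t U))"
    by (simp only: reaches_distance_def open_adj_glue_block_config)
qed

lemma theta_tilde_eq: "theta_tilde n t = reach_prob (0, 0) n t"
proof -
  have "theta_tilde n t = measure unif_space (omega_tilde t -` connects_to (bdry (lattice_box n)) \<inter> space unif_space)"
    unfolding theta_tilde_def P_tilde_def
    by (rule measure_distr[OF measurable_omega_tilde sets_connects_to])
  also have "omega_tilde t -` connects_to (bdry (lattice_box n)) \<inter> space unif_space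
    = {U \<in> space unif_space. reaches_distance (0, 0) n (omega_tilde t U)}"
    using measurable_space[OF measurable_omega_tilde, of _ t] by (auto simp: connects_to_bdry_iff)
  finally show ?thesis by (simp add: reach_prob_def)
qed

lemma theta_tilde_expect:
  assumes "finite I" "box_blocks n \<subseteq> I"
  shows "theta_tilde n t = finite_product.expect configs (config_weight t) I (\<lambda>y. of_bool (box_reach n y)) bot"
  unfolding theta_tilde_eq reach_prob_config box_reach_def[symmetric]
  by (rule prob_config_event[OF assms(1)]) (use assms(2) in \<open>auto intro!: depends_on_box_reach\<close>)

section \<open>Changing the parameter in one block\<close>

text \<open>Any label in \<open>A_edges\<close> exceeds that of the gate, which is one of the labels
  in the minimum; so the maximum cannot lie below the minimum.\<close>

lemma block_config_gate_open:
  assumes "\<And>e. e \<in> block_edges b \<Longrightarrow> e \<noteq> g_edge (fst b) (snd b) \<Longrightarrow> U (g_edge (fst b) (snd b)) < U e"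
  shows "block_config t U b = (\<lambda>e. e \<in> block_edges b \<and> U e \<le> t)"
proof -
  let ?A = "A_edges (fst b) (snd b)" and ?E = "edges_in (Lam (fst b) (snd b))"
  let ?g = "g_edge (fst b) (snd b)"
  have g: "?g \<in> ?E - ?A" by (rule g_edge_in)
  obtain a where a: "a \<in> ?A" using A_edges_nonempty by auto
  have "\<not> gate_closed b U"
  proof
    assume "gate_closed b U"
    have "U a \<le> Max (U ` ?A)" using a by (intro Max_ge finite_imageI finite_A) auto
    also have "\<dots> < Min (U ` (?E - ?A))" using \<open>gate_closed b U\<close> by (simp add: gate_closed_def)
    also have "\<dots> \<le> U ?g" using g by (intro Min_le finite_imageI finite_Diff finite_edges_in finite_Lam) auto
    also have "\<dots> < U a" using a g A_edges_subset edges_in_Lam_block' by (intro assms) blast+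
    finally have "U a < U a" .
    then show False by simp
  qed
  then show ?thesis by (auto simp: block_config_def fun_eq_iff)
qed

text \<open>The gate condition does not involve the parameter, so raising the parameter can only
  open edges.\<close>

lemma block_config_mono: "s \<le> t \<Longrightarrow> block_config s U b \<le> block_config t U b"
  by (auto simp: block_config_def le_fun_def)

lemma finite_product_mult_lower:
  fixes f :: "'a \<Rightarrow> real"
  assumes "finite F" "\<And>x. x \<in> F \<Longrightarrow> m \<le> f x" "0 \<le> m" "m \<le> 1" "card F \<le> n"
  shows "m ^ n \<le> prod f F"
proof -
  have "m ^ n \<le> m ^ card F" using assms by (intro power_decreasing) auto
  also have "\<dots> = (\<Prod>x\<in>F. m)" by simp
  also have "\<dots> \<le> prod f F" using assms by (intro prod_mono) auto
  finally show ?thesis .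
qed

text \<open>The gate gets a label in the lower half of \<open>[0, t]\<close>, the other edges get
  labels in the upper half. Then all labels are at most \<open>t\<close> and the gate does not
  close; each of the at most 60 constraints has probability \<open>t / 2\<close>.\<close>

lemma config_weight_all_open:
  assumes "0 \<le> t" "t \<le> 1"
  shows "(t / 2) ^ 60 \<le> config_weight t b (\<lambda>e. e \<in> block_edges b)"
proof -
  let ?g = "g_edge (fst b) (snd b)"
  define X where "X e = (if e = ?g then {0..t / 2} else {t / 2<..t})" for e
  have "(t / 2) ^ 60 \<le> (\<Prod>e\<in>block_edges b. measure lborel (X e))"
    using assms by (intro finite_product_mult_lower finite_block_edges card_block_edges) (auto simp: X_def)
  also have "\<dots> = prob_unif (\<lambda>U. \<forall>e\<in>block_edges b. U e \<in> X e)"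
    using assms by (intro prob_edges[symmetric] finite_block_edges) (auto simp: X_def block_edges_def)
  also have "\<dots> \<le> config_weight t b (\<lambda>e. e \<in> block_edges b)"
    unfolding config_weight_def
  proof (intro U.finite_measure_mono subsetI sets_block_config[where P = "\<lambda>c. c = _"])
    fix U assume "U \<in> {U \<in> space unif_space. \<forall>e\<in>block_edges b. U e \<in> X e}"
    then have U: "U \<in> space unif_space" and X: "\<And>e. e \<in> block_edges b \<Longrightarrow> U e \<in> X e" by auto
    have g: "?g \<in> block_edges b" using g_edge_block[of "fst b" "snd b"] by simp
    have "block_config t U b = (\<lambda>e. e \<in> block_edges b \<and> U e \<le> t)"
      using X[OF g] X by (intro block_config_gate_open) (force simp: X_def split: if_splits)
    also have "\<dots> = (\<lambda>e. e \<in> block_edges b)"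
      using X assms by (force simp: X_def fun_eq_iff split: if_splits)
    finally show "U \<in> {U \<in> space unif_space. block_config t U b = (\<lambda>e. e \<in> block_edges b)}"
      using U by simp
  qed
  finally show ?thesis .
qed

text \<open>The state of the block differs between \<open>t\<close> and \<open>t + h\<close> only if
  one of its at most 60 labels lies in \<open>{t<..t + h}\<close>, whence a union bound.\<close>

lemma config_weight_close:
  assumes "0 \<le> t" "0 \<le> h" "t + h \<le> 1"
  shows "\<bar>config_weight (t + h) b a - config_weight t b a\<bar> \<le> 60 * h"
proof -
  define A where "A s = {U \<in> space unif_space. block_config s U b = a}" for s
  define D where "D = (\<Union>e\<in>block_edges b. {U \<in> space unif_space. t < U e \<and> U e \<le> t + h})"
  have setsA: "A s \<in> sets unif_space" for s
    unfolding A_def by (rule sets_block_config[where P = "\<lambda>c. c = a"])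
  have setsD: "{U \<in> space unif_space. t < U e \<and> U e \<le> t + h} \<in> sets unif_space" if "e \<in> block_edges b" for e
  proof -
    have [measurable]: "(\<lambda>U. U e) \<in> borel_measurable unif_space"
      using that by (intro measurable_edge_label) (auto simp: block_edges_def)
    show ?thesis by measurable
  qed
  have D: "D \<in> sets unif_space" unfolding D_def by (intro sets.finite_UN finite_block_edges setsD)
  have "measure unif_space D \<le> (\<Sum>e\<in>block_edges b. prob_unif (\<lambda>U. t < U e \<and> U e \<le> t + h))"
    unfolding D_def by (rule U.finite_measure_subadditive_finite) (use finite_block_edges setsD in auto)
  also have "\<dots> = (\<Sum>e\<in>block_edges b. h)"
  proof (rule sum.cong[OF refl])
    fix e assume "e \<in> block_edges b"
    then show "prob_unif (\<lambda>U. t < U e \<and> U e \<le> t + h) = h"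
      using prob_edge_interval[of e t "t + h"] assms by (simp add: block_edges_def)
  qed
  also have "\<dots> \<le> 60 * h" using card_block_edges[of b] assms by (simp add: mult_right_mono)
  finally have mD: "measure unif_space D \<le> 60 * h" .
  have same: "block_config (t + h) U b = block_config t U b" if "U \<in> space unif_space" "U \<notin> D" for U
    using that assms by (force simp: block_config_def D_def fun_eq_iff)
  have "measure unif_space (A s) \<le> measure unif_space (A s' \<union> D)" if "A s \<subseteq> A s' \<union> D" for s s'
    using that setsA D by (intro U.finite_measure_mono) auto
  moreover have "measure unif_space (A s \<union> D) \<le> measure unif_space (A s) + measure unif_space D" for s
    using setsA D by (intro measure_Un_le) auto
  moreover have "A t \<subseteq> A (t + h) \<union> D" "A (t + h) \<subseteq> A t \<union> D"
    using same by (auto simp: A_def)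
  ultimately have "measure unif_space (A t) \<le> measure unif_space (A (t + h)) + 60 * h"
    "measure unif_space (A (t + h)) \<le> measure unif_space (A t) + 60 * h"
    using mD by (meson add_left_mono order_trans)+
  then show ?thesis unfolding config_weight_def A_def by simp
qed

lemma config_weight_mono:
  assumes "0 \<le> h" and F_mono: "\<And>a a'. a \<le> a' \<Longrightarrow> F a \<Longrightarrow> F a'"
  shows "0 \<le> (\<Sum>a\<in>configs b. (config_weight (t + h) b a - config_weight t b a) * of_bool (F a))"
proof -
  have "prob_unif (\<lambda>U. F (block_config t U b)) \<le> prob_unif (\<lambda>U. F (block_config (t + h) U b))"
    using F_mono[OF block_config_mono[of t "t + h" _ b]] assms(1)
    by (intro U.finite_measure_mono sets_block_config) auto
  then show ?thesis
    unfolding sum_config_weight[symmetric] by (simp add: left_diff_distrib sum_subtractf)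
qed

text \<open>As long as \<open>g\<close> carries the smallest label of its block, the gate does not close. Hence, opening
  \<open>g\<close> first and then the other edges one by one, each step of this chain has positive density,
  and an increasing event that is not constant on the block is crossed by one of the steps.\<close>

lemma config_weight_increment:
  assumes t: "0 < lo" "lo \<le> t" "0 < h" "t + h \<le> hi" "hi < 1"
    and F_mono: "\<And>a a'. a \<le> a' \<Longrightarrow> F a \<Longrightarrow> F a'"
    and F: "\<not> F (\<lambda>_. False)" "F (\<lambda>e. e \<in> block_edges b)"
  shows "min (lo / 2) (1 - hi) ^ 60 * h
    \<le> (\<Sum>a\<in>configs b. (config_weight (t + h) b a - config_weight t b a) * of_bool (F a))"
proof -
  \<comment> \<open>A common lower bound for the lengths of \<open>{0..t / 2}\<close>,
    \<open>{t / 2<..t}\<close> and \<open>{t + h<..1}\<close>, the intervals for all labels but the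
    one that crosses.\<close>
  define m where "m = min (lo / 2) (1 - hi)"
  have "m \<le> lo / 2" "m \<le> 1 - hi" unfolding m_def by (rule min.cobounded1, rule min.cobounded2)
  moreover have "0 < m" using t by (simp add: m_def)
  ultimately have m: "0 < m" "m \<le> 1" "m \<le> t / 2" "m \<le> 1 - (t + h)" using t by linarith+
  let ?g = "g_edge (fst b) (snd b)" and ?E = "block_edges b"
  have g: "?g \<in> ?E" using g_edge_block[of "fst b" "snd b"] by simp
  obtain es where es: "set es = ?E - {?g}" "distinct es"
    using finite_distinct_list[of "?E - {?g}"] finite_block_edges by auto
  define gs where "gs = ?g # es"
  have gs: "set gs = ?E" "distinct gs" using es g by (auto simp: gs_def)
  define c where "c j e \<longleftrightarrow> e \<in> set (take j gs)" for j e
  have c0: "c 0 = (\<lambda>_. False)" by (simp add: c_def fun_eq_iff)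
  have cl: "c (length gs) = (\<lambda>e. e \<in> ?E)" by (simp add: c_def fun_eq_iff gs)
  \<comment> \<open>The step of the chain at which \<open>F\<close> becomes true: \<open>c j\<close>
    consists of the first \<open>j\<close> edges of \<open>gs\<close>, a list that begins with the
    gate.\<close>
  obtain j where j: "j < length gs" "\<not> F (c j)" "F (c (Suc j))"
  proof -
    define k where "k = (LEAST k. F (c k))"
    have Fl: "F (c (length gs))" unfolding cl by (rule F)
    then have k: "F (c k)" "k \<le> length gs" unfolding k_def by (rule LeastI, rule Least_le)
    have "k \<noteq> 0" using F(1) k(1) c0 by (cases "k = 0") simp_all
    then obtain i where i: "k = Suc i" by (cases k) simp_all
    have "\<not> F (c i)" using not_less_Least[of i "\<lambda>k. F (c k)"] i by (simp add: k_def)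
    then show thesis using k unfolding i by (intro that[of i]) simp_all
  qed
  \<comment> \<open>Labels for which the block is in state \<open>c j\<close> at \<open>t\<close>
    and \<open>c (Suc j)\<close> at \<open>t + h\<close>: the edge \<open>gs ! j\<close> crosses,
    the earlier ones are open, the later ones stay closed. The split at \<open>t / 2\<close> puts
    the gate below all other edges once it is open.\<close>
  define X where "X e = (if e = gs ! j then {t<..t + h} else if c j e then
      (if e = ?g then {0..t / 2} else {t / 2<..t}) else {t + h<..1})" for e
  have cSuc: "c (Suc j) e \<longleftrightarrow> c j e \<or> e = gs ! j" for e
    using j(1) by (auto simp: c_def take_Suc_conv_app_nth)
  have cj: "\<not> c j (gs ! j)"
    using gs(2) j(1) by (auto simp: c_def in_set_conv_nth nth_eq_iff_index_eq)
  have subE: "c j e \<Longrightarrow> e \<in> ?E" for e using gs(1) set_take_subset[of j gs] by (auto simp: c_def)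
  have jE: "gs ! j \<in> ?E" using gs(1) j(1) nth_mem by blast
  have gfirst: "?g = gs ! j \<longleftrightarrow> j = 0" "c j ?g \<longleftrightarrow> j \<noteq> 0"
  proof -
    show "?g = gs ! j \<longleftrightarrow> j = 0"
    proof (cases j)
      case 0
      then show ?thesis by (simp add: gs_def)
    next
      case (Suc i)
      then have "gs ! j \<in> set es" using j(1) by (simp add: gs_def)
      then have "gs ! j \<noteq> ?g" using es(1) by blast
      then show ?thesis using Suc by auto
    qed
    show "c j ?g \<longleftrightarrow> j \<noteq> 0"
    proof (cases j)
      case 0
      then show ?thesis by (simp add: c_def)
    next
      case (Suc i)
      then show ?thesis by (simp add: c_def gs_def)
    qed
  qed
  define V where "V = {U \<in> space unif_space. \<forall>e\<in>?E. U e \<in> X e}"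
  have V: "block_config t U b = c j \<and> block_config (t + h) U b = c (Suc j)" if "U \<in> V" for U
  proof -
    have X: "\<And>e. e \<in> ?E \<Longrightarrow> U e \<in> X e" using that by (simp add: V_def)
    have next_label: "t < U (gs ! j)" "U (gs ! j) \<le> t + h" using X[OF jE] by (simp_all add: X_def)
    have open_label: "U e \<le> t" if "c j e" for e
    proof -
      have "e \<noteq> gs ! j" using that cj by blast
      then show ?thesis using X[OF subE[OF that]] that t by (simp add: X_def split: if_splits)
    qed
    have closed_label: "t + h < U e" if "e \<in> ?E" "e \<noteq> gs ! j" "\<not> c j e" for e
      using X[OF that(1)] that(2,3) by (simp add: X_def)
    have "U ?g < U e" if e: "e \<in> ?E" "e \<noteq> ?g" for e
    proof (cases "j = 0")
      case True
      then have "?g = gs ! j" "\<not> c j e" using gfirst(1) by (simp, simp add: c_def)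
      then show ?thesis using closed_label[OF e(1)] next_label e(2) by simp
    next
      case False
      then have g': "c j ?g" "?g \<noteq> gs ! j" using gfirst by blast+
      then have "U ?g \<le> t / 2" using X[OF g] by (simp add: X_def)
      moreover have "t / 2 < U e"
      proof (cases "c j e")
        case True
        then have "e \<noteq> gs ! j" using cj by blast
        then show ?thesis using X[OF e(1)] True e(2) by (simp add: X_def)
      next
        case False
        then show ?thesis using closed_label[OF e(1) _ False] next_label t by (cases "e = gs ! j") auto
      qed
      ultimately show ?thesis by simp
    qed
    then have "block_config s U b = (\<lambda>e. e \<in> ?E \<and> U e \<le> s)" for s by (rule block_config_gate_open)
    moreover have "(e \<in> ?E \<and> U e \<le> t) = c j e" for e
    proof (cases "c j e")
      case True
      then show ?thesis using subE open_label by blast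
    next
      case False
      then show ?thesis using closed_label[of e] next_label t by (cases "e = gs ! j") auto
    qed
    moreover have "(e \<in> ?E \<and> U e \<le> t + h) = c (Suc j) e" for e
    proof (cases "c (Suc j) e")
      case True
      then have "e = gs ! j \<or> c j e" using cSuc by blast
      then show ?thesis
      proof
        assume "e = gs ! j"
        then show ?thesis using True jE next_label by simp
      next
        assume "c j e"
        then show ?thesis using True subE[of e] open_label[of e] t by simp
      qed
    next
      case False
      then have "e \<noteq> gs ! j" "\<not> c j e" using cSuc by blast+
      then show ?thesis using closed_label[of e] False by auto
    qed
    ultimately show ?thesis by (simp add: fun_eq_iff)
  qed
  \<comment> \<open>The crossing label contributes the factor \<open>h\<close>, each of the others
    at least \<open>m\<close>.\<close>
  have prodV: "m ^ 60 * h \<le> measure unif_space V"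
  proof -
    have X_cases: "X e \<in> {{t<..t + h}, {0..t / 2}, {t / 2<..t}, {t + h<..1}}" for e
      unfolding X_def by simp
    have "measure unif_space V = (\<Prod>e\<in>?E. measure lborel (X e))" unfolding V_def
    proof (rule prob_edges[OF finite_block_edges])
      show "?E \<subseteq> edges" by (auto simp: block_edges_def)
      show "X e \<in> sets borel" for e using X_cases[of e] by auto
      have "0 < t" "t + h \<le> 1" using t by linarith+
      then have "Z \<subseteq> {0..1}" if "Z \<in> {{t<..t + h}, {0..t / 2}, {t / 2<..t}, {t + h<..1}}" for Z
        using that t(3) by (elim insertE emptyE) (simp_all add: subset_iff)
      then show "X e \<subseteq> {0..1}" for e using X_cases by blast
    qed
    moreover have "(\<Prod>e\<in>?E. measure lborel (X e))
        = measure lborel (X (gs ! j)) * (\<Prod>e\<in>?E - {gs ! j}. measure lborel (X e))"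
      by (rule prod.remove[OF finite_block_edges jE])
    moreover have "measure lborel (X (gs ! j)) = h" unfolding X_def using t(3) by simp
    ultimately have eq: "measure unif_space V = h * (\<Prod>e\<in>?E - {gs ! j}. measure lborel (X e))"
      by simp
    have "m ^ 60 \<le> (\<Prod>e\<in>?E - {gs ! j}. measure lborel (X e))"
    proof (rule finite_product_mult_lower)
      show "card (?E - {gs ! j}) \<le> 60"
        using card_Diff1_le[of ?E "gs ! j"] card_block_edges[of b] by linarith
      fix e assume "e \<in> ?E - {gs ! j}"
      then have "e \<noteq> gs ! j" by blast
      then have "X e \<in> {{0..t / 2}, {t / 2<..t}, {t + h<..1}}" unfolding X_def by simp
      then consider "X e = {0..t / 2}" | "X e = {t / 2<..t}" | "X e = {t + h<..1}" by blast
      then show "m \<le> measure lborel (X e)"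
      proof cases
        case 1
        have "0 \<le> t / 2" using t by simp
        then show ?thesis unfolding 1 using m by simp
      next
        case 2
        have "t / 2 \<le> t" using t by simp
        then show ?thesis unfolding 2 using m by simp
      next
        case 3
        have "t + h \<le> 1" using t by simp
        then show ?thesis unfolding 3 using m by simp
      qed
    qed (use m(1,2) finite_block_edges in simp_all)
    then show ?thesis unfolding eq using t(3) by (simp add: mult.commute)
  qed
  define B where "B s = {U \<in> space unif_space. F (block_config s U b)}" for s
  have setsB: "B s \<in> sets unif_space" for s unfolding B_def by (rule sets_block_config)
  have sub: "B t \<subseteq> B (t + h)"
    using F_mono[OF block_config_mono[of t "t + h" _ b]] t by (auto simp: B_def)
  have "V \<subseteq> B (t + h) - B t" using V j by (auto simp: B_def V_def)
  then have "measure unif_space V \<le> measure unif_space (B (t + h) - B t)"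
    using setsB by (intro U.finite_measure_mono) auto
  also have "\<dots> = measure unif_space (B (t + h)) - measure unif_space (B t)"
    by (rule U.finite_measure_Diff[OF setsB setsB sub])
  also have "\<dots> = (\<Sum>a\<in>configs b. (config_weight (t + h) b a - config_weight t b a) * of_bool (F a))"
    unfolding B_def sum_config_weight[symmetric] by (simp add: left_diff_distrib sum_subtractf)
  finally show ?thesis using prodV by (simp add: m_def)
qed

text \<open>If the labels of the four edges at the origin all exceed \<open>t\<close>, the origin is
  isolated.\<close>

lemma theta_tilde_less_1:
  assumes "0 \<le> t" "t \<le> 1" "1 \<le> n"
  shows "theta_tilde n t \<le> 1 - (1 - t) ^ 4"
proof -
  define F :: "edge set" where "F = (\<lambda>v. {(0, 0), v}) ` {(1, 0), (-1, 0), (0, 1), (0, -1)}"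
  have F: "finite F" "F \<subseteq> edges" by (auto simp: F_def edge_iff)
  have card: "card F \<le> 4" unfolding F_def by (rule order_trans[OF card_image_le]) auto
  define V where "V = {U \<in> space unif_space. \<forall>e\<in>F. U e \<in> {t<..1}}"
  define R where "R = {U \<in> space unif_space. reaches_distance (0, 0) n (omega_tilde t U)}"
  have "(1 - t) ^ 4 \<le> (\<Prod>e\<in>F. measure lborel {t<..1})"
    using assms F card by (intro finite_product_mult_lower) auto
  also have "\<dots> = measure unif_space V" unfolding V_def
    using assms F by (intro prob_edges[symmetric]) auto
  also have "\<dots> \<le> measure unif_space (space unif_space - R)"
  proof (intro U.finite_measure_mono subsetI)
    fix U assume U: "U \<in> V"
    have "\<not> reaches_distance (0, 0) n (omega_tilde t U)"
    proof
      assume "reaches_distance (0, 0) n (omega_tilde t U)"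
      then obtain w where w: "sup_norm (w - (0, 0)) = int n" "((0, 0), w) \<in> (open_adj (omega_tilde t U))\<^sup>*"
        by (auto simp: reaches_distance_def)
      have "w \<noteq> (0, 0)" using w(1) assms(3) by (auto simp: sup_norm_def)
      with w(2) obtain v where v: "((0, 0), v) \<in> open_adj (omega_tilde t U)"
        by (auto elim: converse_rtranclE)
      obtain x y where xy: "v = (x, y)" by (cases v)
      have e: "{(0, 0), v} \<in> edges" "U {(0, 0), v} \<le> t"
        using v by (auto simp: open_adj_def omega_tilde_def)
      then have "v \<in> {(1, 0), (-1, 0), (0, 1), (0, -1)}" unfolding xy edge_iff by auto
      then have "{(0, 0), v} \<in> F" by (auto simp: F_def)
      then show False using U e(2) by (force simp: V_def)
    qed
    then show "U \<in> space unif_space - R" using U by (simp add: V_def R_def)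
  qed (use sets_omega_reaches in \<open>auto simp: R_def\<close>)
  also have "\<dots> = 1 - measure unif_space R"
    by (rule U.prob_compl) (auto simp: R_def sets_omega_reaches)
  finally show ?thesis by (simp add: theta_tilde_eq reach_prob_def R_def)
qed

section \<open>Translation invariance, self-avoiding walks and the infinite cluster\<close>

definition translate_edge :: "vertex \<Rightarrow> edge \<Rightarrow> edge" where
  "translate_edge \<tau> e = (\<lambda>v. v + \<tau>) ` e"

lemma translate_edge_pair [simp]: "translate_edge \<tau> {u, v} = {u + \<tau>, v + \<tau>}"
  by (simp add: translate_edge_def)

lemma edge_iff_coords: "{u, v} \<in> edges \<longleftrightarrow> \<bar>fst u - fst v\<bar> + \<bar>snd u - snd v\<bar> = 1"
  using edge_iff[of "fst u" "snd u" "fst v" "snd v"] by simp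

lemma translate_pair_edges: "{u + \<tau>, v + \<tau>} \<in> edges \<longleftrightarrow> {u, v} \<in> edges" for u v \<tau> :: vertex
  by (simp add: edge_iff_coords)

lemma translate_edge_inverse: "translate_edge \<tau> (translate_edge (- \<tau>) e) = e"
  "translate_edge (- \<tau>) (translate_edge \<tau> e) = e"
  by (auto simp: translate_edge_def image_image)

lemma inj_translate_edge: "inj (translate_edge \<tau>)"
  by (metis injI translate_edge_inverse(2))

lemma translate_edge_edges: "e \<in> edges \<Longrightarrow> translate_edge \<tau> e \<in> edges"
  by (elim edgeE) (simp_all only: translate_edge_pair translate_pair_edges, simp_all add: edge_iff)

lemma edges_in_translate: "edges_in ((\<lambda>v. v + \<tau>) ` \<Gamma>) = translate_edge \<tau> ` edges_in \<Gamma>"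
proof (intro set_eqI iffI)
  fix e assume e: "e \<in> edges_in ((\<lambda>v. v + \<tau>) ` \<Gamma>)"
  then have "translate_edge (- \<tau>) e \<in> edges" by (intro translate_edge_edges) (auto simp: edges_in_def)
  moreover have "translate_edge (- \<tau>) e \<subseteq> \<Gamma>" using e by (auto simp: edges_in_def translate_edge_def)
  ultimately show "e \<in> translate_edge \<tau> ` edges_in \<Gamma>"
    by (intro image_eqI[of _ _ "translate_edge (- \<tau>) e"]) (auto simp: edges_in_def translate_edge_inverse)
next
  fix e assume "e \<in> translate_edge \<tau> ` edges_in \<Gamma>"
  then show "e \<in> edges_in ((\<lambda>v. v + \<tau>) ` \<Gamma>)"
    by (auto simp: edges_in_def translate_edge_edges) (auto simp: translate_edge_def)
qed

lemma bdry_translate: "bdry ((\<lambda>v. v + \<tau>) ` \<Gamma>) = (\<lambda>v. v + \<tau>) ` bdry \<Gamma>"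
proof (intro set_eqI iffI)
  fix x assume "x \<in> bdry ((\<lambda>v. v + \<tau>) ` \<Gamma>)"
  then obtain v y where v: "v \<in> \<Gamma>" "x = v + \<tau>" and y: "y \<notin> (\<lambda>v. v + \<tau>) ` \<Gamma>" "{x, y} \<in> edges"
    by (auto simp: bdry_def)
  have "y - \<tau> \<notin> \<Gamma>" using y(1) by (metis diff_add_cancel imageI)
  moreover have "{v, y - \<tau>} \<in> edges" using y(2) translate_pair_edges[of v \<tau> "y - \<tau>"] v(2) by simp
  ultimately have "v \<in> bdry \<Gamma>" using v(1) unfolding bdry_def by blast
  then show "x \<in> (\<lambda>v. v + \<tau>) ` bdry \<Gamma>" using v(2) by blast
next
  fix x assume "x \<in> (\<lambda>v. v + \<tau>) ` bdry \<Gamma>"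
  then obtain v y where v: "v \<in> \<Gamma>" "x = v + \<tau>" and y: "y \<notin> \<Gamma>" "{v, y} \<in> edges"
    by (auto simp: bdry_def)
  have "y + \<tau> \<notin> (\<lambda>v. v + \<tau>) ` \<Gamma>" "{x, y + \<tau>} \<in> edges" "x \<in> (\<lambda>v. v + \<tau>) ` \<Gamma>"
    using v y translate_pair_edges[of v \<tau> y] by auto
  then show "x \<in> bdry ((\<lambda>v. v + \<tau>) ` \<Gamma>)" unfolding bdry_def by blast
qed

definition block_shift :: "int \<Rightarrow> int \<Rightarrow> vertex" where
  "block_shift r s = (6 * r, 5 * s)"

lemma Lam_translate:
  "Lam (r' + r) (s' + s) = (\<lambda>v. v + block_shift r s) ` Lam r' s'"
  "Lam_bar (r' + r) (s' + s) = (\<lambda>v. v + block_shift r s) ` Lam_bar r' s'"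
  unfolding Lam_def Lam_bar_def image_image block_shift_def
  by (auto simp: case_prod_beta algebra_simps intro!: image_cong)

lemma g_edge_translate: "g_edge (r' + r) (s' + s) = translate_edge (block_shift r s) (g_edge r' s')"
  by (simp add: g_edge_def block_shift_def algebra_simps)

lemma A_edges_translate: "A_edges (r' + r) (s' + s) = translate_edge (block_shift r s) ` A_edges r' s'"
proof -
  let ?\<tau> = "block_shift r s"
  have "card (translate_edge ?\<tau> e \<inter> (\<lambda>v. v + ?\<tau>) ` B) = card (e \<inter> B)" for e B
  proof -
    have "translate_edge ?\<tau> e \<inter> (\<lambda>v. v + ?\<tau>) ` B = (\<lambda>v. v + ?\<tau>) ` (e \<inter> B)"
      by (auto simp: translate_edge_def)
    then show ?thesis by (simp add: card_image)
  qed
  then show ?thesis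
    unfolding A_edges_def Lam_translate edges_in_translate bdry_translate by auto
qed

lemma reaches_distance_translate:
  assumes "\<And>e. e \<in> edges \<Longrightarrow> \<omega>' e = \<omega> (translate_edge \<tau> e)"
  shows "reaches_distance v m \<omega>' \<longleftrightarrow> reaches_distance (v + \<tau>) m \<omega>"
proof -
  have imp: "reaches_distance (v + \<tau>) m \<omega>"
    if eq: "\<And>e. e \<in> edges \<Longrightarrow> \<omega>' e = \<omega> (translate_edge \<tau> e)" and r: "reaches_distance v m \<omega>'"
    for v \<tau> and \<omega> \<omega>' :: "edge \<Rightarrow> bool"
  proof -
    obtain w where w: "sup_norm (w - v) = int m" "(v, w) \<in> (open_adj \<omega>')\<^sup>*"
      using r by (auto simp: reaches_distance_def)
    from w(2) have "(v + \<tau>, w + \<tau>) \<in> (open_adj \<omega>)\<^sup>*"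
    proof (induction rule: rtrancl_induct)
      case (step y z)
      have "(y + \<tau>, z + \<tau>) \<in> open_adj \<omega>"
        using step.hyps(2) eq[of "{y, z}"] by (simp add: open_adj_def translate_pair_edges)
      with step.IH show ?case by (rule rtrancl_into_rtrancl)
    qed simp
    then show ?thesis using w(1) unfolding reaches_distance_def by (intro exI[of _ "w + \<tau>"]) simp
  qed
  show ?thesis
  proof
    show "reaches_distance v m \<omega>' \<Longrightarrow> reaches_distance (v + \<tau>) m \<omega>"
      by (rule imp[where \<omega>' = \<omega>']) (use assms in auto)
    assume "reaches_distance (v + \<tau>) m \<omega>"
    moreover have "\<omega> e = \<omega>' (translate_edge (- \<tau>) e)" if "e \<in> edges" for e
      using assms[OF translate_edge_edges[OF that, of "- \<tau>"]] by (simp add: translate_edge_inverse)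
    ultimately have "reaches_distance (v + \<tau> + - \<tau>) m \<omega>'" by (rule imp[where \<omega>' = \<omega>, rotated])
    then show "reaches_distance v m \<omega>'" by simp
  qed
qed

text \<open>Relabelling the edges by a shift preserves the product law, and shifts by
  \<open>(6 r, 5 s)\<close> carry the gates and the events \<open>C_event\<close> to one
  another.\<close>

lemma reach_prob_translate: "reach_prob (v + block_shift r s) m t = reach_prob v m t"
proof -
  let ?\<tau> = "block_shift r s"
  define T :: "(edge \<Rightarrow> real) \<Rightarrow> edge \<Rightarrow> real" where "T U = (\<lambda>e\<in>edges. U (translate_edge ?\<tau> e))" for U
  have T: "distr unif_space unif_space T = unif_space"
    unfolding unif_space_def T_def
    by (rule distr_PiM_reindex[where f = "translate_edge ?\<tau>" and M = "\<lambda>_. unit_uniform"])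
       (auto intro: prob_space_unit_uniform inj_on_subset[OF inj_translate_edge] translate_edge_edges)
  have T_meas: "T \<in> measurable unif_space unif_space"
    unfolding unif_space_def T_def
    by (intro measurable_restrict measurable_component_singleton translate_edge_edges)
  have C: "T U \<in> C_event r' s' \<longleftrightarrow> U \<in> C_event (r' + r) (s' + s)" if U: "U \<in> space unif_space" for U r' s'
  proof -
    have im: "U ` translate_edge ?\<tau> ` E = T U ` E" if "E \<subseteq> edges" for E
      using that unfolding image_image T_def by (intro image_cong) auto
    have "A_edges r' s' \<subseteq> edges" "edges_in (Lam r' s') - A_edges r' s' \<subseteq> edges"
      by (auto simp: A_edges_def edges_in_def)
    then show ?thesis
      using U measurable_space[OF T_meas U]
      unfolding C_event_def A_edges_translate Lam_translate edges_in_translate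
        image_set_diff[OF inj_translate_edge, symmetric]
      by (simp add: im)
  qed
  have omega: "omega_tilde t (T U) e = omega_tilde t U (translate_edge ?\<tau> e)"
    if U: "U \<in> space unif_space" and e: "e \<in> edges" for U e
  proof -
    have "(\<forall>r' s'. e = g_edge r' s' \<longrightarrow> T U \<notin> C_event r' s')
      \<longleftrightarrow> (\<forall>r' s'. translate_edge ?\<tau> e = g_edge r' s' \<longrightarrow> U \<notin> C_event r' s')" (is "?L \<longleftrightarrow> ?R")
    proof
      assume L: ?L
      show ?R
      proof (intro allI impI)
        fix r' s' assume "translate_edge ?\<tau> e = g_edge r' s'"
        also have "g_edge r' s' = translate_edge ?\<tau> (g_edge (r' - r) (s' - s))"
          using g_edge_translate[of "r' - r" r "s' - s" s] by simp
        finally have "e = g_edge (r' - r) (s' - s)" by (rule injD[OF inj_translate_edge])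
        then show "U \<notin> C_event r' s'" using L C[OF U, of "r' - r" "s' - s"] by simp
      qed
    next
      assume ?R
      then show ?L by (auto simp: C[OF U] g_edge_translate)
    qed
    then show ?thesis using e by (simp add: omega_tilde_def T_def translate_edge_edges)
  qed
  have "reach_prob v m t = measure (distr unif_space unif_space T) {U \<in> space unif_space. reaches_distance v m (omega_tilde t U)}"
    unfolding T reach_prob_def ..
  also have "\<dots> = measure unif_space (T -` {U \<in> space unif_space. reaches_distance v m (omega_tilde t U)} \<inter> space unif_space)"
    by (rule measure_distr[OF T_meas sets_omega_reaches])
  also have "T -` {U \<in> space unif_space. reaches_distance v m (omega_tilde t U)} \<inter> space unif_space
      = {U \<in> space unif_space. reaches_distance (v + ?\<tau>) m (omega_tilde t U)}"
  proof -
    have "reaches_distance v m (omega_tilde t (T U)) \<longleftrightarrow> reaches_distance (v + ?\<tau>) m (omega_tilde t U)"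
      if "U \<in> space unif_space" for U
      by (rule reaches_distance_translate) (rule omega[OF that])
    then show ?thesis using measurable_space[OF T_meas] by auto
  qed
  finally show ?thesis by (simp add: reach_prob_def)
qed

section \<open>Counting self-avoiding walks\<close>

definition steps :: "vertex set" where
  "steps = {(1, 0), (-1, 0), (0, 1), (0, -1)}"

definition walk :: "vertex list \<Rightarrow> nat \<Rightarrow> vertex" where
  "walk ds i = sum_list (take i ds)"

definition walk_edges :: "vertex list \<Rightarrow> edge set" where
  "walk_edges ds = (\<lambda>i. {walk ds i, walk ds (Suc i)}) ` {..<length ds}"

lemma card_walk_edges:
  assumes "inj_on (walk ds) {..length ds}"
  shows "card (walk_edges ds) = length ds"
proof -
  have "inj_on (\<lambda>i. {walk ds i, walk ds (Suc i)}) {..<length ds}"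
  proof (rule inj_onI)
    fix i j assume ij: "i \<in> {..<length ds}" "j \<in> {..<length ds}"
      and eq: "{walk ds i, walk ds (Suc i)} = {walk ds j, walk ds (Suc j)}"
    have inj: "walk ds k = walk ds l \<Longrightarrow> k = l" if "k \<le> length ds" "l \<le> length ds" for k l
      using assms that by (auto dest: inj_onD)
    from eq consider "walk ds i = walk ds j" | "walk ds i = walk ds (Suc j)" "walk ds (Suc i) = walk ds j"
      by (auto simp: doubleton_eq_iff)
    then show "i = j"
    proof cases
      case 1
      then show ?thesis using ij by (intro inj) auto
    next
      case 2
      then have "i = Suc j" "Suc i = j" using ij by (auto intro: inj)
      then show ?thesis by simp
    qed
  qed
  then show ?thesis by (simp add: walk_edges_def card_image)
qed

text \<open>A shortest open path to a vertex of norm \<open>n\<close> repeats no vertex, since a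
  loop could be cut out. The norm grows by at most one per step, so the path has at least
  \<open>n\<close> steps, of which the first \<open>n\<close> are kept.\<close>

lemma open_walk_exists:
  assumes "reaches_distance (0, 0) n \<omega>"
  shows "\<exists>ds. set ds \<subseteq> steps \<and> length ds = n \<and> inj_on (walk ds) {..n} \<and>
    (\<forall>e\<in>walk_edges ds. e \<in> edges \<and> \<omega> e)"
proof -
  let ?R = "open_adj \<omega>"
  obtain w where w: "sup_norm w = int n" "(0, w) \<in> ?R\<^sup>*"
    using assms by (auto simp: reaches_distance_def zero_prod_def[symmetric])
  define m where "m = (LEAST m. (0, w) \<in> ?R ^^ m)"
  have "\<exists>m. (0, w) \<in> ?R ^^ m" using w(2) by (simp add: rtrancl_power)
  then have m: "(0, w) \<in> ?R ^^ m" unfolding m_def by (rule LeastI_ex)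
  have least: "m \<le> k" if "(0, w) \<in> ?R ^^ k" for k unfolding m_def using that by (rule Least_le)
  obtain p where p: "p 0 = 0" "p m = w" "\<And>i. i < m \<Longrightarrow> (p i, p (Suc i)) \<in> ?R"
    using m by (auto simp: relpow_fun_conv)
  have part: "(p i, p j) \<in> ?R ^^ (j - i)" if "i \<le> j" "j \<le> m" for i j
    unfolding relpow_fun_conv using that by (intro exI[of _ "\<lambda>k. p (i + k)"]) (auto intro: p(3))
  have norm: "i \<le> m \<Longrightarrow> sup_norm (p i) \<le> int i" for i
  proof (induction i)
    case (Suc i)
    have "\<bar>sup_norm (p i) - sup_norm (p (Suc i))\<bar> \<le> 1"
      using sup_norm_edge[of "p i" "p (Suc i)" 0] p(3)[of i] Suc.prems by (simp add: open_adj_def)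
    with Suc show ?case by simp
  qed (simp add: p)
  have nm: "n \<le> m" using norm[of m] w(1) p(2) by simp
  have inj: "inj_on p {..m}"
  proof (rule linorder_inj_onI)
    fix i j assume ij: "i < j" "i \<in> {..m}" "j \<in> {..m}"
    show "p i \<noteq> p j"
    proof
      assume eq: "p i = p j"
      have "(0, p i) \<in> ?R ^^ i" using part[of 0 i] ij p(1) by simp
      moreover have "(p i, w) \<in> ?R ^^ (m - j)" using part[of j m] ij p(2) eq by simp
      ultimately have "(0, w) \<in> ?R ^^ (i + (m - j))" by (auto simp: relpow_add)
      then have "m \<le> i + (m - j)" by (rule least)
      then show False using ij by simp
    qed
  qed auto
  define ds where "ds = map (\<lambda>i. p (Suc i) - p i) [0..<n]"
  have walk: "walk ds i = p i" if "i \<le> n" for i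
  proof -
    have "take i ds = map (\<lambda>i. p (Suc i) - p i) [0..<i]"
      using that by (simp add: ds_def take_map)
    moreover have "sum_list (map (\<lambda>i. p (Suc i) - p i) [0..<i]) = p i - p 0"
      by (induction i) (simp_all add: algebra_simps)
    ultimately show ?thesis by (simp add: walk_def p(1))
  qed
  have len: "length ds = n" by (simp add: ds_def)
  show ?thesis
  proof (intro exI[of _ ds] conjI)
    show "set ds \<subseteq> steps"
    proof
      fix d assume "d \<in> set ds"
      then obtain i where i: "i < n" "d = p (Suc i) - p i" by (auto simp: ds_def)
      then have "{p i, p (Suc i)} \<in> edges" using p(3)[of i] nm by (auto simp: open_adj_def)
      then have "\<bar>fst (p i) - fst (p (Suc i))\<bar> + \<bar>snd (p i) - snd (p (Suc i))\<bar> = 1"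
        by (simp add: edge_iff_coords)
      then have d: "\<bar>fst d\<bar> + \<bar>snd d\<bar> = 1" by (simp add: i(2) abs_minus_commute)
      obtain x y where "d = (x, y)" by (cases d)
      with d show "d \<in> steps" unfolding steps_def by auto
    qed
    have "inj_on p {..n}" using inj nm by (rule_tac inj_on_subset) auto
    then show "inj_on (walk ds) {..n}" by (simp add: inj_on_def walk)
    show "\<forall>e\<in>walk_edges ds. e \<in> edges \<and> \<omega> e"
      using p(3) nm by (auto simp: walk_edges_def len walk open_adj_def)
  qed (rule len)
qed

text \<open>Union bound over the at most \<open>4 ^ n\<close> self-avoiding walks from the origin:
  such a walk has \<open>n\<close> distinct edges, and each can be open only if its label is at most
  \<open>t\<close>, whatever the gates do.\<close>

lemma theta_tilde_le_power:
  assumes "0 \<le> t" "t \<le> 1"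
  shows "theta_tilde n t \<le> (4 * t) ^ n"
proof -
  define D where "D = {ds. set ds \<subseteq> steps \<and> length ds = n}"
  define G where "G = {ds \<in> D. inj_on (walk ds) {..n} \<and> walk_edges ds \<subseteq> edges}"
  have "finite steps" "card steps = 4" by (simp_all add: steps_def)
  then have D: "finite D" "card D = 4 ^ n"
    unfolding D_def by (simp_all add: finite_lists_length_eq card_lists_length_eq)
  then have G: "finite G" "card G \<le> 4 ^ n"
    using card_mono[of D G] by (auto simp: G_def)
  define E where "E ds = {U \<in> space unif_space. \<forall>e\<in>walk_edges ds. U e \<in> {0..t}}" for ds
  have E: "measure unif_space (E ds) = t ^ n" if "ds \<in> G" for ds
  proof -
    have "measure unif_space (E ds) = (\<Prod>e\<in>walk_edges ds. measure lborel {0..t})"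
      unfolding E_def using that assms
      by (intro prob_edges) (auto simp: G_def walk_edges_def)
    also have "\<dots> = t ^ n"
      using card_walk_edges[of ds] that assms by (simp add: G_def D_def)
    finally show ?thesis .
  qed
  have setsE: "E ds \<in> sets unif_space" if "ds \<in> G" for ds
    unfolding E_def
  proof (rule sets.sets_Collect_finite_All)
    fix e assume "e \<in> walk_edges ds"
    then have [measurable]: "(\<lambda>U. U e) \<in> borel_measurable unif_space"
      using that by (intro measurable_edge_label) (auto simp: G_def)
    show "{U \<in> space unif_space. U e \<in> {0..t}} \<in> sets unif_space" by measurable
  qed (simp add: walk_edges_def)
  have "theta_tilde n t \<le> measure unif_space (\<Union>ds\<in>G. E ds)"
    unfolding theta_tilde_eq reach_prob_def
  proof (intro U.finite_measure_mono subsetI)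
    fix U assume "U \<in> {U \<in> space unif_space. reaches_distance (0, 0) n (omega_tilde t U)}"
    then have U: "U \<in> space unif_space" and r: "reaches_distance (0, 0) n (omega_tilde t U)" by auto
    obtain ds where ds: "set ds \<subseteq> steps" "length ds = n" "inj_on (walk ds) {..n}"
      "\<And>e. e \<in> walk_edges ds \<Longrightarrow> e \<in> edges \<and> omega_tilde t U e"
      using open_walk_exists[OF r] by blast
    then have "ds \<in> G" by (auto simp: G_def D_def)
    moreover have "U e \<in> {0..t}" if "e \<in> walk_edges ds" for e
      using ds(4)[OF that] edge_label_bounds[OF U, of e] by (auto simp: omega_tilde_def)
    ultimately show "U \<in> (\<Union>ds\<in>G. E ds)" using U by (auto simp: E_def)
  qed (use G setsE in auto)
  also have "\<dots> \<le> (\<Sum>ds\<in>G. measure unif_space (E ds))"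
    by (rule U.finite_measure_subadditive_finite) (use G setsE in auto)
  also have "\<dots> = real (card G) * t ^ n" by (simp add: E)
  also have "\<dots> \<le> 4 ^ n * t ^ n" using G(2) assms by (intro mult_right_mono) (auto simp flip: of_nat_power_le_of_nat_cancel_iff)
  finally show ?thesis by (simp add: power_mult_distrib)
qed

section \<open>Passage from large boxes to the infinite cluster\<close>

lemma connects_to_infinity_eq: "connects_to_infinity = (\<Inter>n. connects_to (bdry (lattice_box n)))"
proof (intro set_eqI iffI)
  fix \<omega> assume \<omega>: "\<omega> \<in> connects_to_infinity"
  have "reaches_distance (0, 0) n \<omega>" for n
  proof -
    have "\<not> cluster \<omega> \<subseteq> lattice_box n"
      using \<omega> finite_subset[of "cluster \<omega>" "lattice_box n"]
      by (auto simp: connects_to_infinity_def lattice_box_def)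
    then obtain x where x: "x \<in> cluster \<omega>" "\<not> sup_norm x \<le> int n" by (auto simp: lattice_box_eq)
    then show ?thesis
      by (intro reaches_distanceI[of _ x]) (auto simp: cluster_def zero_prod_def[symmetric])
  qed
  then show "\<omega> \<in> (\<Inter>n. connects_to (bdry (lattice_box n)))"
    using \<omega> by (auto simp: connects_to_bdry_iff connects_to_infinity_def)
next
  fix \<omega> assume "\<omega> \<in> (\<Inter>n. connects_to (bdry (lattice_box n)))"
  then have \<omega>: "\<omega> \<in> space config_space" "reaches_distance (0, 0) n \<omega>" for n
    by (auto simp: connects_to_bdry_iff)
  have "int n \<in> sup_norm ` cluster \<omega>" for n
  proof -
    obtain w where "sup_norm w = int n" "(0, w) \<in> (open_adj \<omega>)\<^sup>*"
      using \<omega>(2)[of n] by (auto simp: reaches_distance_def zero_prod_def[symmetric])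
    then show ?thesis
      by (intro image_eqI[of _ _ w]) (auto simp: cluster_def zero_prod_def[symmetric])
  qed
  then have "range int \<subseteq> sup_norm ` cluster \<omega>" by auto
  moreover have "infinite (range int)" by (simp add: range_inj_infinite)
  ultimately have "infinite (cluster \<omega>)" by (meson finite_imageI finite_subset)
  then show "\<omega> \<in> connects_to_infinity" using \<omega> by (simp add: connects_to_infinity_def)
qed

lemma theta_tilde_LIMSEQ: "(\<lambda>n. theta_tilde n t) \<longlonglongrightarrow> measure (P_tilde t) connects_to_infinity"
proof -
  interpret P: prob_space "P_tilde t" by (rule prob_space_P_tilde)
  have "decseq (\<lambda>n. connects_to (bdry (lattice_box n)))"
    unfolding decseq_def by (auto simp: connects_to_bdry_iff intro: reaches_distance_antimono)
  moreover have "range (\<lambda>n. connects_to (bdry (lattice_box n))) \<subseteq> sets (P_tilde t)"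
    by (auto simp: P_tilde_def sets_connects_to)
  ultimately show ?thesis
    unfolding connects_to_infinity_eq theta_tilde_def by (intro P.finite_Lim_measure_decseq)
qed

lemma theta_tilde_mono: "s \<le> t \<Longrightarrow> theta_tilde n s \<le> theta_tilde n t"
  unfolding theta_tilde_eq reach_prob_def
proof (intro U.finite_measure_mono subsetI sets_omega_reaches)
  fix U assume "s \<le> t" and U: "U \<in> {U \<in> space unif_space. reaches_distance (0, 0) n (omega_tilde s U)}"
  then have "omega_tilde s U \<le> omega_tilde t U" by (auto simp: omega_tilde_def le_fun_def)
  with U show "U \<in> {U \<in> space unif_space. reaches_distance (0, 0) n (omega_tilde t U)}"
    by (auto intro: reaches_distance_mono)
qed

lemma theta_tilde_0: "theta_tilde 0 t = 1"
proof -
  have "reaches_distance (0, 0) 0 \<omega>" for \<omega>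
    by (rule reaches_distanceI[of _ "(0, 0)"]) auto
  then show ?thesis by (simp add: theta_tilde_eq reach_prob_def U.prob_space)
qed

section \<open>Sharpness\<close>

text \<open>After a block translation the start lies in \<open>Lam 0 0\<close>. Resampling the block
  of the origin makes it fully open with probability at least \<open>(t / 2) ^ 60\<close>,
  independently of the other blocks, and then \<open>opened_block_reaches\<close> applies.\<close>

lemma reach_prob_le_theta:
  assumes t: "0 < t" "t \<le> 1"
  shows "reach_prob v m t \<le> theta_tilde (m - 5) t / (t / 2) ^ 60"
proof -
  define a where "a = (t / 2) ^ 60"
  have a: "0 < a" "a \<le> 1" using t by (auto simp: a_def intro: power_le_one)
  define r s where "r = fst v div 6" and "s = snd v div 5"
  define u where "u = (fst v mod 6, snd v mod 5)"
  have "v = u + block_shift r s" by (simp add: u_def r_def s_def block_shift_def prod_eq_iff)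
  then have v: "reach_prob v m t = reach_prob u m t" by (simp add: reach_prob_translate)
  have u: "u \<in> Lam 0 0"
    using pos_mod_bound[of 6 "fst v"] pos_mod_bound[of 5 "snd v"] by (auto simp: u_def Lam_eq)
  have "a * reach_prob u m t \<le> theta_tilde (m - 5) t"
  proof (cases "m \<le> 5")
    \<comment> \<open>Here \<open>m - 5\<close> is 0 by truncated subtraction, and
      \<open>theta_tilde 0 t\<close> is 1.\<close>
    case True
    have "a * reach_prob u m t \<le> 1 * 1"
      using a by (intro mult_mono) (auto simp: reach_prob_def)
    then show ?thesis using True by (simp add: theta_tilde_0)
  next
    case False
    define k where "k = m - 5"
    have m: "m = k + 5" using False by (simp add: k_def)
    let ?b = "(0, 0) :: int \<times> int"
    let ?top = "\<lambda>e. e \<in> block_edges ?b"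
    define I where "I = insert ?b (box_blocks k)"
    have I: "finite I" "box_blocks k \<subseteq> I" "?b \<in> I" by (auto simp: I_def finite_box_blocks)
    interpret W: finite_product configs "config_weight t" by (rule finite_product_configs)
    define Q where "Q x = box_reach k (x(?b := ?top))" for x
    have dep: "Q x = Q y" if "\<And>b. b \<in> I \<Longrightarrow> x b = y b" for x y
      unfolding Q_def by (rule depends_on_box_reach) (use that in \<open>auto simp: I_def\<close>)
    have "reach_prob u m t \<le> prob_unif (\<lambda>U. Q (block_config t U))"
      unfolding reach_prob_config
    proof (intro U.finite_measure_mono subsetI sets_config_event[OF I(1) dep])
      fix U assume "U \<in> {U \<in> space unif_space. reaches_distance u m (glue (block_config t U))}"
      then show "U \<in> {U \<in> space unif_space. Q (block_config t U)}"
        using opened_block_reaches[OF _ u, of k "block_config t U"] by (simp add: Q_def m)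
    qed
    also have "\<dots> = W.expect I (\<lambda>y. of_bool (Q y)) bot" by (rule prob_config_event[OF I(1) dep])
    finally have 1: "reach_prob u m t \<le> W.expect I (\<lambda>y. of_bool (Q y)) bot" .
    have "a * reach_prob u m t \<le> a * W.expect I (\<lambda>y. of_bool (Q y)) bot" using 1 a by simp
    also have "\<dots> = W.expect I (\<lambda>y. a * of_bool (Q y)) bot" by (simp add: W.expect_cmult)
    also have "\<dots> \<le> W.expect I (\<lambda>y. \<Sum>c\<in>configs ?b. config_weight t ?b c * of_bool (box_reach k (y(?b := c)))) bot"
    proof (rule W.expect_mono)
      fix y
      have "a * of_bool (Q y) \<le> config_weight t ?b ?top * of_bool (box_reach k (y(?b := ?top)))"
        using config_weight_all_open[of t ?b] t by (simp add: Q_def a_def)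
      also have "\<dots> \<le> (\<Sum>c\<in>configs ?b. config_weight t ?b c * of_bool (box_reach k (y(?b := c))))"
        by (rule member_le_sum[of ?top "configs ?b" "\<lambda>c. config_weight t ?b c * of_bool (box_reach k (y(?b := c)))"])
           (auto simp: configs_def finite_configs[unfolded configs_def] config_weight_def)
      finally show "a * of_bool (Q y) \<le> (\<Sum>c\<in>configs ?b. config_weight t ?b c * of_bool (box_reach k (y(?b := c))))" .
    qed
    also have "\<dots> = W.expect I (\<lambda>y. of_bool (box_reach k y)) bot"
      by (rule W.expect_resample[OF I(1,3), symmetric])
    also have "\<dots> = theta_tilde k t" by (rule theta_tilde_expect[OF I(1,2), symmetric])
    finally show ?thesis by (simp add: k_def)
  qed
  then show ?thesis using a unfolding v a_def[symmetric] by (simp add: pos_le_divide_eq mult.commute)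
qed

lemma theta_tilde_nonneg: "0 \<le> theta_tilde n t"
  by (simp add: theta_tilde_def)

lemma theta_tilde_le_1: "theta_tilde n t \<le> 1"
  unfolding theta_tilde_eq reach_prob_def by (rule U.prob_le_1)

text \<open>The six indices \<open>m \<le> 5\<close> contribute 1 each, the others at most the sum
  \<open>S\<close> on the right without its first term 1. Then \<open>5 + S \<le> 6 * S\<close>
  because \<open>S\<close> is at least 1.\<close>

lemma sum_theta_tilde_shift:
  assumes "1 \<le> n"
  shows "(\<Sum>m\<le>n. theta_tilde (m - 5) t) \<le> 6 * (\<Sum>j<n. theta_tilde j t)"
proof -
  let ?S = "\<Sum>j<n. theta_tilde j t"
  have "(\<Sum>m\<le>n. theta_tilde (m - 5) t)
    \<le> (\<Sum>m\<in>{..5} \<union> (\<lambda>j. j + 5) ` {1..<n}. theta_tilde (m - 5) t)"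
  proof (rule sum_mono2)
    show "{..n} \<subseteq> {..5} \<union> (\<lambda>j. j + 5) ` {1..<n}"
    proof
      fix m assume m: "m \<in> {..n}"
      show "m \<in> {..5} \<union> (\<lambda>j. j + 5) ` {1..<n}"
      proof (cases "m \<le> 5")
        case False
        then show ?thesis using m by (intro UnI2 image_eqI[of _ _ "m - 5"]) auto
      qed simp
    qed
  qed (auto simp: theta_tilde_nonneg)
  also have "\<dots> = (\<Sum>m\<le>5. theta_tilde (m - 5) t) + (\<Sum>m\<in>(\<lambda>j. j + 5) ` {1..<n}. theta_tilde (m - 5) t)"
    by (rule sum.union_disjoint) auto
  also have "(\<Sum>m\<le>5. theta_tilde (m - 5) t) = 6" by (simp add: theta_tilde_0)
  also have "(\<Sum>m\<in>(\<lambda>j. j + 5) ` {1..<n}. theta_tilde (m - 5) t) = (\<Sum>j=1..<n. theta_tilde j t)"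
    by (subst sum.reindex) (auto simp: inj_on_def)
  also have "\<dots> = ?S - 1"
    using assms sum.atLeast_Suc_lessThan[of 0 n "\<lambda>j. theta_tilde j t"]
    by (simp add: atLeast0LessThan theta_tilde_0)
  finally have "(\<Sum>m\<le>n. theta_tilde (m - 5) t) \<le> 5 + ?S" by simp
  moreover have "1 \<le> ?S"
    using member_le_sum[of 0 "{..<n}" "\<lambda>j. theta_tilde j t"] assms by (simp add: theta_tilde_nonneg theta_tilde_0)
  ultimately show ?thesis by linarith
qed

text \<open>Each distance arises from at most one \<open>k \<le> d\<close> and at most one
  \<open>k > d\<close>, so \<open>sum_theta_tilde_shift\<close> is used twice.\<close>

lemma sum_theta_tilde_distance:
  assumes "1 \<le> n" "d \<le> n"
  shows "(\<Sum>k=1..n. theta_tilde (nat \<bar>int k - int d\<bar> - 5) t) \<le> 12 * (\<Sum>j<n. theta_tilde j t)"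
proof -
  let ?g = "\<lambda>m. theta_tilde (m - 5) t"
  have "{1..n} = {1..d} \<union> {d<..n}" using assms(2) by auto
  then have "(\<Sum>k=1..n. ?g (nat \<bar>int k - int d\<bar>))
      = (\<Sum>k=1..d. ?g (nat \<bar>int k - int d\<bar>)) + (\<Sum>k\<in>{d<..n}. ?g (nat \<bar>int k - int d\<bar>))"
    by (simp add: sum.union_disjoint ivl_disj_int)
  also have "(\<Sum>k=1..d. ?g (nat \<bar>int k - int d\<bar>)) = (\<Sum>m\<in>(\<lambda>k. d - k) ` {1..d}. ?g m)"
    by (subst sum.reindex) (auto simp: inj_on_def nat_diff_distrib' abs_if of_nat_diff intro!: sum.cong)
  also have "\<dots> \<le> (\<Sum>m\<le>n. ?g m)"
    using assms by (intro sum_mono2) (auto simp: theta_tilde_nonneg)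
  also have "(\<Sum>k\<in>{d<..n}. ?g (nat \<bar>int k - int d\<bar>)) = (\<Sum>m\<in>(\<lambda>k. k - d) ` {d<..n}. ?g m)"
    by (subst sum.reindex) (auto simp: inj_on_def nat_diff_distrib' intro!: sum.cong)
  also have "\<dots> \<le> (\<Sum>m\<le>n. ?g m)"
    by (intro sum_mono2) (auto simp: theta_tilde_nonneg)
  finally show ?thesis using sum_theta_tilde_shift[OF assms(1), of t] by simp
qed

lemma explored_prob:
  assumes "0 < t" "t \<le> 1"
  shows "prob_unif (\<lambda>U. b \<in> explored n k (block_config t U))
    \<le> (\<Sum>v\<in>{v\<in>block_vertices b. sup_norm v \<le> int n}.
        theta_tilde (nat \<bar>int k - sup_norm v\<bar> - 5) t / (t / 2) ^ 60)"
proof -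
  let ?V = "{v\<in>block_vertices b. sup_norm v \<le> int n}"
  let ?m = "\<lambda>v. nat \<bar>int k - sup_norm v\<bar>"
  let ?R = "\<lambda>v. {U \<in> space unif_space. reaches_distance v (?m v) (omega_tilde t U)}"
  have "prob_unif (\<lambda>U. b \<in> explored n k (block_config t U)) \<le> measure unif_space (\<Union>v\<in>?V. ?R v)"
  proof (intro U.finite_measure_mono subsetI)
    fix U assume "U \<in> {U \<in> space unif_space. b \<in> explored n k (block_config t U)}"
    then have U: "U \<in> space unif_space" and "b \<in> explored n k (block_config t U)" by auto
    from explored_reaches[OF this(2)] obtain v where
      v: "v \<in> ?V" "reaches_distance v (?m v) (glue (block_config t U))" by blast
    then have "U \<in> ?R v"
      using U open_adj_glue_block_config[OF U, of t] by (simp add: reaches_distance_def)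
    then show "U \<in> (\<Union>v\<in>?V. ?R v)" using v(1) by blast
  qed (auto intro!: sets.finite_UN finite_block_vertices sets_omega_reaches)
  also have "\<dots> \<le> (\<Sum>v\<in>?V. measure unif_space (?R v))"
    by (rule U.finite_measure_subadditive_finite) (auto simp: finite_block_vertices sets_omega_reaches)
  also have "\<dots> \<le> (\<Sum>v\<in>?V. theta_tilde (?m v - 5) t / (t / 2) ^ 60)"
    using reach_prob_le_theta[OF assms] unfolding reach_prob_def by (intro sum_mono)
  finally show ?thesis .
qed

text \<open>Comparing the two extreme states makes the value independent of the present state of
  block \<open>b\<close>, as \<open>expect_increment\<close> demands of \<open>piv\<close>. By
  monotonicity, any change of the event caused by resampling the block forces the value 1.\<close>

definition pivotal :: "nat \<Rightarrow> int \<times> int \<Rightarrow> (int \<times> int \<Rightarrow> edge \<Rightarrow> bool) \<Rightarrow> real" where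
  "pivotal n b y = of_bool (\<not> box_reach n (y(b := bot)) \<and> box_reach n (y(b := (\<lambda>e. e \<in> block_edges b))))"

lemma total_pivotal_bound:
  assumes t: "0 < t" "t \<le> 1" and n: "1 \<le> n"
  shows "real n * (theta_tilde n t * (1 - theta_tilde n t)) \<le>
    504 * (\<Sum>j<n. theta_tilde j t) / (t / 2) ^ 60 *
      (\<Sum>b\<in>box_blocks n. finite_product.expect configs (config_weight t) (box_blocks n) (pivotal n b) bot)"
proof -
  interpret finite_product configs "config_weight t" by (rule finite_product_configs)
  interpret W: finite_product_bot configs "config_weight t" ..
  define I where "I = box_blocks n"
  have I: "finite I" by (simp add: I_def finite_box_blocks)
  define f where "f y = (of_bool (box_reach n y) :: real)" for y
  define \<delta> where "\<delta> k b = expect I (\<lambda>y. of_bool (b \<in> explored n k y)) bot" for k b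
  define S where "S = (\<Sum>j<n. theta_tilde j t)"
  define a where "a = (t / 2) ^ 60"
  have a: "0 < a" using t by (simp add: a_def)
  have \<theta>: "expect I f bot = theta_tilde n t"
    unfolding f_def I_def by (rule theta_tilde_expect[symmetric]) (auto simp: finite_box_blocks)
  have dep: "depends_on I f"
    unfolding depends_on_def f_def I_def
  proof (intro allI impI)
    fix x y :: "int \<times> int \<Rightarrow> edge \<Rightarrow> bool"
    assume "\<forall>b\<in>box_blocks n. x b = y b"
    then have "box_reach n x = box_reach n y" by (intro depends_on_box_reach) blast
    then show "(of_bool (box_reach n x) :: real) = of_bool (box_reach n y)" by simp
  qed
  have infl: "influence I b f bot \<le> expect I (pivotal n b) bot" if b: "b \<in> I" for b
    unfolding influence_def
  proof (rule expect_mono)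
    fix y assume y: "y \<in> completions I bot"
    have le: "y(b := bot) \<le> y(b := c)" "y(b := c) \<le> y(b := (\<lambda>e. e \<in> block_edges b))"
      if "c \<in> configs b" for c
      using that by (auto simp: le_fun_def configs_def)
    have yb: "y b \<in> configs b" using y b by (simp add: completions_def)
    have "\<bar>f y - f (y(b := c))\<bar> \<le> pivotal n b y" if c: "c \<in> configs b" for c
      using box_reach_mono[of n, OF _ le(1)[OF c]] box_reach_mono[of n, OF _ le(2)[OF c]]
        box_reach_mono[of n, OF _ le(1)[OF yb]] box_reach_mono[of n, OF _ le(2)[OF yb]]
      by (auto simp: f_def pivotal_def)
    then have "(\<Sum>c\<in>configs b. config_weight t b c * \<bar>f y - f (y(b := c))\<bar>)
      \<le> (\<Sum>c\<in>configs b. config_weight t b c * pivotal n b y)"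
      by (intro sum_mono mult_left_mono w_nonneg)
    then show "(\<Sum>c\<in>configs b. config_weight t b c * \<bar>f y - f (y(b := c))\<bar>) \<le> pivotal n b y"
      by (simp add: sum_distrib_right[symmetric] w_sum)
  qed
  have \<delta>_nonneg: "0 \<le> \<delta> k b" for k b unfolding \<delta>_def by (rule expect_nonneg) simp
  have OSSS: "theta_tilde n t * (1 - theta_tilde n t) \<le> (\<Sum>b\<in>I. \<delta> k b * expect I (pivotal n b) bot)"
    if k: "k \<le> n" for k
  proof -
    \<comment> \<open>OSSS with both functions equal to the indicator of the event, so that the
      left-hand side is its variance.\<close>
    have "\<bar>expect I (\<lambda>y. f y * f y) bot - expect I f bot * expect I f bot\<bar>
      \<le> (\<Sum>b\<in>I. expect I (\<lambda>y. of_bool (b \<in> explored n k y)) bot * influence I b f bot)"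
    proof (rule W.OSSS_state[OF I _ _ _ dep])
      show "x \<le> y \<Longrightarrow> explored n k x \<subseteq> explored n k y" for x y by (rule explored_mono)
      show "f y = f x" if "\<And>i. i \<in> explored n k x \<Longrightarrow> y i = x i" for x y
        unfolding f_def using box_reach_explored[OF k, of x y] that by simp
    qed (simp add: f_def)
    moreover have "f y * f y = f y" for y by (simp add: f_def)
    ultimately have "theta_tilde n t * (1 - theta_tilde n t) \<le> (\<Sum>b\<in>I. \<delta> k b * influence I b f bot)"
      by (simp add: \<theta> \<delta>_def right_diff_distrib)
    also have "\<dots> \<le> (\<Sum>b\<in>I. \<delta> k b * expect I (pivotal n b) bot)"
      by (intro sum_mono mult_left_mono infl \<delta>_nonneg)
    finally show ?thesis .
  qed
  \<comment> \<open>\<open>504 = 42 * 12\<close>: a block has 42 vertices, and each contributes at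
    most \<open>12 * S / a\<close> to the sum over all radii \<open>k\<close>.\<close>
  have sum_\<delta>: "(\<Sum>k=1..n. \<delta> k b) \<le> 504 * S / a" for b
  proof -
    let ?V = "{v\<in>block_vertices b. sup_norm v \<le> int n}"
    have "\<delta> k b \<le> (\<Sum>v\<in>?V. theta_tilde (nat \<bar>int k - sup_norm v\<bar> - 5) t / a)" for k
    proof -
      have "\<delta> k b = prob_unif (\<lambda>U. b \<in> explored n k (block_config t U))"
        unfolding \<delta>_def
      proof (rule prob_config_event[OF I, symmetric])
        show "(b \<in> explored n k x) = (b \<in> explored n k y)" if "\<And>b. b \<in> I \<Longrightarrow> x b = y b" for x y
          using depends_on_explored[of n x y k] that by (simp add: I_def)
      qed
      then show ?thesis using explored_prob[OF t, of b n k] by (simp add: a_def)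
    qed
    then have "(\<Sum>k=1..n. \<delta> k b) \<le> (\<Sum>k=1..n. \<Sum>v\<in>?V. theta_tilde (nat \<bar>int k - sup_norm v\<bar> - 5) t / a)"
      by (intro sum_mono)
    also have "\<dots> = (\<Sum>v\<in>?V. (\<Sum>k=1..n. theta_tilde (nat \<bar>int k - sup_norm v\<bar> - 5) t) / a)"
      by (subst sum.swap) (simp add: sum_divide_distrib)
    also have "\<dots> \<le> (\<Sum>v\<in>?V. 12 * S / a)"
    proof (intro sum_mono divide_right_mono)
      fix v assume "v \<in> ?V"
      then have "nat (sup_norm v) \<le> n" "sup_norm v = int (nat (sup_norm v))"
        using sup_norm_nonneg[of v] by auto
      then show "(\<Sum>k=1..n. theta_tilde (nat \<bar>int k - sup_norm v\<bar> - 5) t) \<le> 12 * S"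
        using sum_theta_tilde_distance[OF n, of "nat (sup_norm v)" t] by (simp add: S_def)
    qed (use a in simp)
    also have "\<dots> = real (card ?V) * (12 * S / a)" by simp
    also have "\<dots> \<le> 42 * (12 * S / a)"
    proof (rule mult_right_mono)
      have "card ?V \<le> card (block_vertices b)" by (rule card_mono[OF finite_block_vertices]) auto
      then show "real (card ?V) \<le> 42" by (simp add: card_block_vertices)
      show "0 \<le> 12 * S / a" using a by (simp add: S_def sum_nonneg theta_tilde_nonneg)
    qed
    finally show ?thesis by simp
  qed
  have "real n * (theta_tilde n t * (1 - theta_tilde n t))
    = (\<Sum>k=1..n. theta_tilde n t * (1 - theta_tilde n t))" by simp
  also have "\<dots> \<le> (\<Sum>k=1..n. \<Sum>b\<in>I. \<delta> k b * expect I (pivotal n b) bot)"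
    by (intro sum_mono OSSS) simp
  also have "\<dots> = (\<Sum>b\<in>I. (\<Sum>k=1..n. \<delta> k b) * expect I (pivotal n b) bot)"
    by (subst sum.swap) (simp add: sum_distrib_right)
  also have "\<dots> \<le> (\<Sum>b\<in>I. 504 * S / a * expect I (pivotal n b) bot)"
    by (intro sum_mono mult_right_mono sum_\<delta> expect_nonneg) (simp add: pivotal_def)
  also have "\<dots> = 504 * S / a * (\<Sum>b\<in>I. expect I (pivotal n b) bot)" by (simp add: sum_distrib_left)
  finally show ?thesis by (simp add: S_def a_def I_def)
qed

lemma theta_tilde_increment:
  assumes lohi: "0 < lo" "hi < 1" and n: "1 \<le> n"
  shows "\<exists>K\<ge>0. \<forall>t h. lo \<le> t \<longrightarrow> 0 < h \<longrightarrow> t + h \<le> hi \<longrightarrow>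
    min (lo / 2) (1 - hi) ^ 60 * h * (\<Sum>b\<in>box_blocks n. finite_product.expect configs (config_weight t) (box_blocks n) (pivotal n b) bot)
      - K * h\<^sup>2 \<le> theta_tilde n (t + h) - theta_tilde n t"
proof (cases "lo \<le> hi")
  case True
  define I where "I = box_blocks n"
  have I: "finite I" by (simp add: I_def finite_box_blocks)
  define c where "c = min (lo / 2) (1 - hi) ^ 60"
  have c: "0 \<le> c" using lohi by (simp add: c_def)
  define f where "f y = (of_bool (box_reach n y) :: real)" for y
  have piv: "0 \<le> pivotal n b y \<and> pivotal n b y \<le> 1" "pivotal n b (y(b := c)) = pivotal n b y" for b y c
    by (auto simp: pivotal_def)
  \<comment> \<open>The 60 is the Lipschitz constant from \<open>config_weight_close\<close>.
    \<open>K\<close> is fixed before \<open>t\<close> and \<open>h\<close>, so it serves all of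
    them.\<close>
  obtain K where K: "0 \<le> K" and incr: "\<forall>w w' \<eta> x. finite_product configs w \<longrightarrow> finite_product configs w' \<longrightarrow> 0 \<le> \<eta> \<longrightarrow>
      (\<forall>i\<in>I. \<forall>a\<in>configs i. \<bar>w' i a - w i a\<bar> \<le> 60 * \<eta>) \<longrightarrow>
      (\<forall>i\<in>I. \<forall>y. c * \<eta> * pivotal n i y \<le> (\<Sum>a\<in>configs i. (w' i a - w i a) * f (y(i := a)))) \<longrightarrow>
      c * \<eta> * (\<Sum>i\<in>I. finite_product.expect configs w I (pivotal n i) x) - K * \<eta>\<^sup>2
        \<le> finite_product.expect configs w' I f x - finite_product.expect configs w I f x"
    by (rule exE[OF expect_increment[where L = I and c = c and \<kappa> = 60 and piv = "pivotal n" and A = configs and f = f]])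
       (use I c piv in simp_all, blast)
  have \<theta>: "finite_product.expect configs (config_weight t) I f bot = theta_tilde n t" for t
    unfolding f_def I_def by (rule theta_tilde_expect[symmetric]) (auto simp: finite_box_blocks)
  show ?thesis
  proof (intro exI[of _ K] conjI allI impI K)
    fix t h assume th: "lo \<le> t" "0 < h" "t + h \<le> hi"
    have "c * h * (\<Sum>i\<in>I. finite_product.expect configs (config_weight t) I (pivotal n i) bot) - K * h\<^sup>2
        \<le> finite_product.expect configs (config_weight (t + h)) I f bot - finite_product.expect configs (config_weight t) I f bot"
    proof (rule incr[rule_format, OF finite_product_configs finite_product_configs])
      show "0 \<le> h" using th by simp
      show "\<bar>config_weight (t + h) i a - config_weight t i a\<bar> \<le> 60 * h" for i a
        using th lohi by (intro config_weight_close) auto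
      fix b y
      define F where "F a = box_reach n (y(b := a))" for a
      have F_mono: "F a'" if "a \<le> a'" "F a" for a a'
      proof -
        have "y(b := a) \<le> y(b := a')" using that(1) by (auto simp: le_fun_def)
        then show ?thesis using that(2) box_reach_mono unfolding F_def by blast
      qed
      show "c * h * pivotal n b y \<le> (\<Sum>a\<in>configs b. (config_weight (t + h) b a - config_weight t b a) * f (y(b := a)))"
      proof (cases "\<not> F bot \<and> F (\<lambda>e. e \<in> block_edges b)")
        case True
        then have "c * h \<le> (\<Sum>a\<in>configs b. (config_weight (t + h) b a - config_weight t b a) * of_bool (F a))"
          unfolding c_def using lohi th F_mono
          by (intro config_weight_increment) (auto simp: bot_fun_def)
        then show ?thesis using True by (simp add: f_def F_def pivotal_def)
      next
        case False
        then have "pivotal n b y = 0" by (simp add: pivotal_def F_def)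
        moreover have "0 \<le> (\<Sum>a\<in>configs b. (config_weight (t + h) b a - config_weight t b a) * of_bool (F a))"
          using th F_mono by (intro config_weight_mono) auto
        ultimately show ?thesis by (simp add: f_def F_def)
      qed
    qed
    then show "min (lo / 2) (1 - hi) ^ 60 * h * (\<Sum>b\<in>box_blocks n. finite_product.expect configs (config_weight t) (box_blocks n) (pivotal n b) bot)
      - K * h\<^sup>2 \<le> theta_tilde n (t + h) - theta_tilde n t"
      by (simp add: c_def I_def[symmetric] \<theta>)
  qed
next
  case False
  then show ?thesis by (intro exI[of _ 0]) auto
qed

lemma sharp_sequence_theta_tilde:
  assumes lohi: "0 < lo" "hi < 1"
  shows "\<exists>c. sharp_sequence theta_tilde lo hi c"
proof (cases "lo \<le> hi")
  case True
  define c0 where "c0 = min (lo / 2) (1 - hi) ^ 60"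
  \<comment> \<open>Collects the growth rate \<open>c0\<close> per pivotal block, the lower bound
    \<open>(1 - hi) ^ 4\<close> for \<open>1 - theta_tilde n t\<close>, and the constant of
    \<open>total_pivotal_bound\<close> at its worst value \<open>t = lo\<close>. None of them
    depends on \<open>n\<close>.\<close>
  define c where "c = c0 * ((1 - hi) ^ 4 * (lo / 2) ^ 60 / 504)"
  have c0: "0 < c0" using lohi by (simp add: c0_def)
  have c: "0 < c" using c0 lohi by (simp add: c_def)
  show ?thesis
  proof (intro exI[of _ c], unfold_locales)
    fix n :: nat assume n: "1 \<le> n"
    obtain K where K: "0 \<le> K" and incr: "\<And>t h. lo \<le> t \<Longrightarrow> 0 < h \<Longrightarrow> t + h \<le> hi \<Longrightarrow>
      c0 * h * (\<Sum>b\<in>box_blocks n. finite_product.expect configs (config_weight t) (box_blocks n) (pivotal n b) bot)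
      - K * h\<^sup>2 \<le> theta_tilde n (t + h) - theta_tilde n t"
      using theta_tilde_increment[OF lohi n] unfolding c0_def by blast
    show "\<exists>K\<ge>0. \<forall>t h. lo \<le> t \<longrightarrow> 0 < h \<longrightarrow> t + h \<le> hi \<longrightarrow>
        h * (c * real n / (\<Sum>k<n. theta_tilde k t)) * theta_tilde n t - K * h\<^sup>2
          \<le> theta_tilde n (t + h) - theta_tilde n t"
    proof (intro exI[of _ K] conjI allI impI K)
      fix t h assume th: "lo \<le> t" "0 < h" "t + h \<le> hi"
      define S where "S = (\<Sum>j<n. theta_tilde j t)"
      define P where "P = (\<Sum>b\<in>box_blocks n. finite_product.expect configs (config_weight t) (box_blocks n) (pivotal n b) bot)"
      have t: "0 < t" "t \<le> 1" using th lohi by auto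
      have "1 \<le> S" unfolding S_def
        using member_le_sum[of 0 "{..<n}" "\<lambda>j. theta_tilde j t"] n by (simp add: theta_tilde_nonneg theta_tilde_0)
      then have S: "0 < S" by simp
      have P0: "0 \<le> P" unfolding P_def
        by (intro sum_nonneg finite_product.expect_nonneg[OF finite_product_configs]) (simp add: pivotal_def)
      have "(1 - hi) ^ 4 \<le> (1 - t) ^ 4" using th lohi by (intro power_mono) auto
      then have gap: "(1 - hi) ^ 4 \<le> 1 - theta_tilde n t"
        using theta_tilde_less_1[of t n] t n by simp
      have "real n * (theta_tilde n t * (1 - hi) ^ 4) \<le> real n * (theta_tilde n t * (1 - theta_tilde n t))"
        using gap by (intro mult_left_mono theta_tilde_nonneg) auto
      also have "\<dots> \<le> 504 * S / (t / 2) ^ 60 * P"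
        unfolding S_def P_def by (rule total_pivotal_bound[OF t n])
      also have "\<dots> \<le> 504 * S / (lo / 2) ^ 60 * P"
        using th lohi t S P0 by (intro mult_right_mono divide_left_mono power_mono mult_pos_pos zero_less_power) auto
      finally have "real n * (theta_tilde n t * (1 - hi) ^ 4) \<le> 504 * S / (lo / 2) ^ 60 * P" .
      then have "real n * (theta_tilde n t * (1 - hi) ^ 4) * ((lo / 2) ^ 60 / (504 * S))
          \<le> 504 * S / (lo / 2) ^ 60 * P * ((lo / 2) ^ 60 / (504 * S))"
        using S lohi by (intro mult_right_mono) auto
      also have "\<dots> = P" using S lohi by (simp add: field_simps)
      finally have "h * (c0 * (real n * (theta_tilde n t * (1 - hi) ^ 4) * ((lo / 2) ^ 60 / (504 * S)))) \<le> h * (c0 * P)"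
        using th c0 by (intro mult_left_mono) auto
      moreover have "h * (c * real n / S) * theta_tilde n t
        = h * (c0 * (real n * (theta_tilde n t * (1 - hi) ^ 4) * ((lo / 2) ^ 60 / (504 * S))))"
        by (simp add: c_def)
      ultimately show "h * (c * real n / (\<Sum>k<n. theta_tilde k t)) * theta_tilde n t - K * h\<^sup>2
          \<le> theta_tilde n (t + h) - theta_tilde n t"
        using incr[OF th] unfolding S_def[symmetric] P_def[symmetric] by (simp add: mult_ac)
    qed
  qed (use c in \<open>auto simp: theta_tilde_nonneg theta_tilde_le_1 theta_tilde_0 theta_tilde_mono\<close>)
next
  case False
  have "sharp_sequence theta_tilde lo hi 1"
    by unfold_locales (use False in \<open>auto simp: theta_tilde_nonneg theta_tilde_le_1 theta_tilde_0 theta_tilde_mono intro!: exI[of _ 0]\<close>)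
  then show ?thesis by blast
qed

section \<open>The critical point and the two regimes\<close>

abbreviation percolation_prob :: "real \<Rightarrow> real" where
  "percolation_prob t \<equiv> measure (P_tilde t) connects_to_infinity"

lemma percolation_prob_mono: "s \<le> t \<Longrightarrow> percolation_prob s \<le> percolation_prob t"
  by (rule LIMSEQ_le[OF theta_tilde_LIMSEQ theta_tilde_LIMSEQ]) (auto intro: theta_tilde_mono)

lemma percolation_prob_below_quarter: "0 \<le> t \<Longrightarrow> t < 1 / 4 \<Longrightarrow> percolation_prob t = 0"
proof -
  assume t: "0 \<le> t" "t < 1 / 4"
  have "(\<lambda>n. (4 * t) ^ n) \<longlonglongrightarrow> 0" using t by (intro LIMSEQ_realpow_zero) auto
  then have "percolation_prob t \<le> 0"
  proof (rule LIMSEQ_le[OF theta_tilde_LIMSEQ])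
    show "\<exists>N. \<forall>n\<ge>N. theta_tilde n t \<le> (4 * t) ^ n"
      using t theta_tilde_le_power[of t] by auto
  qed
  then show ?thesis by (simp add: measure_le_0_iff)
qed

lemma t_c_star_bounds: "1 / 4 \<le> t_c_star" "t_c_star \<le> 1"
proof -
  let ?Z = "{t \<in> {0..1}. percolation_prob t = 0}"
  have bdd: "bdd_above ?Z" by (rule bdd_aboveI[of _ 1]) simp
  show "1 / 4 \<le> t_c_star"
  proof (rule dense_le_bounded[of 0])
    fix t :: real assume "0 < t" "t < 1 / 4"
    then show "t \<le> t_c_star"
      unfolding t_c_star_def by (intro cSup_upper bdd) (auto simp: percolation_prob_below_quarter)
  qed simp
  have "(0::real) \<in> ?Z" by (simp add: percolation_prob_below_quarter)
  then have "?Z \<noteq> {}" by blast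
  then show "t_c_star \<le> 1" unfolding t_c_star_def by (rule cSup_least) simp
qed

lemma percolation_prob_below: "t < t_c_star \<Longrightarrow> percolation_prob t = 0"
proof -
  let ?Z = "{t \<in> {0..1}. percolation_prob t = 0}"
  assume "t < t_c_star"
  moreover have "(0::real) \<in> ?Z" by (simp add: percolation_prob_below_quarter)
  ultimately obtain s where "s \<in> ?Z" "t < s"
    unfolding t_c_star_def using less_cSupD[of ?Z t] by blast
  then show ?thesis using percolation_prob_mono[of t s] by (simp add: measure_le_0_iff)
qed

lemma percolation_prob_above: "t_c_star < t \<Longrightarrow> t \<le> 1 \<Longrightarrow> 0 < percolation_prob t"
proof (rule ccontr)
  assume t: "t_c_star < t" "t \<le> 1" and "\<not> 0 < percolation_prob t"
  then have "t \<in> {t \<in> {0..1}. percolation_prob t = 0}"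
    using t_c_star_bounds by (simp add: measure_le_0_iff not_less)
  then have "t \<le> t_c_star" unfolding t_c_star_def by (intro cSup_upper bdd_aboveI[of _ 1]) auto
  with t show False by simp
qed

lemma subcritical_decay:
  assumes "t < t_c_star"
  shows "\<exists>c>0. \<forall>n\<ge>1. theta_tilde n t \<le> exp (- c * real n)"
proof -
  \<comment> \<open>The parameters will satisfy \<open>t < p < r < q < o' < t_c_star\<close>. The
    maximum with \<open>1 / 8\<close> keeps \<open>p\<close> positive even for \<open>t = 0\<close>,
    and there is room for it since \<open>1 / 4 \<le> t_c_star\<close>.\<close>
  obtain q where q: "max t (1 / 8) < q" "q < t_c_star"
    using dense[of "max t (1 / 8)" t_c_star] assms t_c_star_bounds by auto
  obtain r where r: "max t (1 / 8) < r" "r < q" using dense q(1) by blast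
  obtain p where p: "max t (1 / 8) < p" "p < r" using dense r(1) by blast
  obtain o' where o': "q < o'" "o' < t_c_star" using dense q(2) by blast
  have "o' < 1" using o' t_c_star_bounds by simp
  then obtain c where "sharp_sequence theta_tilde p o' c"
    using sharp_sequence_theta_tilde[of p o'] p by auto
  then interpret sharp_sequence theta_tilde p o' c .
  \<comment> \<open>Otherwise linear growth from \<open>q\<close> to \<open>o'\<close> would make
    the percolation probability positive at \<open>o'\<close>, below the threshold. So
    \<open>S n q\<close> is polynomially smaller than \<open>n\<close>, which is what
    \<open>exponential_decay\<close> starts from.\<close>
  have "\<exists>\<alpha>>0. \<not> (\<exists>\<^sub>F n in sequentially. real n powr (1 - \<alpha>) < S n q)"
  proof (rule ccontr)
    assume "\<not> (\<exists>\<alpha>>0. \<not> (\<exists>\<^sub>F n in sequentially. real n powr (1 - \<alpha>) < S n q))"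
    then have "c * (o' - q) \<le> percolation_prob o'"
      using p r o' by (intro linear_growth theta_tilde_LIMSEQ) auto
    then show False using percolation_prob_below[OF o'(2)] c_pos o'(1) by (simp add: mult_le_0_iff)
  qed
  then obtain \<alpha> where "0 < \<alpha>" "\<forall>\<^sub>F n in sequentially. S n q \<le> real n powr (1 - \<alpha>)"
    by (auto simp: not_frequently not_less)
  then obtain d where d: "0 < d" "\<And>n. 1 \<le> n \<Longrightarrow> theta_tilde n p \<le> exp (- d * real n)"
    using exponential_decay[of p r q \<alpha>] p r o' by auto
  show ?thesis
  proof (intro exI[of _ d] conjI allI impI d)
    fix n :: nat assume "1 \<le> n"
    have "theta_tilde n t \<le> theta_tilde n p" using p by (intro theta_tilde_mono) auto
    also have "\<dots> \<le> exp (- d * real n)" by (rule d(2)[OF \<open>1 \<le> n\<close>])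
    finally show "theta_tilde n t \<le> exp (- d * real n)" .
  qed
qed

text \<open>For \<open>s\<close> above the threshold, \<open>S n s\<close> is at least
  \<open>n\<close> times a positive percolation probability, which eventually beats
  \<open>n powr (1 - \<alpha>)\<close>. So \<open>linear_growth\<close> applies from each such
  \<open>s\<close> up to \<open>hi\<close>, with one constant \<open>c\<close>.\<close>

lemma supercritical_linear:
  assumes "t_c_star < 1"
  shows "\<exists>c>0. \<forall>t\<in>{0..1}. t > t_c_star \<longrightarrow> percolation_prob t \<ge> c * (t - t_c_star)"
proof -
  obtain hi where hi: "t_c_star < hi" "hi < 1" using dense[OF assms] by blast
  obtain c where "sharp_sequence theta_tilde (1 / 4) hi c"
    using sharp_sequence_theta_tilde[of "1 / 4" hi] hi by auto
  then interpret sharp_sequence theta_tilde "1 / 4" hi c .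
  have step: "c * (t - s) \<le> percolation_prob t" if st: "t_c_star < s" "s \<le> t" "t \<le> hi" for s t
  proof (rule linear_growth[OF _ st(2,3) _ theta_tilde_LIMSEQ])
    show "1 / 4 \<le> s" using st t_c_star_bounds by simp
    fix \<alpha> :: real assume \<alpha>: "0 < \<alpha>"
    define \<theta> where "\<theta> = percolation_prob s"
    have \<theta>: "0 < \<theta>" using percolation_prob_above[of s] st hi by (simp add: \<theta>_def)
    have "\<theta> \<le> theta_tilde k s" for k
    proof -
      have "decseq (\<lambda>k. theta_tilde k s)"
        unfolding decseq_def theta_tilde_eq reach_prob_def
        by (auto intro!: U.finite_measure_mono sets_omega_reaches intro: reaches_distance_antimono)
      then show ?thesis unfolding \<theta>_def by (rule decseq_ge[OF _ theta_tilde_LIMSEQ])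
    qed
    then have S: "real n * \<theta> \<le> S n s" for n
      using sum_mono[of "{..<n}" "\<lambda>_. \<theta>" "\<lambda>k. theta_tilde k s"] by simp
    have "\<forall>\<^sub>F n in sequentially. real n powr (1 - \<alpha>) < real n * \<theta>"
      using \<alpha> \<theta> by real_asymp
    then have "\<forall>\<^sub>F n in sequentially. real n powr (1 - \<alpha>) < S n s"
      by eventually_elim (rule less_le_trans[OF _ S])
    then show "\<exists>\<^sub>F n in sequentially. real n powr (1 - \<alpha>) < S n s"
      by (rule eventually_frequently[rotated]) simp
  qed
  \<comment> \<open>The constant does not depend on \<open>s\<close>, so \<open>s\<close> can tend
    to \<open>t_c_star\<close>.\<close>
  have near: "c * (t - t_c_star) \<le> percolation_prob t" if t: "t_c_star < t" "t \<le> hi" for t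
  proof -
    have "t - percolation_prob t / c \<le> t_c_star"
    proof (rule dense_ge_bounded[OF t(1)])
      fix s assume "t_c_star < s" "s < t"
      then have "c * (t - s) \<le> percolation_prob t" using t by (intro step) auto
      then have "t - s \<le> percolation_prob t / c" using c_pos by (simp add: pos_le_divide_eq mult.commute)
      then show "t - percolation_prob t / c \<le> s" by simp
    qed
    then have "t - t_c_star \<le> percolation_prob t / c" by simp
    then show ?thesis using c_pos by (simp add: pos_le_divide_eq mult.commute)
  qed
  \<comment> \<open>Beyond \<open>hi\<close> only monotonicity is available. With the extra factor
    \<open>hi - t_c_star\<close>, the bound at \<open>hi\<close> suffices up to
    \<open>t = 1\<close>.\<close>
  define d where "d = c * (hi - t_c_star)"
  have d: "0 < d" using hi c_pos by (simp add: d_def)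
  show ?thesis
  proof (intro exI[of _ d] conjI ballI impI d)
    fix t :: real assume t: "t \<in> {0..1}" "t_c_star < t"
    have small: "t - t_c_star \<le> 1" "hi - t_c_star \<le> 1" using t hi t_c_star_bounds by auto
    show "d * (t - t_c_star) \<le> percolation_prob t"
    proof (cases "t \<le> hi")
      case True
      have "d * (t - t_c_star) \<le> c * (t - t_c_star)"
        using small t c_pos by (intro mult_right_mono) (auto simp: d_def)
      also have "\<dots> \<le> percolation_prob t" using t True by (intro near) auto
      finally show ?thesis .
    next
      case False
      have "d * (t - t_c_star) \<le> d * 1" using small d by (intro mult_left_mono) auto
      also have "\<dots> \<le> percolation_prob hi" using near[of hi] hi by (simp add: d_def)
      also have "\<dots> \<le> percolation_prob t" using False by (intro percolation_prob_mono) simp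
      finally show ?thesis .
    qed
  qed
qed

theorem theorem3:
  "(\<forall>t\<in>{0..1}. t < t_c_star \<longrightarrow>
      (\<exists>c>0. \<forall>n\<ge>1. theta_tilde n t \<le> exp (- c * real n))) \<and>
   (\<exists>c>0. \<forall>t\<in>{0..1}. t > t_c_star \<longrightarrow>
      measure (P_tilde t) connects_to_infinity \<ge> c * (t - t_c_star))"
proof
  show "\<forall>t\<in>{0..1}. t < t_c_star \<longrightarrow> (\<exists>c>0. \<forall>n\<ge>1. theta_tilde n t \<le> exp (- c * real n))"
    using subcritical_decay by blast
  show "\<exists>c>0. \<forall>t\<in>{0..1}. t > t_c_star \<longrightarrow> percolation_prob t \<ge> c * (t - t_c_star)"
  proof (cases "t_c_star < 1")
    case True
    then show ?thesis by (rule supercritical_linear)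
  next
    \<comment> \<open>No parameter in \<open>[0, 1]\<close> lies above the threshold, so any
      positive constant will do.\<close>
    case False
    then show ?thesis by (intro exI[of _ 1]) auto
  qed
qed

end
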